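(* Let $\phi:\mathbb{R}\to[1,\infty)$ be a weight function, and let $\mathbf{D}$, $(\mathbf{D}_\phi,\mathcal{D}_\phi,\|\cdot\|_\phi)$ be as in the context. Let $f:\mathbf{D}(f)\to\mathbb{R}$ be a map defined on a set $\mathbf{D}(f)\subset\mathbf{D}$ of distribution functions of finite (not necessarily probability) Borel measures on $\mathbb{R}$. Let $F\in\mathbf{D}(f)$ be the distribution function of a Borel probability measure on $\mathbb{R}$, and let $\mathbf{C}_{\phi,F}\subseteq\mathbf{D}_\phi$ be a $\|\cdot\|_\phi$-separable subspace with $\mathbf{C}_{\phi,F}\in\mathcal{D}_\phi$. Let $(X_i)$ be a sequence of identically distributed real-valued random variables on a probability space $(\Omega,\mathcal{F},\mathbb{P})$ with distribution function $F$, and let $\widehat F_n:=\frac1n\sum_{i=1}^n\mathbf{1}_{[X_i,\infty)}$ be the empirical distribution function; assume $\widehat F_n$ takes values only in $\mathbf{D}(f)$. Let $(\Omega',\mathcal{F}',\mathbb{P}')$ be another probability space, $(\overline\Omega,\overline{\mathcal{F}},\overline{\mathbb{P}}):=(\Omega\times\Omega',\mathcal{F}\otimes\mathcal{F}',\mathbb{P}\otimes\mathbb{P}')$, and $\widehat F_n^*:\overline\Omega\to\mathbf{D}$ any map taking values only in $\mathbf{D}(f)$. Let $(a_n)$ be a sequence of positive real numbers tending to $\infty$, and consider the following conditions (range and measurability requirements for every $n\in\mathbb N$): (a) $a_n(\widehat F_n-F)$ takes values only in $\mathbf{D}_\phi$ and $a_n(\widehat F_n-F)\leadsto^\circ B$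 in $(\mathbf{D}_\phi,\mathcal{D}_\phi,\|\cdot\|_\phi)$ for some $(\mathbf{D}_\phi,\mathcal{D}_\phi)$-valued random variable $B$ on some probability space $(\Omega_0,\mathcal{F}_0,\mathbb{P}_0)$ with $B(\Omega_0)\subseteq\mathbf{C}_{\phi,F}$. (b) $f(\widehat F_n):\Omega\to\mathbb{R}$ is $(\mathcal{F},\mathcal{B}(\mathbb{R}))$-measurable. (c) $f$ is quasi-Hadamard differentiable at $F$ tangentially to $\mathbf{C}_{\phi,F}\langle\mathbf{D}_\phi\rangle$ with quasi-Hadamard derivative $\dot f_F$. (d) $\dot f_F$ can be extended from $\mathbf{C}_{\phi,F}$ to $\mathbf{D}_\phi$ such that the extension $\dot f_F:\mathbf{D}_\phi\to\mathbb{R}$ is linear, $(\mathcal{D}_\phi,\mathcal{B}(\mathbb{R}))$-measurable, and continuous at every point of $\mathbf{C}_{\phi,F}$. (e) $f(\widehat F_n^* ):\overline\Omega\to\mathbb{R}$ is $(\overline{\mathcal{F}},\mathcal{B}(\mathbb{R}))$-measurable. (f) $a_n(\widehat F_n^*-\widehat F_n)$ takes values only in $\mathbf{D}_\phi$ and is $(\overline{\mathcal{F}},\mathcal{D}_\phi)$-measurable, and for $\mathbb{P}$-a.e. $\omega$, $a_n(\widehat F_n^*(\omega,\cdot)-\widehat F_n(\omega))\leadsto^\circ B$ in $(\mathbf{D}_\phi,\mathcal{D}_\phi,\|\cdot\|_\phi)$, where the left-hand side is regarded as a random variable on $(\Omega',\mathcal{F}',\mathbb{P}')$. (f') $a_n(\widehat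 F_n^*-\widehat F_n)$ takes values only in $\mathbf{D}_\phi$ and is $(\overline{\mathcal{F}},\mathcal{D}_\phi)$-measurable, and with $P_n(\omega,\cdot):=\mathbb{P}'\circ\{a_n(\widehat F_n^*(\omega,\cdot)-\widehat F_n(\omega))\}^{-1}$, $$\lim_{n\to\infty}\mathbb{P}^{\mathsf{out}}[\{\omega\in\Omega:d_{\rm BL}^\circ(P_n(\omega,\cdot),\mathrm{law}\{B\})\ge\delta\}]=0\quad\text{for all }\delta>0.$$ Then the following assertions hold: (i) If (a)--(c) hold, then $a_n(f(\widehat F_n)-f(F))$ and $\dot f_F(B)$ are respectively $(\mathcal{F},\mathcal{B}(\mathbb{R}))$- and $(\mathcal{F}_0,\mathcal{B}(\mathbb{R}))$-measurable, and $a_n(f(\widehat F_n)-f(F))\leadsto\dot f_F(B)$ in $(\mathbb{R},\mathcal{B}(\mathbb{R}))$. (ii) If (a), (b), (c), (d), (e), (f) hold, then $a_n(f(\widehat F_n^* )-f(\widehat F_n))$ and $\dot f_F(B)$ are respectively $(\overline{\mathcal{F}},\mathcal{B}(\mathbb{R}))$- and $(\mathcal{F}_0,\mathcal{B}(\mathbb{R}))$-measurable, and with $\widetilde P_n(\omega,\cdot):=\mathbb{P}'\circ\{a_n(f(\widehat F_n^*(\omega,\cdot))-f(\widehat F_n(\omega)))\}^{-1}$, $$\lim_{n\to\infty}\mathbb{P}[\{\omega\in\Omega:\widetilde d_{\rm BL}(\widetilde P_n(\omega,\cdot),\mathrm{law}\{\dot f_F(B)\})\ge\delta\}]=0\quad\text{for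 all }\delta>0.$$ (iii) Assertion (ii) still holds when (f) is replaced by (f').
   Context: Function spaces: $\mathbf{D}$ is the space of all càdlàg functions $v$ on $\mathbb{R}$ with $\|v\|_\infty:=\sup_t|v(t)|<\infty$; $\mathcal{D}$ is the $\sigma$-algebra on $\mathbf{D}$ generated by the coordinate projections $\pi_t(v):=v(t)$, $t\in\mathbb{R}$. A weight function is a continuous $\phi:\mathbb{R}\to[1,\infty)$ that is non-increasing on $(-\infty,0]$ and non-decreasing on $[0,\infty)$. $\mathbf{D}_\phi$ is the subspace of all $x\in\mathbf{D}$ with $\|x\|_\phi:=\|x\phi\|_\infty<\infty$ and $\lim_{|t|\to\infty}|x(t)|=0$; $\mathcal{D}_\phi:=\mathcal{D}\cap\mathbf{D}_\phi$ is the trace $\sigma$-algebra, which coincides with the $\sigma$-algebra generated by the $\|\cdot\|_\phi$-open balls in $\mathbf{D}_\phi$. Convergence in distribution$^\circ$: for a metric space $(\mathbf{E},d)$ with open-ball $\sigma$-algebra $\mathcal{B}^\circ$ (generated by the open balls), and $(\mathbf{E},\mathcal{B}^\circ)$-valued random variables $X_n$ (possibly on different probability spaces), $X_n\leadsto^\circ X_0$ means that the expectation of $g(X_n)$ converges to the expectation of $g(X_0)$ for every bounded, continuous, $(\mathcal{B}^\circ,\mathcal{B}(\mathbb{R}))$-measurable $g:\mathbf{E}\to\mathbb{R}$. For separable $\mathbf{E}$ this is the usual convergence in distribution, written $\leadsto$. Here $(\mathbf{E},\mathcal{B}^\circ)=(\mathbf{D}_\phi,\mathcal{D}_\phi)$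 with metric induced by $\|\cdot\|_\phi$. Bounded Lipschitz distance: $\mathrm{BL}_1^\circ$ is the set of $(\mathcal{B}^\circ,\mathcal{B}(\mathbb{R}))$-measurable $g:\mathbf{E}\to\mathbb{R}$ with $|g(x)-g(y)|\le d(x,y)$ for all $x,y$ and $\sup|g|\le1$; $d_{\rm BL}^\circ(\mu,\nu):=\sup_{g\in\mathrm{BL}_1^\circ}|\int g\,d\mu-\int g\,d\nu|$. $\widetilde d_{\rm BL}$ is the same object on $(\mathbb{R},\mathcal{B}(\mathbb{R}))$ with $|\cdot|$. Outer probability: $\mathbb{P}^{\mathsf{out}}[S]:=\inf\{\mathbb{P}[\overline S]:\overline S\in\mathcal{F},\ \overline S\supseteq S\}$ for $S\subseteq\Omega$. Quasi-Hadamard differentiability: $f$ is quasi-Hadamard differentiable at $F\in\mathbf{D}(f)$ tangentially to $\mathbf{C}_{\phi,F}\langle\mathbf{D}_\phi\rangle$ if there is a continuous map $\dot f_F:\mathbf{C}_{\phi,F}\to\mathbb{R}$ (the quasi-Hadamard derivative) with $\lim_{n\to\infty}|\dot f_F(x_0)-\varepsilon_n^{-1}(f(F+\varepsilon_nx_n)-f(F))|=0$ for each triplet $(x_0,(x_n),(\varepsilon_n))$ with $x_0\in\mathbf{C}_{\phi,F}$, $(x_n)\subseteq\mathbf{D}_\phi$, $\|x_n-x_0\|_\phi\to0$, $(F+\varepsilon_nx_n)\subseteq\mathbf{D}(f)$, $(\varepsilon_n)\subset(0,\infty)$, $\varepsilon_n\to0$. *)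

theory Defs
  imports "HOL-Probability.Probability"
begin

section \<open>Function spaces\<close>

definition cadlag :: "(real \<Rightarrow> real) \<Rightarrow> bool" where
  "cadlag v \<longleftrightarrow> (\<forall>t. continuous (at_right t) v \<and> (\<exists>l. (v \<longlongrightarrow> l) (at_left t)))"

definition sup_norm :: "(real \<Rightarrow> real) \<Rightarrow> ennreal" where
  "sup_norm v = (SUP t. ennreal \<bar>v t\<bar>)"

definition Dspace :: "(real \<Rightarrow> real) set" where
  "Dspace = {v. cadlag v \<and> sup_norm v < \<infinity>}"

definition Dsigma :: "(real \<Rightarrow> real) measure" where
  "Dsigma = sigma Dspace {{v \<in> Dspace. v t \<in> A} | t A. A \<in> sets borel}"

definition weight_function :: "(real \<Rightarrow> real) \<Rightarrow> bool" where
  "weight_function \<phi> \<longleftrightarrow>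
     continuous_on UNIV \<phi> \<and> (\<forall>t. 1 \<le> \<phi> t) \<and> antimono_on {..0} \<phi> \<and> mono_on {0..} \<phi>"

definition wnorm :: "(real \<Rightarrow> real) \<Rightarrow> (real \<Rightarrow> real) \<Rightarrow> ennreal" where
  "wnorm \<phi> x = sup_norm (\<lambda>t. x t * \<phi> t)"

definition Dphi :: "(real \<Rightarrow> real) \<Rightarrow> (real \<Rightarrow> real) set" where
  "Dphi \<phi> = {x \<in> Dspace. wnorm \<phi> x < \<infinity> \<and> ((\<lambda>t. \<bar>x t\<bar>) \<longlongrightarrow> 0) at_infinity}"

definition Dphi_sigma :: "(real \<Rightarrow> real) \<Rightarrow> (real \<Rightarrow> real) measure" where
  "Dphi_sigma \<phi> = restrict_space Dsigma (Dphi \<phi>)"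

definition dphi :: "(real \<Rightarrow> real) \<Rightarrow> (real \<Rightarrow> real) \<Rightarrow> (real \<Rightarrow> real) \<Rightarrow> real" where
  "dphi \<phi> x y = enn2real (wnorm \<phi> (\<lambda>t. x t - y t))"

abbreviation Dphi_top :: "(real \<Rightarrow> real) \<Rightarrow> (real \<Rightarrow> real) topology" where
  "Dphi_top \<phi> \<equiv> Metric_space.mtopology (Dphi \<phi>) (dphi \<phi>)"

text \<open>Functions on the real line carry no \<open>real_vector\<close> instance in the library, so
  linear subspaces and linear functionals are spelled out pointwise.\<close>

definition fun_subspace :: "(real \<Rightarrow> real) set \<Rightarrow> bool" where
  "fun_subspace S \<longleftrightarrow>
     (\<lambda>t. 0) \<in> S \<and> (\<forall>x\<in>S. \<forall>y\<in>S. (\<lambda>t. x t + y t) \<in> S) \<and> (\<forall>c. \<forall>x\<in>S. (\<lambda>t. c * x t) \<in> S)"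

definition fun_linear_on :: "(real \<Rightarrow> real) set \<Rightarrow> ((real \<Rightarrow> real) \<Rightarrow> real) \<Rightarrow> bool" where
  "fun_linear_on S g \<longleftrightarrow>
     (\<forall>x\<in>S. \<forall>y\<in>S. g (\<lambda>t. x t + y t) = g x + g y) \<and> (\<forall>c. \<forall>x\<in>S. g (\<lambda>t. c * x t) = c * g x)"


section \<open>Convergence in distribution and bounded Lipschitz distance for the open-ball sigma-algebra\<close>

definition ball_sigma :: "'e set \<Rightarrow> ('e \<Rightarrow> 'e \<Rightarrow> real) \<Rightarrow> 'e measure" where
  "ball_sigma E d = sigma E {Metric_space.mball E d x r | x r. x \<in> E}"

text \<open>Sequences of random variables are indexed by \<open>n \<ge> 1\<close> (empirical distribution functions
  have sample size at least one); \<open>X 0\<close> is a dummy value on which nothing is required.\<close>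

definition conv_distr ::
  "'e set \<Rightarrow> ('e \<Rightarrow> 'e \<Rightarrow> real) \<Rightarrow> (nat \<Rightarrow> 'a measure) \<Rightarrow> (nat \<Rightarrow> 'a \<Rightarrow> 'e) \<Rightarrow> 'b measure \<Rightarrow> ('b \<Rightarrow> 'e) \<Rightarrow> bool"
where
  "conv_distr E d M X M0 X0 \<longleftrightarrow>
     (\<forall>n\<ge>1. X n \<in> measurable (M n) (ball_sigma E d)) \<and>
     X0 \<in> measurable M0 (ball_sigma E d) \<and>
     (\<forall>g. g \<in> borel_measurable (ball_sigma E d) \<and>
          continuous_map (Metric_space.mtopology E d) euclideanreal g \<and> bounded (g ` E) \<longrightarrow>
        (\<lambda>n. \<integral>\<omega>. g (X n \<omega>) \<partial>M n) \<longlonglongrightarrow> (\<integral>\<omega>. g (X0 \<omega>) \<partial>M0))"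

definition BL1 :: "'e set \<Rightarrow> ('e \<Rightarrow> 'e \<Rightarrow> real) \<Rightarrow> ('e \<Rightarrow> real) set" where
  "BL1 E d = {g \<in> borel_measurable (ball_sigma E d).
     (\<forall>x\<in>E. \<forall>y\<in>E. \<bar>g x - g y\<bar> \<le> d x y) \<and> (\<forall>x\<in>E. \<bar>g x\<bar> \<le> 1)}"

text \<open>For probability measures the supremum is over a nonempty set bounded by 2.\<close>

definition dBL :: "'e set \<Rightarrow> ('e \<Rightarrow> 'e \<Rightarrow> real) \<Rightarrow> 'e measure \<Rightarrow> 'e measure \<Rightarrow> real" where
  "dBL E d \<mu> \<nu> = (SUP g\<in>BL1 E d. \<bar>(\<integral>x. g x \<partial>\<mu>) - (\<integral>x. g x \<partial>\<nu>)\<bar>)"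


section \<open>Distribution functions and quasi-Hadamard differentiability\<close>

definition emp_df :: "(nat \<Rightarrow> 'a \<Rightarrow> real) \<Rightarrow> nat \<Rightarrow> 'a \<Rightarrow> real \<Rightarrow> real" where
  "emp_df X n \<omega> = (\<lambda>t. (1 / real n) * (\<Sum>i=1..n. indicator {X i \<omega>..} t))"

definition scaled_diff :: "real \<Rightarrow> (real \<Rightarrow> real) \<Rightarrow> (real \<Rightarrow> real) \<Rightarrow> real \<Rightarrow> real" where
  "scaled_diff c G H = (\<lambda>t. c * (G t - H t))"

definition quasi_hadamard ::
  "(real \<Rightarrow> real) \<Rightarrow> ((real \<Rightarrow> real) \<Rightarrow> real) \<Rightarrow> (real \<Rightarrow> real) set \<Rightarrow> (real \<Rightarrow> real) \<Rightarrow>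
   (real \<Rightarrow> real) set \<Rightarrow> ((real \<Rightarrow> real) \<Rightarrow> real) \<Rightarrow> bool"
where
  "quasi_hadamard \<phi> f Df F C f' \<longleftrightarrow>
     continuous_map (subtopology (Dphi_top \<phi>) C) euclideanreal f' \<and>
     (\<forall>x0 x \<epsilon>. x0 \<in> C \<and> (\<forall>n. x n \<in> Dphi \<phi>) \<and>
        (\<lambda>n. dphi \<phi> (x n) x0) \<longlonglongrightarrow> 0 \<and>
        (\<forall>n. (\<lambda>t. F t + \<epsilon> n * x n t) \<in> Df) \<and>
        (\<forall>n. 0 < \<epsilon> n) \<and> \<epsilon> \<longlonglongrightarrow> 0 \<longrightarrow>
        (\<lambda>n::nat. \<bar>f' x0 - (f (\<lambda>t. F t + \<epsilon> n * x n t) - f F) / \<epsilon> n\<bar>) \<longlonglongrightarrow> 0)"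


section \<open>The metric space \<open>Dphi\<close> and its open-ball sigma-algebra\<close>

lemma sup_norm_finite_iff: "sup_norm v < \<infinity> \<longleftrightarrow> (\<exists>K. \<forall>t. \<bar>v t\<bar> \<le> K)"
proof
  assume a: "sup_norm v < \<infinity>"
  have "\<bar>v t\<bar> \<le> enn2real (sup_norm v)" for t
  proof -
    have "ennreal \<bar>v t\<bar> \<le> sup_norm v" unfolding sup_norm_def by (rule SUP_upper) simp
    then have "enn2real (ennreal \<bar>v t\<bar>) \<le> enn2real (sup_norm v)"
      using a by (intro enn2real_mono) auto
    then show ?thesis by simp
  qed
  then show "\<exists>K. \<forall>t. \<bar>v t\<bar> \<le> K" by blast
next
  assume "\<exists>K. \<forall>t. \<bar>v t\<bar> \<le> K"
  then obtain K where K: "\<And>t. \<bar>v t\<bar> \<le> K" by blast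
  have "sup_norm v \<le> ennreal K" unfolding sup_norm_def by (rule SUP_least) (use K in \<open>simp add: ennreal_leI\<close>)
  also have "\<dots> < \<infinity>" by simp
  finally show "sup_norm v < \<infinity>" .
qed

lemma sup_norm_le_iff: "sup_norm v < \<infinity> \<Longrightarrow> 0 \<le> K \<Longrightarrow> enn2real (sup_norm v) \<le> K \<longleftrightarrow> (\<forall>t. \<bar>v t\<bar> \<le> K)"
proof
  assume a: "sup_norm v < \<infinity>" "0 \<le> K" "enn2real (sup_norm v) \<le> K"
  show "\<forall>t. \<bar>v t\<bar> \<le> K"
  proof
    fix t
    have "ennreal \<bar>v t\<bar> \<le> sup_norm v" unfolding sup_norm_def by (rule SUP_upper) simp
    then have "enn2real (ennreal \<bar>v t\<bar>) \<le> enn2real (sup_norm v)"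
      using a by (intro enn2real_mono) auto
    then show "\<bar>v t\<bar> \<le> K" using a by simp
  qed
next
  assume a: "sup_norm v < \<infinity>" "0 \<le> K" "\<forall>t. \<bar>v t\<bar> \<le> K"
  have "sup_norm v \<le> ennreal K" unfolding sup_norm_def by (rule SUP_least) (use a in \<open>simp add: ennreal_leI\<close>)
  then show "enn2real (sup_norm v) \<le> K" using a by (simp add: enn2real_leI)
qed

lemma DphiD:
  assumes "x \<in> Dphi \<phi>" shows "\<exists>K. \<forall>t. \<bar>x t * \<phi> t\<bar> \<le> K"
  using assms sup_norm_finite_iff[of "\<lambda>t. x t * \<phi> t"] unfolding Dphi_def wnorm_def by simp

lemma wnorm_diff_finite:
  assumes "x \<in> Dphi \<phi>" "y \<in> Dphi \<phi>"
  shows "wnorm \<phi> (\<lambda>t. x t - y t) < \<infinity>"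
proof -
  obtain K L where K: "\<And>t. \<bar>x t * \<phi> t\<bar> \<le> K" and L: "\<And>t. \<bar>y t * \<phi> t\<bar> \<le> L"
    using DphiD assms by metis
  have "\<bar>(x t - y t) * \<phi> t\<bar> \<le> K + L" for t
    using K[of t] L[of t] by (simp add: left_diff_distrib)
  then show ?thesis unfolding wnorm_def sup_norm_finite_iff by blast
qed

lemma dphi_le_iff:
  assumes "x \<in> Dphi \<phi>" "y \<in> Dphi \<phi>" "0 \<le> K"
  shows "dphi \<phi> x y \<le> K \<longleftrightarrow> (\<forall>t. \<bar>(x t - y t) * \<phi> t\<bar> \<le> K)"
  using wnorm_diff_finite[OF assms(1,2)] assms(3) unfolding dphi_def wnorm_def
  by (rule sup_norm_le_iff)

lemma Metric_space_Dphi: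
  assumes "weight_function \<phi>"
  shows "Metric_space (Dphi \<phi>) (dphi \<phi>)"
proof
  show nn: "0 \<le> dphi \<phi> x y" for x y by (simp add: dphi_def)
  show "dphi \<phi> x y = dphi \<phi> y x" for x y
  proof -
    have "\<bar>(x t - y t) * \<phi> t\<bar> = \<bar>(y t - x t) * \<phi> t\<bar>" for t
      by (simp add: abs_mult abs_minus_commute)
    then show ?thesis unfolding dphi_def wnorm_def sup_norm_def by simp
  qed
  have pos: "\<phi> t > 0" for t using assms unfolding weight_function_def by (meson less_le_trans zero_less_one)
  fix x y z assume x: "x \<in> Dphi \<phi>" and y: "y \<in> Dphi \<phi>"
  show "dphi \<phi> x y = 0 \<longleftrightarrow> x = y"
  proof -
    have "dphi \<phi> x y = 0 \<longleftrightarrow> dphi \<phi> x y \<le> 0" using nn[of x y] by linarith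
    also have "\<dots> \<longleftrightarrow> (\<forall>t. \<bar>(x t - y t) * \<phi> t\<bar> \<le> 0)" using dphi_le_iff[OF x y] by simp
    also have "\<dots> \<longleftrightarrow> x = y" using pos by (auto simp: fun_eq_iff) (metis less_irrefl)
    finally show ?thesis .
  qed
  assume z: "z \<in> Dphi \<phi>"
  have "\<bar>(x t - z t) * \<phi> t\<bar> \<le> dphi \<phi> x y + dphi \<phi> y z" for t
  proof -
    have "\<bar>(x t - y t) * \<phi> t\<bar> \<le> dphi \<phi> x y" "\<bar>(y t - z t) * \<phi> t\<bar> \<le> dphi \<phi> y z"
      using dphi_le_iff[OF x y nn[of x y]] dphi_le_iff[OF y z nn[of y z]] by auto
    moreover have "(x t - z t) * \<phi> t = (x t - y t) * \<phi> t + (y t - z t) * \<phi> t" by (simp add: algebra_simps)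
    ultimately show ?thesis by linarith
  qed
  then show "dphi \<phi> x z \<le> dphi \<phi> x y + dphi \<phi> y z"
    using dphi_le_iff[OF x z] nn by simp
qed

lemma Dphi_subset: "Dphi \<phi> \<subseteq> Dspace" by (auto simp: Dphi_def)

lemma space_Dsigma [simp]: "space Dsigma = Dspace"
  unfolding Dsigma_def by (rule space_measure_of) auto

lemma space_Dphi_sigma [simp]: "space (Dphi_sigma \<phi>) = Dphi \<phi>"
  using Dphi_subset by (auto simp: Dphi_sigma_def space_restrict_space)

lemma space_ball_sigma [simp]: "space (ball_sigma E d) = E"
  unfolding ball_sigma_def by (rule space_measure_of_conv)

lemma measurable_coord_D [measurable]: "(\<lambda>v. v t) \<in> borel_measurable Dsigma"
proof (rule measurableI)
  fix A :: "real set" assume "A \<in> sets borel"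
  then have "{v \<in> Dspace. v t \<in> A} \<in> sets Dsigma"
    unfolding Dsigma_def by (subst sets_measure_of) (auto intro!: sigma_sets.Basic)
  moreover have "(\<lambda>v. v t) -` A \<inter> space Dsigma = {v \<in> Dspace. v t \<in> A}" by auto
  ultimately show "(\<lambda>v. v t) -` A \<inter> space Dsigma \<in> sets Dsigma" by simp
qed simp

lemma measurable_coord_Dphi [measurable]: "(\<lambda>v. v t) \<in> borel_measurable (Dphi_sigma \<phi>)"
  unfolding Dphi_sigma_def by (rule measurable_restrict_space1) simp

text \<open>A weighted bound on the rationals extends to all reals by right-continuity.\<close>

lemma cadlag_bound_rat:
  assumes "cadlag x" "cadlag y" "weight_function \<phi>"
    and "\<And>q. q \<in> \<rat> \<Longrightarrow> \<bar>(x q - y q) * \<phi> q\<bar> \<le> K"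
  shows "\<bar>(x t - y t) * \<phi> t\<bar> \<le> K"
proof (rule ccontr)
  assume "\<not> ?thesis"
  then have gt: "K < \<bar>(x t - y t) * \<phi> t\<bar>" by simp
  have "continuous (at_right t) \<phi>"
    using assms(3) unfolding weight_function_def
    by (simp add: continuous_on_eq_continuous_at continuous_at_imp_continuous_at_within)
  then have "((\<lambda>s. \<bar>(x s - y s) * \<phi> s\<bar>) \<longlongrightarrow> \<bar>(x t - y t) * \<phi> t\<bar>) (at_right t)"
    using assms(1,2) unfolding cadlag_def continuous_within by (intro tendsto_intros) auto
  then have "\<forall>\<^sub>F s in at_right t. K < \<bar>(x s - y s) * \<phi> s\<bar>"
    using gt by (rule order_tendstoD(1))
  then obtain b where b: "b > t" "\<And>s. t < s \<Longrightarrow> s < b \<Longrightarrow> K < \<bar>(x s - y s) * \<phi> s\<bar>"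
    unfolding eventually_at_right_field by blast
  obtain q where "q \<in> \<rat>" "t < q" "q < b" using Rats_dense_in_real[OF b(1)] by blast
  then show False using b(2)[of q] assms(4)[of q] by simp
qed

text \<open>A right-continuous spike: \<open>Dphi\<close>-balls around it recover the half spaces \<open>{x. a < x t}\<close>.\<close>

definition spike :: "(real \<Rightarrow> real) \<Rightarrow> real \<Rightarrow> real \<Rightarrow> nat \<Rightarrow> real \<Rightarrow> real" where
  "spike \<phi> a t n = (\<lambda>s. indicator {t..<t + 1 / real (Suc n)} s * (a + real n * \<phi> t / \<phi> s))"

lemma spike_in_Dphi:
  assumes w: "weight_function \<phi>"
  shows "spike \<phi> a t n \<in> Dphi \<phi>"
proof -
  let ?u = "t + 1 / real (Suc n)"
  let ?h = "\<lambda>s. a + real n * \<phi> t / \<phi> s"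
  have one: "1 \<le> \<phi> s" for s using w unfolding weight_function_def by simp
  have nz: "\<phi> s \<noteq> 0" for s using one[of s] by simp
  have c\<phi>: "continuous_on UNIV \<phi>" using w unfolding weight_function_def by simp
  have ch: "continuous_on UNIV ?h" using c\<phi> nz by (intro continuous_intros) auto
  have tu: "t < ?u" by simp
  have hR: "(?h \<longlongrightarrow> ?h s) (at_right s)" and hL: "(?h \<longlongrightarrow> ?h s) (at_left s)" for s
    using ch unfolding continuous_on_def by (meson UNIV_I tendsto_within_subset subset_UNIV)+
  have cad: "cadlag (spike \<phi> a t n)"
    unfolding cadlag_def
  proof (intro allI conjI)
    fix s
    consider "s < t" | "t \<le> s" "s < ?u" | "?u \<le> s" by linarith
    then have "(spike \<phi> a t n \<longlongrightarrow> spike \<phi> a t n s) (at_right s)"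
    proof cases
      case 1
      then have "\<forall>\<^sub>F r in at_right s. 0 = spike \<phi> a t n r"
        unfolding eventually_at_right_field by (intro exI[of _ t]) (auto simp: spike_def)
      then show ?thesis using 1 by (intro Lim_transform_eventually[OF tendsto_const]) (auto simp: spike_def)
    next
      case 2
      then have "\<forall>\<^sub>F r in at_right s. ?h r = spike \<phi> a t n r"
        unfolding eventually_at_right_field by (intro exI[of _ "?u"]) (auto simp: spike_def)
      moreover have "spike \<phi> a t n s = ?h s" using 2 by (simp add: spike_def)
      ultimately show ?thesis using Lim_transform_eventually[OF hR[of s]] by simp
    next
      case 3
      then have "\<forall>\<^sub>F r in at_right s. 0 = spike \<phi> a t n r"
        unfolding eventually_at_right_field by (intro exI[of _ "s+1"]) (auto simp: spike_def)
      then show ?thesis using 3 by (intro Lim_transform_eventually[OF tendsto_const]) (auto simp: spike_def)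
    qed
    then show "continuous (at_right s) (spike \<phi> a t n)" by (simp add: continuous_within)
    consider "s \<le> t" | "t < s" "s \<le> ?u" | "?u < s" by linarith
    then show "\<exists>l. (spike \<phi> a t n \<longlongrightarrow> l) (at_left s)"
    proof cases
      case 1
      then have "\<forall>\<^sub>F r in at_left s. 0 = spike \<phi> a t n r"
        unfolding eventually_at_left_field by (intro exI[of _ "s-1"]) (auto simp: spike_def)
      then show ?thesis using Lim_transform_eventually[OF tendsto_const] by blast
    next
      case 2
      then have "\<forall>\<^sub>F r in at_left s. ?h r = spike \<phi> a t n r"
        unfolding eventually_at_left_field by (intro exI[of _ t]) (auto simp: spike_def)
      then show ?thesis using Lim_transform_eventually[OF hL[of s]] by blast
    next
      case 3
      then have "\<forall>\<^sub>F r in at_left s. 0 = spike \<phi> a t n r"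
        unfolding eventually_at_left_field by (intro exI[of _ "?u"]) (auto simp: spike_def)
      then show ?thesis using Lim_transform_eventually[OF tendsto_const] by blast
    qed
  qed
  have "compact (\<phi> ` {t..?u})"
    by (intro compact_continuous_image continuous_on_subset[OF c\<phi>]) auto
  then obtain K where "\<forall>z\<in>\<phi> ` {t..?u}. norm z \<le> K"
    using compact_imp_bounded[of "\<phi> ` {t..?u}"] unfolding bounded_iff by blast
  then have K: "\<bar>\<phi> s\<bar> \<le> K" if "s \<in> {t..?u}" for s using that by force
  have K0: "0 \<le> K" using K[of t] tu by auto
  have b: "\<bar>spike \<phi> a t n s * \<phi> s\<bar> \<le> \<bar>a\<bar> * K + real n * \<phi> t" for s
  proof (cases "s \<in> {t..<?u}")
    case True
    have "spike \<phi> a t n s * \<phi> s = a * \<phi> s + real n * \<phi> t"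
      using True nz[of s] by (simp add: spike_def field_simps)
    moreover have "\<bar>a * \<phi> s\<bar> \<le> \<bar>a\<bar> * K" using K[of s] True by (simp add: abs_mult mult_left_mono)
    moreover have "0 \<le> real n * \<phi> t" using one[of t] by simp
    ultimately show ?thesis by linarith
  next
    case False
    then have "spike \<phi> a t n s = 0" unfolding spike_def by (metis indicator_simps(2) mult_zero_left)
    then show ?thesis using K0 one[of t] by simp
  qed
  have b1: "\<bar>spike \<phi> a t n s\<bar> \<le> \<bar>a\<bar> * K + real n * \<phi> t" for s
  proof -
    have "\<bar>spike \<phi> a t n s\<bar> * 1 \<le> \<bar>spike \<phi> a t n s\<bar> * \<bar>\<phi> s\<bar>"
      using one[of s] by (intro mult_left_mono) auto
    then show ?thesis using b[of s] by (simp add: abs_mult)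
  qed
  have "\<forall>\<^sub>F s in at_infinity. 0 = \<bar>spike \<phi> a t n s\<bar>"
    unfolding eventually_at_infinity
  proof (intro exI[of _ "\<bar>t\<bar> + \<bar>?u\<bar> + 1"] allI impI)
    fix s :: real assume "\<bar>t\<bar> + \<bar>?u\<bar> + 1 \<le> norm s"
    then have "s \<notin> {t..<?u}" unfolding real_norm_def atLeastLessThan_iff by linarith
    then show "0 = \<bar>spike \<phi> a t n s\<bar>" unfolding spike_def by (metis indicator_simps(2) mult_zero_left abs_zero)
  qed
  then have "((\<lambda>s. \<bar>spike \<phi> a t n s\<bar>) \<longlongrightarrow> 0) at_infinity"
    by (rule Lim_transform_eventually[OF tendsto_const])
  moreover have "sup_norm (spike \<phi> a t n) < \<infinity>" "wnorm \<phi> (spike \<phi> a t n) < \<infinity>"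
    unfolding wnorm_def sup_norm_finite_iff using b b1 by blast+
  ultimately show ?thesis unfolding Dphi_def Dspace_def using cad by simp
qed

lemma halfspace_eq_balls:
  assumes w: "weight_function \<phi>"
  shows "{x \<in> Dphi \<phi>. a < x t}
     = (\<Union>n. Metric_space.mball (Dphi \<phi>) (dphi \<phi>) (spike \<phi> a t n) (real n * \<phi> t))"
    (is "?L = ?R")
proof -
  interpret Metric_space "Dphi \<phi>" "dphi \<phi>" by (rule Metric_space_Dphi[OF w])
  have one: "1 \<le> \<phi> s" for s using w unfolding weight_function_def by simp
  have nz: "\<phi> s \<noteq> 0" for s using one[of s] by simp
  show ?thesis
  proof (intro equalityI subsetI)
    fix x assume "x \<in> ?R"
    then obtain n where x: "x \<in> Dphi \<phi>" and d: "dphi \<phi> (spike \<phi> a t n) x < real n * \<phi> t" by auto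
    have "\<bar>(spike \<phi> a t n t - x t) * \<phi> t\<bar> \<le> dphi \<phi> (spike \<phi> a t n) x"
      using dphi_le_iff[OF spike_in_Dphi[OF w] x nonneg] by blast
    moreover have "(spike \<phi> a t n t - x t) * \<phi> t = (a - x t) * \<phi> t + real n * \<phi> t"
      using nz[of t] by (simp add: spike_def field_simps)
    ultimately have "(a - x t) * \<phi> t < 0" using d by linarith
    then have "a < x t" using one[of t] by (simp add: mult_less_0_iff)
    then show "x \<in> ?L" using x by simp
  next
    fix x assume "x \<in> ?L"
    then have x: "x \<in> Dphi \<phi>" and ax: "a < x t" by auto
    obtain K where K: "\<And>s. \<bar>x s * \<phi> s\<bar> \<le> K" using DphiD[OF x] by blast
    define e where "e = (x t - a) / 2"
    have e: "0 < e" "a + e < x t" using ax by (auto simp: e_def field_simps)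
    have "(x \<longlongrightarrow> x t) (at_right t)"
      using x unfolding Dphi_def Dspace_def cadlag_def continuous_within by blast
    then have "\<forall>\<^sub>F s in at_right t. a + e < x s" using e(2) by (rule order_tendstoD(1))
    then obtain b where b: "b > t" "\<And>s. t < s \<Longrightarrow> s < b \<Longrightarrow> a + e < x s"
      unfolding eventually_at_right_field by blast
    have c\<phi>: "continuous_on UNIV \<phi>" using w unfolding weight_function_def by simp
    have "compact (\<phi> ` {t..t+1})"
      by (intro compact_continuous_image continuous_on_subset[OF c\<phi>]) auto
    then obtain P where "\<forall>z\<in>\<phi> ` {t..t+1}. norm z \<le> P"
      using compact_imp_bounded[of "\<phi> ` {t..t+1}"] unfolding bounded_iff by blast
    then have P: "\<bar>\<phi> s\<bar> \<le> P" if "s \<in> {t..t+1}" for s using that by force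
    obtain n1 where n1: "1 / (b - t) < real n1" using reals_Archimedean2 by blast
    obtain n2 where n2: "K + \<bar>a\<bar> * P + e < real n2" using reals_Archimedean2 by blast
    define n where "n = max n1 n2"
    have n: "1 / (b - t) < real n" "K + \<bar>a\<bar> * P + e < real n" using n1 n2 by (auto simp: n_def max_def)
    have P0: "0 \<le> P" using P[of t] by auto
    have K0: "0 \<le> K" using K[of t] by linarith
    have aP0: "0 \<le> \<bar>a\<bar> * P" using P0 by simp
    have nn: "real n \<le> real n * \<phi> t" using one[of t] by (simp add: mult_le_cancel_left1)
    have "1 / real (Suc n) < b - t"
    proof -
      have "1 / (b - t) < real (Suc n)" using n by simp
      then show ?thesis using b(1) by (simp add: field_simps)
    qed
    then have ub: "t + 1 / real (Suc n) < b" by simp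
    have "\<bar>(spike \<phi> a t n s - x s) * \<phi> s\<bar> \<le> real n * \<phi> t - e" for s
    proof (cases "s \<in> {t..<t + 1 / real (Suc n)}")
      case True
      have "1 / real (Suc n) \<le> 1" by simp
      then have s1: "s \<in> {t..t+1}" using True unfolding atLeastLessThan_iff atLeastAtMost_iff by linarith
      have ex: "a + e < x s" using b(2)[of s] ub e(2) True
        by (cases "s = t") auto
      have eq: "(spike \<phi> a t n s - x s) * \<phi> s = real n * \<phi> t - (x s - a) * \<phi> s"
        using True nz[of s] by (simp add: spike_def field_simps)
      have "e * 1 \<le> (x s - a) * \<phi> s" using ex e(1) one[of s] by (intro mult_mono) auto
      moreover have "(x s - a) * \<phi> s \<le> K + \<bar>a\<bar> * P"
      proof -
        have "\<bar>a * \<phi> s\<bar> \<le> \<bar>a\<bar> * P" using P[OF s1] by (simp add: abs_mult mult_left_mono)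
        then show ?thesis using K[of s] by (simp add: left_diff_distrib)
      qed
      ultimately show ?thesis using eq n(2) nn by linarith
    next
      case False
      then have "spike \<phi> a t n s = 0" unfolding spike_def by (metis indicator_simps(2) mult_zero_left)
      then have "\<bar>(spike \<phi> a t n s - x s) * \<phi> s\<bar> \<le> K" using K[of s] by simp
      then show ?thesis using n(2) nn aP0 by linarith
    qed
    moreover have "0 \<le> real n * \<phi> t - e" using n(2) nn aP0 K0 by linarith
    ultimately have "dphi \<phi> (spike \<phi> a t n) x \<le> real n * \<phi> t - e"
      using dphi_le_iff[OF spike_in_Dphi[OF w] x] by blast
    then have "dphi \<phi> (spike \<phi> a t n) x < real n * \<phi> t" using e by linarith
    then show "x \<in> ?R" using x spike_in_Dphi[OF w] by auto
  qed
qed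

lemma mball_in_Dphi_sigma:
  assumes w: "weight_function \<phi>" and c: "c \<in> Dphi \<phi>"
  shows "Metric_space.mball (Dphi \<phi>) (dphi \<phi>) c r \<in> sets (Dphi_sigma \<phi>)"
proof -
  interpret Metric_space "Dphi \<phi>" "dphi \<phi>" by (rule Metric_space_Dphi[OF w])
  have cad: "cadlag x" if "x \<in> Dphi \<phi>" for x using that unfolding Dphi_def Dspace_def by simp
  have "mball c r = {x \<in> space (Dphi_sigma \<phi>). \<exists>k\<in>{k::nat. 0 \<le> r - 1 / real (Suc k)}. \<forall>q\<in>\<rat>.
          \<bar>(c q - x q) * \<phi> q\<bar> \<le> r - 1 / real (Suc k)}" (is "_ = ?R")
  proof (intro equalityI subsetI)
    fix x assume "x \<in> mball c r"
    then have x: "x \<in> Dphi \<phi>" "dphi \<phi> c x < r" by auto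
    then obtain k where k: "1 / real (Suc k) < r - dphi \<phi> c x"
      using reals_Archimedean[of "r - dphi \<phi> c x"] by (auto simp: inverse_eq_divide)
    then have le: "dphi \<phi> c x \<le> r - 1 / real (Suc k)" by linarith
    then have nn: "0 \<le> r - 1 / real (Suc k)" using nonneg[of c x] by linarith
    then have "\<forall>t. \<bar>(c t - x t) * \<phi> t\<bar> \<le> r - 1 / real (Suc k)"
      using dphi_le_iff[OF c x(1) nn] le by blast
    then show "x \<in> ?R" using x nn by auto
  next
    fix x assume "x \<in> ?R"
    then obtain k where x: "x \<in> Dphi \<phi>" and nn: "0 \<le> r - 1 / real (Suc k)"
      and q: "\<And>q. q \<in> \<rat> \<Longrightarrow> \<bar>(c q - x q) * \<phi> q\<bar> \<le> r - 1 / real (Suc k)" by auto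
    have "\<bar>(c t - x t) * \<phi> t\<bar> \<le> r - 1 / real (Suc k)" for t
      by (rule cadlag_bound_rat[OF cad[OF c] cad[OF x] w q])
    then have le: "dphi \<phi> c x \<le> r - 1 / real (Suc k)" using dphi_le_iff[OF c x nn] by blast
    have "0 < 1 / real (Suc k)" by simp
    then show "x \<in> mball c r" using le x c unfolding in_mball by linarith
  qed
  also have "\<dots> \<in> sets (Dphi_sigma \<phi>)"
    using countable_rat by measurable
  finally show ?thesis .
qed

text \<open>The trace sigma-algebra on \<open>Dphi\<close> is the open-ball sigma-algebra.\<close>

theorem sets_ball_sigma_Dphi:
  assumes w: "weight_function \<phi>"
  shows "sets (ball_sigma (Dphi \<phi>) (dphi \<phi>)) = sets (Dphi_sigma \<phi>)"
proof (intro equalityI)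
  interpret Metric_space "Dphi \<phi>" "dphi \<phi>" by (rule Metric_space_Dphi[OF w])
  let ?B = "ball_sigma (Dphi \<phi>) (dphi \<phi>)"
  have sB: "sets ?B = sigma_sets (Dphi \<phi>) {mball x r |x r. x \<in> Dphi \<phi>}"
    unfolding ball_sigma_def by (rule sets_measure_of) auto
  have "sigma_sets (space (Dphi_sigma \<phi>)) {mball x r |x r. x \<in> Dphi \<phi>} \<subseteq> sets (Dphi_sigma \<phi>)"
    by (rule sets.sigma_sets_subset) (use mball_in_Dphi_sigma[OF w] in blast)
  then show "sets ?B \<subseteq> sets (Dphi_sigma \<phi>)" using sB by simp
  have "(\<lambda>x. x t) \<in> borel_measurable ?B" for t
  proof (rule borel_measurable_iff_greater[THEN iffD2], rule allI)
    fix a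
    have "{x \<in> Dphi \<phi>. a < x t} \<in> sets ?B"
      unfolding halfspace_eq_balls[OF w] sB
      by (intro sigma_sets.Union sigma_sets.Basic) (use spike_in_Dphi[OF w] in blast)
    then show "{x \<in> space ?B. a < x t} \<in> sets ?B" by simp
  qed
  then have co: "{x \<in> Dphi \<phi>. x t \<in> A} \<in> sets ?B" if "A \<in> sets borel" for t A
    using measurable_sets[OF _ that, of "\<lambda>x. x t" ?B] by (simp add: vimage_def Int_def conj_commute)
  have "id \<in> measurable ?B Dsigma"
    unfolding Dsigma_def
  proof (rule measurable_measure_of)
    show "id \<in> space ?B \<rightarrow> Dspace" using Dphi_subset[of \<phi>] by auto
    fix y assume "y \<in> {{v \<in> Dspace. v t \<in> A} |t A. A \<in> sets (borel :: real measure)}"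
    then obtain t A where A: "A \<in> sets borel" and y: "y = {v \<in> Dspace. v t \<in> A}" by blast
    have "id -` y \<inter> space ?B = {x \<in> Dphi \<phi>. x t \<in> A}" using Dphi_subset[of \<phi>] y by auto
    then show "id -` y \<inter> space ?B \<in> sets ?B" using co[OF A] by simp
  qed auto
  then have "id \<in> measurable ?B (Dphi_sigma \<phi>)"
    unfolding Dphi_sigma_def by (intro measurable_restrict_space2) auto
  then show "sets (Dphi_sigma \<phi>) \<subseteq> sets ?B"
    using measurable_sets[of id ?B "Dphi_sigma \<phi>"] sets.sets_into_space by (fastforce simp: Int_absorb2)
qed

theorem sets_ball_sigma_real: "sets (ball_sigma (UNIV :: real set) dist) = sets borel"
proof -
  have eq: "Metric_space.mball (UNIV :: real set) dist x r = ball x r" for x r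
    by (simp add: Metric_space.mball_def[OF Met_TC.Metric_space_axioms] ball_def)
  have "sets (ball_sigma (UNIV :: real set) dist) = sigma_sets UNIV {ball x r |x r. True}"
    unfolding ball_sigma_def eq by simp
  also have "\<dots> = sets (borel :: real measure)"
  proof (intro equalityI)
    show "sigma_sets UNIV {ball x r |x r. True} \<subseteq> sets (borel :: real measure)"
      by (rule sets.sigma_sets_subset[of _ borel, simplified]) auto
    let ?B = "sigma (UNIV :: real set) {ball x r |x r. True}"
    have "(\<lambda>x. x) \<in> borel_measurable ?B"
    proof (rule borel_measurable_iff_greater[THEN iffD2], rule allI)
      fix a :: real
      have "{x. a < x} = (\<Union>n. ball (a + real n) (real n))"
      proof (intro equalityI subsetI)
        fix x assume "x \<in> {x. a < x}"
        moreover obtain n where "x - a < real n" using reals_Archimedean2 by blast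
        ultimately have "x \<in> ball (a + real n) (real n)" by (auto simp: dist_real_def)
        then show "x \<in> (\<Union>n. ball (a + real n) (real n))" by blast
      qed (auto simp: dist_real_def abs_if split: if_splits)
      moreover have "(\<Union>n. ball (a + real n) (real n)) \<in> sigma_sets UNIV {ball x r |x r. True}"
        by (intro sigma_sets.Union sigma_sets.Basic) blast
      ultimately show "{x \<in> space ?B. a < x} \<in> sets ?B" by simp
    qed
    then show "sets (borel :: real measure) \<subseteq> sigma_sets UNIV {ball x r |x r. True}"
      using measurable_sets[of "\<lambda>x. x" ?B borel] by auto
  qed
  finally show ?thesis .
qed

end

(*
  A linear extension of the derivative that is continuous at 0 is Lipschitz for the weighted norm.
  With U_n = a_n (F_n - F), V_n = a_n (F*_n - F_n) and the difference quotients
  g_n(x) = a_n (f(F + x / a_n) - f(F)), linearity of the derivative g gives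
    a_n (f(F*_n) - f(F_n)) = g(V_n) + r_n(U_n + V_n) - r_n(U_n),   r_n = g_n - g.
  The conditional law of g(V_n) is close to that of g(B) because composing with g scales bounded
  Lipschitz functions only. The remainders vanish in probability: quasi-Hadamard differentiability
  makes r_n(x_n) tend to 0 along convergent sequences with limit in C, hence r_n is uniformly small
  near subsets of C that increase to C, and U_n and U_n + V_n are asymptotically distributed like B
  and B + B' with B' an independent copy of B, both with values in the subspace C.

  Open balls generate a sigma-algebra in which few sets and functions are measurable, so every test
  function is an infimum of countably many cones c + s d(., q). This is where separability of C
  enters, and no Skorohod representation is needed.
*)
theory Submission
  imports Defs
begin

section \<open>Bounded Lipschitz functions and Lipschitz envelopes\<close>

text \<open>Differentiability is available at F only, whereas the bootstrap difference is taken at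
  the random point F_n. Therefore f(F*_n) and f(F_n) are both expanded around F, and this brings in
  the direction U_n + V_n, about whose limit law nothing is assumed. That limit comes from
  conditioning on the first coordinate. U_n is then a constant shift, and a shifted Lipschitz
  function is Lipschitz with the same constant, so the bounded Lipschitz distance controls the error
  uniformly over all shifts. Convergence for each fixed test function would not suffice. The copy B'
  is independent of B because the conditional law of V_n has a limit that does not depend on the
  sample. The extension g has to be defined off C since U_n and V_n leave C in general. Remainders
  are measured by the expectation of min 1 \<bar>r\<bar>, which a cutoff with values in [0, 1] can
  dominate.\<close>

lemma BL1D:
  assumes "g \<in> BL1 E d"
  shows "g \<in> borel_measurable (ball_sigma E d)"
    and "\<And>x y. x \<in> E \<Longrightarrow> y \<in> E \<Longrightarrow> \<bar>g x - g y\<bar> \<le> d x y"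
    and "\<And>x. x \<in> E \<Longrightarrow> \<bar>g x\<bar> \<le> 1"
  using assms by (auto simp: BL1_def)

lemma prob_integrable_bounded:
  fixes g :: "'a \<Rightarrow> real"
  assumes "prob_space \<mu>" "g \<in> borel_measurable \<mu>" "\<And>x. x \<in> space \<mu> \<Longrightarrow> \<bar>g x\<bar> \<le> K"
  shows "integrable \<mu> g"
proof -
  interpret prob_space \<mu> by fact
  show ?thesis by (rule integrable_const_bound[of _ K]) (use assms in auto)
qed

lemma prob_integral_abs_le:
  fixes g :: "'a \<Rightarrow> real"
  assumes "prob_space \<mu>" "g \<in> borel_measurable \<mu>" "\<And>x. x \<in> space \<mu> \<Longrightarrow> \<bar>g x\<bar> \<le> K"
  shows "\<bar>\<integral>x. g x \<partial>\<mu>\<bar> \<le> K"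
proof -
  interpret prob_space \<mu> by fact
  have i: "integrable \<mu> g" by (rule prob_integrable_bounded[OF assms])
  have "(\<integral>x. g x \<partial>\<mu>) \<le> K" by (rule integral_le_const[OF i]) (use assms(3) in \<open>force intro!: AE_I2\<close>)
  moreover have "- K \<le> (\<integral>x. g x \<partial>\<mu>)"
    by (rule integral_ge_const[OF i]) (use assms(3) in \<open>force intro!: AE_I2\<close>)
  ultimately show ?thesis by linarith
qed

lemma BL1_integral_diff_le:
  assumes "prob_space \<mu>" "prob_space \<nu>" "sets \<mu> = sets (ball_sigma E d)" "sets \<nu> = sets (ball_sigma E d)"
    and g: "g \<in> BL1 E d"
  shows "\<bar>(\<integral>x. g x \<partial>\<mu>) - (\<integral>x. g x \<partial>\<nu>)\<bar> \<le> 2"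
proof -
  have sp: "space \<mu> = E" "space \<nu> = E" using assms(3,4)[THEN sets_eq_imp_space_eq] by simp_all
  have m: "g \<in> borel_measurable \<mu>" "g \<in> borel_measurable \<nu>"
    using BL1D(1)[OF g] measurable_cong_sets[OF assms(3) refl] measurable_cong_sets[OF assms(4) refl]
    by auto
  have "\<bar>\<integral>x. g x \<partial>\<mu>\<bar> \<le> 1"
    by (rule prob_integral_abs_le[OF assms(1) m(1)]) (simp add: sp BL1D(3)[OF g])
  moreover have "\<bar>\<integral>x. g x \<partial>\<nu>\<bar> \<le> 1"
    by (rule prob_integral_abs_le[OF assms(2) m(2)]) (simp add: sp BL1D(3)[OF g])
  ultimately show ?thesis by linarith
qed

text \<open>A real supremum bounds its members only if the family is bounded above; two probability
  measures provide the bound 2.\<close>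

lemma BL1_integral_diff_le_dBL:
  assumes "prob_space \<mu>" "prob_space \<nu>" "sets \<mu> = sets (ball_sigma E d)" "sets \<nu> = sets (ball_sigma E d)"
    and "g \<in> BL1 E d"
  shows "\<bar>(\<integral>x. g x \<partial>\<mu>) - (\<integral>x. g x \<partial>\<nu>)\<bar> \<le> dBL E d \<mu> \<nu>"
  unfolding dBL_def
  by (rule cSUP_upper[OF assms(5)]) (use BL1_integral_diff_le[OF assms(1-4)] in \<open>auto intro!: bdd_aboveI[of _ 2]\<close>)

text \<open>The rescaled function \<open>g / K\<close> lies in the unit class. A single constant
  serves as Lipschitz constant and as bound, which is why applications take the maximum of a
  Lipschitz constant and 1.\<close>

lemma Lipschitz_integral_diff_le_dBL:
  fixes g :: "'e \<Rightarrow> real"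
  assumes \<mu>: "prob_space \<mu>" "prob_space \<nu>" "sets \<mu> = sets (ball_sigma E d)" "sets \<nu> = sets (ball_sigma E d)"
    and g: "g \<in> borel_measurable (ball_sigma E d)"
      "\<And>x y. x \<in> E \<Longrightarrow> y \<in> E \<Longrightarrow> \<bar>g x - g y\<bar> \<le> K * d x y" "\<And>x. x \<in> E \<Longrightarrow> \<bar>g x\<bar> \<le> K"
    and K: "0 < K"
  shows "\<bar>(\<integral>x. g x \<partial>\<mu>) - (\<integral>x. g x \<partial>\<nu>)\<bar> \<le> K * dBL E d \<mu> \<nu>"
proof -
  have "(\<lambda>x. g x / K) \<in> BL1 E d"
    unfolding BL1_def using g K by (auto simp: diff_divide_distrib[symmetric] divide_le_eq mult.commute)
  from BL1_integral_diff_le_dBL[OF \<mu> this]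
  have "\<bar>(\<integral>x. g x \<partial>\<mu>) - (\<integral>x. g x \<partial>\<nu>)\<bar> / K \<le> dBL E d \<mu> \<nu>"
    using K by (simp add: diff_divide_distrib[symmetric])
  then show ?thesis using K by (simp add: divide_le_eq mult.commute)
qed

section \<open>Measurable test functions built from distances to countably many centres\<close>

context Metric_space
begin

lemma zero_in_BL1: "(\<lambda>x. 0) \<in> BL1 M d"
  by (auto simp: BL1_def)

lemma dBL_leI:
  assumes "\<And>g. g \<in> BL1 M d \<Longrightarrow> \<bar>(\<integral>x. g x \<partial>\<mu>) - (\<integral>x. g x \<partial>\<nu>)\<bar> \<le> K"
  shows "dBL M d \<mu> \<nu> \<le> K"
  unfolding dBL_def using zero_in_BL1 assms by (intro cSUP_least) auto

lemma dBL_nonneg: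
  assumes "prob_space \<mu>" "prob_space \<nu>" "sets \<mu> = sets (ball_sigma M d)" "sets \<nu> = sets (ball_sigma M d)"
  shows "0 \<le> dBL M d \<mu> \<nu>"
  using BL1_integral_diff_le_dBL[OF assms zero_in_BL1] by simp

text \<open>Strict sublevel sets of the distance to a fixed centre are open balls, hence generators.
  All measurability of envelopes goes back to this fact.\<close>

lemma measurable_d_ball_sigma:
  assumes "x \<in> M"
  shows "(\<lambda>y. d x y) \<in> borel_measurable (ball_sigma M d)"
proof (rule borel_measurable_iff_less[THEN iffD2], rule allI)
  fix c
  have "{y \<in> space (ball_sigma M d). d x y < c} = mball x c" using assms by auto
  also have "\<dots> \<in> sets (ball_sigma M d)"
    unfolding ball_sigma_def using assms mball_subset_mspace
    by (subst sets_measure_of) (auto intro!: sigma_sets.Basic)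
  finally show "{y \<in> space (ball_sigma M d). d x y < c} \<in> sets (ball_sigma M d)" .
qed

text \<open>Lipschitz envelopes over countable index sets supply the test functions of the whole proof:
  unlike arbitrary continuous functions they are measurable for the open-ball sigma-algebra.\<close>

definition lip_env :: "real \<Rightarrow> ('a \<times> real) set \<Rightarrow> 'a \<Rightarrow> real" where
  "lip_env s S y = Inf (insert 1 ((\<lambda>(q, c). c + s * d y q) ` S))"

text \<open>\<open>Inf\<close> on the reals is meaningful only for nonempty sets that are bounded
  below. The inserted 1 gives the former, even for empty \<open>S\<close>, and caps the envelope;
  apex heights of at least -1 give the latter.\<close>

lemma bdd_below_lip_env:
  assumes "S \<subseteq> M \<times> {-1..}" "0 \<le> s"
  shows "bdd_below (insert 1 ((\<lambda>(q, c). c + s * d y q) ` S))"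
proof (rule bdd_belowI[of _ "-1"])
  fix z assume "z \<in> insert 1 ((\<lambda>(q, c). c + s * d y q) ` S)"
  moreover have "-1 \<le> c + s * d y q" if "(q, c) \<in> S" for q c
  proof -
    have "-1 \<le> c" using that assms by auto
    moreover have "0 \<le> s * d y q" using assms by simp
    ultimately show ?thesis by linarith
  qed
  ultimately show "-1 \<le> z" by auto
qed

lemma lip_env_le:
  assumes "S \<subseteq> M \<times> {-1..}" "0 \<le> s" "(q, c) \<in> S"
  shows "lip_env s S y \<le> c + s * d y q"
  unfolding lip_env_def by (rule cInf_lower[OF _ bdd_below_lip_env[OF assms(1,2)]]) (use assms(3) in force)

lemma lip_env_le_1:
  assumes "S \<subseteq> M \<times> {-1..}" "0 \<le> s"
  shows "lip_env s S y \<le> 1"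
  unfolding lip_env_def by (rule cInf_lower[OF _ bdd_below_lip_env[OF assms(1,2)]]) force

lemma lip_env_ge:
  assumes "b \<le> 1" "\<And>q c. (q, c) \<in> S \<Longrightarrow> b \<le> c + s * d y q"
  shows "b \<le> lip_env s S y"
  unfolding lip_env_def by (rule cInf_greatest) (use assms in auto)

lemma lip_env_ge_lower_bound:
  assumes "b \<le> 1" "S \<subseteq> M \<times> {b..}" "0 \<le> s"
  shows "b \<le> lip_env s S y"
proof (rule lip_env_ge[OF assms(1)])
  fix q c assume "(q, c) \<in> S"
  then have "b \<le> c" using assms by auto
  moreover have "0 \<le> s * d y q" using assms by simp
  ultimately show "b \<le> c + s * d y q" by linarith
qed

lemma abs_lip_env_le_1:
  assumes "S \<subseteq> M \<times> {-1..}" "0 \<le> s"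
  shows "\<bar>lip_env s S y\<bar> \<le> 1"
  using lip_env_le_1[OF assms, of y] lip_env_ge_lower_bound[of "-1", OF _ assms, of y] by linarith

text \<open>An infimum lies below \<open>b\<close> exactly if some member does. For countable
  \<open>S\<close> this writes sublevel sets as countable unions of balls, and it recovers a nearby
  centre from a small value of a cutoff.\<close>

lemma lip_env_less_iff:
  assumes "S \<subseteq> M \<times> {-1..}" "0 \<le> s"
  shows "lip_env s S y < b \<longleftrightarrow> 1 < b \<or> (\<exists>z\<in>S. snd z + s * d y (fst z) < b)"
  unfolding lip_env_def
  by (subst cInf_less_iff[OF _ bdd_below_lip_env[OF assms]]) (auto simp: case_prod_unfold)

lemma lip_env_Lipschitz:
  assumes S: "S \<subseteq> M \<times> {-1..}" "0 \<le> s" and xy: "x \<in> M" "y \<in> M"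
  shows "\<bar>lip_env s S x - lip_env s S y\<bar> \<le> s * d x y"
proof -
  have *: "lip_env s S x - s * d x y \<le> lip_env s S y" if "x \<in> M" "y \<in> M" for x y
  proof (rule lip_env_ge)
    have "0 \<le> s * d x y" using S by simp
    then show "lip_env s S x - s * d x y \<le> 1" using lip_env_le_1[OF S, of x] by linarith
    fix q c assume q: "(q, c) \<in> S"
    then have "d x q \<le> d x y + d y q" using S that by (intro triangle) auto
    then have "s * d x q \<le> s * d x y + s * d y q" using S(2) by (metis distrib_left mult_left_mono)
    then show "lip_env s S x - s * d x y \<le> c + s * d y q" using lip_env_le[OF S q, of x] by linarith
  qed
  from *[OF xy] *[OF xy(2,1)] show ?thesis by (simp add: commute abs_le_iff)
qed

lemma measurable_lip_env:
  assumes S: "S \<subseteq> M \<times> {-1..}" "0 \<le> s" and "countable S"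
  shows "lip_env s S \<in> borel_measurable (ball_sigma M d)"
proof (rule borel_measurable_iff_less[THEN iffD2], rule allI)
  fix b
  have m: "{y \<in> M. snd z + s * d y (fst z) < b} \<in> sets (ball_sigma M d)" if "z \<in> S" for z
  proof -
    have "fst z \<in> M" using that S by auto
    from measurable_d_ball_sigma[OF this]
    have "{y \<in> space (ball_sigma M d). snd z + s * d (fst z) y < b} \<in> sets (ball_sigma M d)"
      by measurable
    then show ?thesis by (simp add: commute)
  qed
  have "{y \<in> space (ball_sigma M d). lip_env s S y < b} =
      (if 1 < b then space (ball_sigma M d) else (\<Union>z\<in>S. {y \<in> M. snd z + s * d y (fst z) < b}))"
    by (auto simp: lip_env_less_iff[OF S])
  also have "\<dots> \<in> sets (ball_sigma M d)"
    using sets.countable_UN'[of S "\<lambda>z. {y \<in> M. snd z + s * d y (fst z) < b}" "ball_sigma M d"] \<open>countable S\<close> m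
    by (auto simp del: space_ball_sigma)
  finally show "{y \<in> space (ball_sigma M d). lip_env s S y < b} \<in> sets (ball_sigma M d)" .
qed

lemma Lipschitz_imp_continuous_map_real:
  assumes "\<And>x y. x \<in> M \<Longrightarrow> y \<in> M \<Longrightarrow> \<bar>g x - g y\<bar> \<le> L * d x y"
  shows "continuous_map mtopology euclideanreal g"
proof -
  have "\<exists>\<delta>>0. \<forall>x. x \<in> M \<and> d a x < \<delta> \<longrightarrow> dist (g a) (g x) < \<epsilon>" if "a \<in> M" "\<epsilon> > 0" for a \<epsilon>
  proof (intro exI conjI allI impI)
    \<comment> \<open>The sign of \<open>L\<close> is unknown; \<open>\<bar>L\<bar> + 1\<close> is
      positive and dominates \<open>L\<close>.\<close>
    show "0 < \<epsilon> / (\<bar>L\<bar> + 1)" using that by simp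
    fix x assume x: "x \<in> M \<and> d a x < \<epsilon> / (\<bar>L\<bar> + 1)"
    have "\<bar>g a - g x\<bar> \<le> L * d a x" using assms that x by blast
    also have "\<dots> \<le> (\<bar>L\<bar> + 1) * d a x" by (intro mult_right_mono) auto
    also have "\<dots> < \<epsilon>" using x by (simp add: field_simps)
    finally show "dist (g a) (g x) < \<epsilon>" by (simp add: dist_real_def)
  qed
  then show ?thesis
    using metric_continuous_map[OF Met_TC.Metric_space_axioms, of g] by simp
qed

lemma conv_distr_Lipschitz:
  assumes "conv_distr M d N X N0 X0" "g \<in> borel_measurable (ball_sigma M d)"
    and "\<And>x y. x \<in> M \<Longrightarrow> y \<in> M \<Longrightarrow> \<bar>g x - g y\<bar> \<le> L * d x y" "\<And>x. x \<in> M \<Longrightarrow> \<bar>g x\<bar> \<le> K"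
  shows "(\<lambda>n. \<integral>\<omega>. g (X n \<omega>) \<partial>N n) \<longlonglongrightarrow> (\<integral>\<omega>. g (X0 \<omega>) \<partial>N0)"
proof -
  have "bounded (g ` M)" unfolding bounded_iff using assms(4) by auto
  then show ?thesis
    using assms(1,2) Lipschitz_imp_continuous_map_real[OF assms(3)] unfolding conv_distr_def by blast
qed

lemma conv_distr_lip_env:
  assumes "conv_distr M d N X N0 X0" "S \<subseteq> M \<times> {-1..}" "0 \<le> s" "countable S"
  shows "(\<lambda>n. \<integral>\<omega>. lip_env s S (X n \<omega>) \<partial>N n) \<longlonglongrightarrow> (\<integral>\<omega>. lip_env s S (X0 \<omega>) \<partial>N0)"
  by (rule conv_distr_Lipschitz[OF assms(1) measurable_lip_env lip_env_Lipschitz abs_lip_env_le_1])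
    (use assms in auto)

text \<open>In a metric space separability passes to arbitrary subsets: whenever the ball of radius
  \<open>1 / (n + 1)\<close> around a point of a countable dense subset of \<open>C\<close> meets
  \<open>Q\<close>, one point of \<open>Q\<close> in it is selected. Subsets matter because the
  cutoffs are centred at points of \<open>C\<close> with a prescribed behaviour.\<close>

lemma separable_subset_countable_dense:
  assumes C: "C \<subseteq> M" "separable_space (subtopology mtopology C)" and Q: "Q \<subseteq> C"
  obtains D where "countable D" "D \<subseteq> Q" "\<And>x e. x \<in> Q \<Longrightarrow> 0 < e \<Longrightarrow> \<exists>q\<in>D. d x q < e"
proof -
  have [simp]: "topspace (subtopology mtopology C) = C" using C by auto
  obtain A where A: "countable A" "A \<subseteq> C" "subtopology mtopology C closure_of A = C"
    using C(2) unfolding separable_space_def by (metis \<open>topspace _ = C\<close>)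
  have dense: "\<exists>q\<in>A. d q x < e" if "x \<in> C" "0 < e" for x and e :: real
  proof -
    have "x \<in> mtopology closure_of A"
      using A(3) that(1) by (metis closure_of_subtopology_subset subsetD)
    then obtain q where "q \<in> A" "q \<in> mball x e" using \<open>0 < e\<close> unfolding metric_closure_of by blast
    then show ?thesis by (auto simp: commute)
  qed
  define I where "I = {(q, n) \<in> A \<times> (UNIV :: nat set). \<exists>x\<in>Q. d q x < 1 / real (Suc n)}"
  define c where "c = (\<lambda>(q, n). SOME x. x \<in> Q \<and> d q x < 1 / real (Suc n))"
  have c: "c (q, n) \<in> Q \<and> d q (c (q, n)) < 1 / real (Suc n)" if "(q, n) \<in> I" for q n
    unfolding c_def prod.case by (rule someI_ex) (use that in \<open>auto simp: I_def\<close>)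
  show ?thesis
  proof (rule that[of "c ` I"])
    have "I \<subseteq> A \<times> UNIV" by (auto simp: I_def)
    then show "countable (c ` I)" using A(1) by (meson countable_SIGMA countable_image countable_subset uncountable_def countableI_type)
    show "c ` I \<subseteq> Q" using c by auto
    fix x and e :: real assume x: "x \<in> Q" and e: "0 < e"
    obtain n where n: "1 / real (Suc n) < e / 2"
      using reals_Archimedean[of "e / 2"] e by (auto simp: inverse_eq_divide)
    obtain q where q: "q \<in> A" "d q x < 1 / real (Suc n)" using dense[of x "1 / real (Suc n)"] x Q by auto
    then have "(q, n) \<in> I" using x by (auto simp: I_def)
    from c[OF this] have "c (q, n) \<in> Q" "d q (c (q, n)) < 1 / real (Suc n)" by auto
    moreover have "d x (c (q, n)) \<le> d x q + d q (c (q, n))"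
      using x Q C A(2) q(1) calculation by (intro triangle) auto
    ultimately have "d x (c (q, n)) < e" using q(2) n by (simp add: commute)
    then show "\<exists>q\<in>c ` I. d x q < e" using \<open>(q, n) \<in> I\<close> by blast
  qed
qed

end

lemma integral_diff_le_integral:
  fixes f g k :: "'a \<Rightarrow> real"
  assumes "integrable \<mu> f" "integrable \<mu> g" "integrable \<mu> k"
    and "\<And>x. x \<in> space \<mu> \<Longrightarrow> \<bar>f x - g x\<bar> \<le> k x"
  shows "\<bar>(\<integral>x. f x \<partial>\<mu>) - (\<integral>x. g x \<partial>\<mu>)\<bar> \<le> (\<integral>x. k x \<partial>\<mu>)"
proof -
  have "\<bar>(\<integral>x. f x \<partial>\<mu>) - (\<integral>x. g x \<partial>\<mu>)\<bar> = \<bar>\<integral>x. f x - g x \<partial>\<mu>\<bar>" using assms by simp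
  also have "\<dots> \<le> (\<integral>x. \<bar>f x - g x\<bar> \<partial>\<mu>)" by (rule integral_abs_bound)
  also have "\<dots> \<le> (\<integral>x. k x \<partial>\<mu>)" using assms by (intro integral_mono) auto
  finally show ?thesis .
qed

lemma prob_bounded_convergence:
  fixes s :: "nat \<Rightarrow> 'a \<Rightarrow> real"
  assumes "prob_space \<mu>" "\<And>n. s n \<in> borel_measurable \<mu>" "\<And>n x. x \<in> space \<mu> \<Longrightarrow> \<bar>s n x\<bar> \<le> K"
    and "\<And>x. x \<in> space \<mu> \<Longrightarrow> (\<lambda>n. s n x) \<longlonglongrightarrow> t x"
  shows "(\<lambda>n. \<integral>x. s n x \<partial>\<mu>) \<longlonglongrightarrow> (\<integral>x. t x \<partial>\<mu>)"
proof (rule integral_dominated_convergence[where w = "\<lambda>_. K"])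
  interpret prob_space \<mu> by fact
  show "t \<in> borel_measurable \<mu>" using assms(2,4) by (rule borel_measurable_LIMSEQ_real[rotated])
  show "integrable \<mu> (\<lambda>_. K)" by simp
qed (use assms in auto)

section \<open>Metrisation of convergence in distribution when the limit has values in a separable
  set\<close>

context Metric_space
begin

lemma integrable_lip_env_compose:
  assumes "prob_space \<mu>" "X \<in> measurable \<mu> (ball_sigma M d)"
    and "S \<subseteq> M \<times> {-1..}" "0 \<le> s" "countable S"
  shows "integrable \<mu> (\<lambda>\<omega>. lip_env s S (X \<omega>))"
  by (rule prob_integrable_bounded[OF assms(1), of _ 1])
    (use measurable_compose[OF assms(2) measurable_lip_env] abs_lip_env_le_1 assms in auto)

text \<open>A cone of slope 1 whose apex lies on or above the graph of a 1-Lipschitz function stays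
  above that function. The cone over \<open>x\<close> overshoots at \<open>y\<close> by
  \<open>\<epsilon>\<close> from the rounded height, by one \<open>d y x\<close> from its slope and
  by another from the variation of \<open>h\<close>.\<close>

lemma lip_env_graph_approx:
  assumes h: "h \<in> BL1 M d" and X: "X \<subseteq> M" and c: "\<And>x. x \<in> X \<Longrightarrow> h x \<le> c x \<and> c x \<le> h x + \<epsilon>"
    and y: "y \<in> M"
  defines "S \<equiv> (\<lambda>x. (x, c x)) ` X"
  shows "S \<subseteq> M \<times> {-1..}" and "h y \<le> lip_env 1 S y"
    and "x \<in> X \<Longrightarrow> lip_env 1 S y \<le> h y + \<epsilon> + 2 * d y x"
proof -
  have hx: "-1 \<le> h x" "h x \<le> 1" "\<bar>h y - h x\<bar> \<le> d y x" if "x \<in> M" for x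
    using BL1D(3)[OF h that] BL1D(2)[OF h y that] by linarith+
  show S: "S \<subseteq> M \<times> {-1..}"
  proof -
    have "x \<in> M \<and> -1 \<le> c x" if "x \<in> X" for x using X c[OF that] hx(1)[of x] that by fastforce
    then show ?thesis by (auto simp: S_def)
  qed
  show "h y \<le> lip_env 1 S y"
  proof (rule lip_env_ge)
    fix q b assume "(q, b) \<in> S"
    then have q: "q \<in> X" "b = c q" by (auto simp: S_def)
    then have "q \<in> M" using X by blast
    then show "h y \<le> b + 1 * d y q" using c[OF q(1)] hx(3)[of q] q(2) by linarith
  qed (use hx[OF y] in simp)
  assume x: "x \<in> X"
  then have "lip_env 1 S y \<le> c x + 1 * d y x" by (intro lip_env_le[OF S]) (auto simp: S_def)
  then show "lip_env 1 S y \<le> h y + \<epsilon> + 2 * d y x" using c[OF x] hx(3)[of x] subsetD[OF X x] by linarith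
qed

text \<open>Values are rounded up, not to the nearest grid point, so that cones with rounded heights
  remain above the function they approximate.\<close>

lemma finite_grid:
  assumes "0 < \<epsilon>"
  obtains G :: "real set" where "finite G" "\<And>u. -1 \<le> u \<Longrightarrow> u \<le> 1 \<Longrightarrow> \<exists>c\<in>G. u \<le> c \<and> c \<le> u + \<epsilon>"
proof
  let ?G = "(\<lambda>j::nat. -1 + \<epsilon> * real j) ` {..nat \<lceil>2 / \<epsilon>\<rceil>}"
  show "finite ?G" by simp
  fix u :: real assume u: "-1 \<le> u" "u \<le> 1"
  define j where "j = nat \<lceil>(u + 1) / \<epsilon>\<rceil>"
  have j: "real j = of_int \<lceil>(u + 1) / \<epsilon>\<rceil>" using u assms by (simp add: j_def)
  have 1: "(u + 1) / \<epsilon> \<le> real j" "real j \<le> (u + 1) / \<epsilon> + 1" unfolding j by linarith+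
  have "(u + 1) / \<epsilon> \<le> 2 / \<epsilon>" using u assms by (simp add: divide_right_mono)
  then have jle: "j \<le> nat \<lceil>2 / \<epsilon>\<rceil>" unfolding j_def by (intro nat_mono ceiling_mono)
  have "u + 1 \<le> \<epsilon> * real j" using 1(1) assms by (simp add: divide_le_eq mult.commute)
  moreover have "\<epsilon> * real j \<le> \<epsilon> * ((u + 1) / \<epsilon> + 1)" using 1(2) assms by (intro mult_left_mono) auto
  moreover have "\<epsilon> * ((u + 1) / \<epsilon> + 1) = u + 1 + \<epsilon>" using assms by (simp add: field_simps)
  ultimately have "u \<le> -1 + \<epsilon> * real j \<and> -1 + \<epsilon> * real j \<le> u + \<epsilon>" by linarith
  then show "\<exists>c\<in>?G. u \<le> c \<and> c \<le> u + \<epsilon>" using jle by blast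
qed

text \<open>Up to an error controlled by the capped distance to finitely many centres, every function in
  the unit ball of bounded Lipschitz functions is an envelope from a finite family, so
  convergence for this finite family suffices.\<close>

lemma conv_distr_imp_dBL_tendsto_0:
  assumes conv: "conv_distr M d (\<lambda>n. N) V N0 B" and N: "prob_space N" and N0: "prob_space N0"
    and C: "C \<subseteq> M" "separable_space (subtopology mtopology C)" and BC: "\<And>\<omega>. \<omega> \<in> space N0 \<Longrightarrow> B \<omega> \<in> C"
  shows "(\<lambda>n. dBL M d (distr N (ball_sigma M d) (V n)) (distr N0 (ball_sigma M d) B)) \<longlonglongrightarrow> 0"
proof -
  let ?\<Sigma> = "ball_sigma M d"
  have V: "V n \<in> measurable N ?\<Sigma>" if "n \<ge> 1" for n using conv that by (auto simp: conv_distr_def)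
  have B: "B \<in> measurable N0 ?\<Sigma>" using conv by (auto simp: conv_distr_def)
  obtain D where D: "countable D" "D \<subseteq> C" "\<And>x e. x \<in> C \<Longrightarrow> 0 < e \<Longrightarrow> \<exists>q\<in>D. d x q < e"
    by (rule separable_subset_countable_dense[OF C, of C]) auto
  \<comment> \<open>A probability space is nonempty, so \<open>B\<close> attains a value in
    \<open>C\<close> and \<open>D\<close> cannot be empty; \<open>from_nat_into\<close> enumerates
    only nonempty sets.\<close>
  obtain \<omega>0 where "\<omega>0 \<in> space N0" using prob_space.not_empty[OF N0] by blast
  then have Dne: "D \<noteq> {}" using D(3)[of "B \<omega>0" 1] BC by auto
  define x where "x = from_nat_into D"
  have x: "range x = D" unfolding x_def by (rule range_from_nat_into[OF Dne D(1)])
  have xM: "x i \<in> M" for i using x D(2) C(1) by blast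
  \<comment> \<open>Apexes of height 0: the resulting \<open>\<theta> m\<close> is the distance to
    \<open>x 0\<close>, ..., \<open>x m\<close> capped at 1. It decreases to 0 on \<open>C\<close>,
    so a large \<open>m\<close> makes its mean under the law of \<open>B\<close> small.\<close>
  define T where "T m = (\<lambda>i::nat. (x i, 0::real)) ` {..m}" for m
  have T: "T m \<subseteq> M \<times> {0..}" "T m \<subseteq> M \<times> {-1..}" "countable (T m)" for m
    using xM by (auto simp: T_def)
  define \<theta> where "\<theta> m = lip_env 1 (T m)" for m
  have \<theta>le: "\<theta> m y \<le> d y (x i)" if "i \<le> m" for m i y
    using lip_env_le[OF T(2), of 1 "x i" 0 m y] that by (auto simp: \<theta>_def T_def)
  have \<theta>0: "0 \<le> \<theta> m y" for m y
    unfolding \<theta>_def by (rule lip_env_ge_lower_bound[OF _ T(1)]) auto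
  have \<theta>1: "\<bar>\<theta> m y\<bar> \<le> 1" for m y unfolding \<theta>_def by (rule abs_lip_env_le_1[OF T(2)]) simp
  have \<theta>m: "\<theta> m \<in> borel_measurable ?\<Sigma>" for m
    unfolding \<theta>_def by (rule measurable_lip_env[OF T(2) _ T(3)]) simp
  have "(\<lambda>m. \<integral>\<omega>. \<theta> m (B \<omega>) \<partial>N0) \<longlonglongrightarrow> (\<integral>\<omega>. 0 \<partial>N0)"
  proof (rule prob_bounded_convergence[OF N0])
    show "(\<lambda>\<omega>. \<theta> m (B \<omega>)) \<in> borel_measurable N0" for m by (rule measurable_compose[OF B \<theta>m])
    fix \<omega> assume \<omega>: "\<omega> \<in> space N0"
    show "(\<lambda>m. \<theta> m (B \<omega>)) \<longlonglongrightarrow> 0"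
    proof (rule LIMSEQ_I)
      fix r :: real assume "0 < r"
      then obtain i where i: "d (B \<omega>) (x i) < r" using D(3)[OF BC[OF \<omega>], of r] x by blast
      have "norm (\<theta> m (B \<omega>) - 0) < r" if "m \<ge> i" for m using \<theta>le[OF that, of "B \<omega>"] \<theta>0[of m "B \<omega>"] i by simp
      then show "\<exists>no. \<forall>m\<ge>no. norm (\<theta> m (B \<omega>) - 0) < r" by blast
    qed
  qed (use \<theta>1 in auto)
  then have lim\<theta>: "(\<lambda>m. \<integral>\<omega>. \<theta> m (B \<omega>) \<partial>N0) \<longlonglongrightarrow> 0" by simp
  show ?thesis
  proof (rule LIMSEQ_I)
    fix e :: real assume "0 < e"
    \<comment> \<open>Seven of these eight parts are spent:
      \<open>\<epsilon> + 2 * \<epsilon>\<close> to replace \<open>h\<close> by an envelope under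
      the law of \<open>V n\<close>, the same under the law of \<open>B\<close>, and one
      \<open>\<epsilon>\<close> for the convergence of the envelope integrals.\<close>
    define \<epsilon> where "\<epsilon> = e / 8"
    have \<epsilon>: "0 < \<epsilon>" using \<open>0 < e\<close> by (simp add: \<epsilon>_def)
    obtain m where m: "(\<integral>\<omega>. \<theta> m (B \<omega>) \<partial>N0) < \<epsilon>"
      using order_tendstoD(2)[OF lim\<theta> \<epsilon>] by (auto simp: eventually_sequentially)
    obtain G where G: "finite G" "\<And>u. -1 \<le> u \<Longrightarrow> u \<le> 1 \<Longrightarrow> \<exists>c\<in>G. u \<le> c \<and> c \<le> u + \<epsilon>"
      using finite_grid[OF \<epsilon>] by blast
    \<comment> \<open>The family is fixed before \<open>h\<close> and is finite, so convergence is
      uniform over it; this is how convergence of single integrals becomes convergence of a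
      supremum. The condition on heights is imposed because the grid may extend below -1.\<close>
    define \<S> where "\<S> = {S. S \<subseteq> x ` {..m} \<times> G \<and> S \<subseteq> M \<times> {-1..}}"
    have fin: "finite \<S>" unfolding \<S>_def using G(1) by simp
    have \<S>: "S \<subseteq> M \<times> {-1..}" "countable S" if "S \<in> \<S>" for S
    proof -
      have "finite (x ` {..m} \<times> G)" using G(1) by simp
      then show "S \<subseteq> M \<times> {-1..}" "countable S"
        using that finite_subset[of S] by (auto simp: \<S>_def countable_finite)
    qed
    have "\<forall>\<^sub>F n in sequentially. \<forall>S\<in>\<S>. \<bar>(\<integral>\<omega>. lip_env 1 S (V n \<omega>) \<partial>N) - (\<integral>\<omega>. lip_env 1 S (B \<omega>) \<partial>N0)\<bar> < \<epsilon>"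
    proof (rule eventually_ball_finite[OF fin], rule ballI)
      fix S assume "S \<in> \<S>"
      from tendstoD[OF conv_distr_lip_env[OF conv \<S>(1)[OF this] _ \<S>(2)[OF this], of 1] \<epsilon>]
      show "\<forall>\<^sub>F n in sequentially. \<bar>(\<integral>\<omega>. lip_env 1 S (V n \<omega>) \<partial>N) - (\<integral>\<omega>. lip_env 1 S (B \<omega>) \<partial>N0)\<bar> < \<epsilon>"
        by (simp add: dist_real_def)
    qed
    moreover have "\<forall>\<^sub>F n in sequentially. (\<integral>\<omega>. \<theta> m (V n \<omega>) \<partial>N) < \<epsilon>"
      using conv_distr_lip_env[OF conv T(2) _ T(3), of 1 m] m
      unfolding \<theta>_def by (intro order_tendstoD(2)) auto
    moreover have "\<forall>\<^sub>F n in sequentially. n \<ge> (1::nat)" by (rule eventually_ge_at_top)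
    ultimately have "\<forall>\<^sub>F n in sequentially. norm (dBL M d (distr N ?\<Sigma> (V n)) (distr N0 ?\<Sigma> B) - 0) < e"
    proof eventually_elim
      case (elim n)
      note Vn = V[OF elim(3)]
      have pr: "prob_space (distr N ?\<Sigma> (V n))" "prob_space (distr N0 ?\<Sigma> B)"
        using N N0 Vn B by (auto intro: prob_space.prob_space_distr)
      have "dBL M d (distr N ?\<Sigma> (V n)) (distr N0 ?\<Sigma> B) \<le> 7 * \<epsilon>"
      proof (rule dBL_leI)
        fix h assume h: "h \<in> BL1 M d"
        have hb: "\<bar>h y\<bar> \<le> 1" if "y \<in> M" for y using BL1D(3)[OF h that] .
        have "\<forall>y\<in>x ` {..m}. \<exists>c\<in>G. h y \<le> c \<and> c \<le> h y + \<epsilon>"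
          using G(2) hb xM by (auto simp: abs_le_iff)
        then obtain c where c: "\<And>y. y \<in> x ` {..m} \<Longrightarrow> c y \<in> G \<and> h y \<le> c y \<and> c y \<le> h y + \<epsilon>" by metis
        define S where "S = (\<lambda>y. (y, c y)) ` (x ` {..m})"
        have xm: "x ` {..m} \<subseteq> M" using xM by blast
        have approx: "h y \<le> lip_env 1 S y" "\<And>i. i \<le> m \<Longrightarrow> lip_env 1 S y \<le> h y + \<epsilon> + 2 * d y (x i)"
          if "y \<in> M" for y
          using lip_env_graph_approx[OF h xm, of c \<epsilon> y] c that unfolding S_def by auto
        have S: "S \<in> \<S>"
          using lip_env_graph_approx(1)[OF h xm, of c \<epsilon> "x 0"] c xM unfolding S_def \<S>_def by auto
        have close: "\<bar>h y - lip_env 1 S y\<bar> \<le> \<epsilon> + 2 * \<theta> m y" if y: "y \<in> M" for y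
        proof -
          \<comment> \<open>The estimate holds for each of the centres, hence for the infimum over
            them. It also respects the cap, because both functions have values in [-1, 1] and half
            their difference is at most 1.\<close>
          have "(lip_env 1 S y - h y - \<epsilon>) / 2 \<le> \<theta> m y"
            unfolding \<theta>_def
          proof (rule lip_env_ge)
            show "(lip_env 1 S y - h y - \<epsilon>) / 2 \<le> 1"
              using lip_env_le_1[OF \<S>(1)[OF S], of 1 y] hb[OF y] \<epsilon> by auto
            fix q b assume "(q, b) \<in> T m"
            then show "(lip_env 1 S y - h y - \<epsilon>) / 2 \<le> b + 1 * d y q"
              using approx(2)[OF y] by (auto simp: T_def field_simps)
          qed
          then show ?thesis using approx(1)[OF y] by simp
        qed
        have bnd: "\<bar>(\<integral>\<omega>. h (Y \<omega>) \<partial>\<mu>) - (\<integral>\<omega>. lip_env 1 S (Y \<omega>) \<partial>\<mu>)\<bar> \<le> \<epsilon> + 2 * (\<integral>\<omega>. \<theta> m (Y \<omega>) \<partial>\<mu>)"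
          if \<mu>: "prob_space \<mu>" and Y: "Y \<in> measurable \<mu> ?\<Sigma>" for \<mu> :: "'z measure" and Y
        proof -
          interpret \<mu>: prob_space \<mu> by fact
          have YM: "Y \<omega> \<in> M" if "\<omega> \<in> space \<mu>" for \<omega> using measurable_space[OF Y that] by simp
          have i\<theta>: "integrable \<mu> (\<lambda>\<omega>. \<theta> m (Y \<omega>))" unfolding \<theta>_def
            by (rule integrable_lip_env_compose[OF \<mu> Y T(2) _ T(3)]) simp
          have "\<bar>(\<integral>\<omega>. h (Y \<omega>) \<partial>\<mu>) - (\<integral>\<omega>. lip_env 1 S (Y \<omega>) \<partial>\<mu>)\<bar> \<le> (\<integral>\<omega>. \<epsilon> + 2 * \<theta> m (Y \<omega>) \<partial>\<mu>)"
          proof (rule integral_diff_le_integral)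
            show "integrable \<mu> (\<lambda>\<omega>. h (Y \<omega>))"
              by (rule prob_integrable_bounded[OF \<mu> measurable_compose[OF Y BL1D(1)[OF h]]])
                (use hb YM in auto)
            show "integrable \<mu> (\<lambda>\<omega>. lip_env 1 S (Y \<omega>))"
              by (rule integrable_lip_env_compose[OF \<mu> Y]) (use \<S>[OF S] in auto)
          qed (use i\<theta> close YM in auto)
          also have "\<dots> = \<epsilon> + 2 * (\<integral>\<omega>. \<theta> m (Y \<omega>) \<partial>\<mu>)" using i\<theta> by (simp add: \<mu>.prob_space)
          finally show ?thesis .
        qed
        have "\<bar>(\<integral>\<omega>. h (V n \<omega>) \<partial>N) - (\<integral>\<omega>. h (B \<omega>) \<partial>N0)\<bar> \<le> 7 * \<epsilon>"
          using bnd[OF N Vn] bnd[OF N0 B] bspec[OF elim(1) S] elim(2) m by linarith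
        then show "\<bar>integral\<^sup>L (distr N ?\<Sigma> (V n)) h - integral\<^sup>L (distr N0 ?\<Sigma> B) h\<bar> \<le> 7 * \<epsilon>"
          using integral_distr[OF Vn BL1D(1)[OF h]] integral_distr[OF B BL1D(1)[OF h]] by simp
      qed
      moreover have "0 \<le> dBL M d (distr N ?\<Sigma> (V n)) (distr N0 ?\<Sigma> B)"
        by (rule dBL_nonneg[OF pr]) auto
      ultimately show ?case using \<epsilon> by (simp add: \<epsilon>_def)
    qed
    then show "\<exists>no. \<forall>n\<ge>no. norm (dBL M d (distr N ?\<Sigma> (V n)) (distr N0 ?\<Sigma> B) - 0) < e"
      by (simp add: eventually_sequentially)
  qed
qed

section \<open>Lipschitz envelopes of bounded continuous functions on a separable set\<close>

lemma lip_env_graph_le: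
  assumes D: "D \<subseteq> C" "C \<subseteq> M" "\<And>x e. x \<in> C \<Longrightarrow> 0 < e \<Longrightarrow> \<exists>q\<in>D. d x q < e"
    and p: "\<And>x. x \<in> C \<Longrightarrow> \<bar>p x\<bar> \<le> 1"
      "\<And>x e. x \<in> C \<Longrightarrow> 0 < e \<Longrightarrow> \<exists>\<delta>>0. \<forall>y\<in>C. d x y < \<delta> \<longrightarrow> \<bar>p x - p y\<bar> < e"
    and L: "0 \<le> L" and x: "x \<in> C"
  shows "lip_env L ((\<lambda>q. (q, p q)) ` D) x \<le> p x"
proof (rule field_le_epsilon)
  fix e :: real assume e: "0 < e"
  have "q \<in> M \<and> -1 \<le> p q" if "q \<in> D" for q using D(1,2) p(1)[of q] that by (auto simp: abs_le_iff)
  then have S: "(\<lambda>q. (q, p q)) ` D \<subseteq> M \<times> {-1..}" by auto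
  obtain \<delta> where \<delta>: "\<delta> > 0" "\<And>y. y \<in> C \<Longrightarrow> d x y < \<delta> \<Longrightarrow> \<bar>p x - p y\<bar> < e / 2"
    using p(2)[OF x, of "e / 2"] e by auto
  \<comment> \<open>The centre is chosen so near that \<open>p\<close> changes by less than
    \<open>e / 2\<close> and the cone rises by at most \<open>e / 2\<close>; \<open>L + 1\<close>
    avoids a division by 0.\<close>
  have "0 < min \<delta> (e / (2 * (L + 1)))" using \<delta>(1) e L by simp
  then obtain q where q: "q \<in> D" "d x q < min \<delta> (e / (2 * (L + 1)))" using D(3)[OF x] by blast
  have "lip_env L ((\<lambda>q. (q, p q)) ` D) x \<le> p q + L * d x q" using q(1) by (intro lip_env_le[OF S L]) auto
  moreover have "\<bar>p x - p q\<bar> < e / 2" using \<delta>(2)[of q] q D by auto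
  moreover have "L * d x q \<le> e / 2"
  proof -
    have "L * d x q \<le> (L + 1) * d x q" by (intro mult_right_mono) auto
    also have "\<dots> \<le> (L + 1) * (e / (2 * (L + 1)))" using q L by (intro mult_left_mono) auto
    also have "\<dots> = e / 2" using L by (simp add: field_simps)
    finally show ?thesis .
  qed
  ultimately show "lip_env L ((\<lambda>q. (q, p q)) ` D) x \<le> p x + e" by linarith
qed

text \<open>These are the Pasch-Hausdorff regularisations of \<open>p\<close> with slopes
  \<open>k\<close>. A cone whose apex is at distance at least \<open>\<delta>\<close> has risen by
  more than 2, the largest possible oscillation of \<open>p\<close>, once \<open>k\<close> exceeds
  \<open>2 / \<delta>\<close>; only apexes near \<open>x\<close> then decide the infimum, and there
  \<open>p\<close> is close to \<open>p x\<close>.\<close>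

lemma lip_env_graph_tendsto:
  assumes D: "D \<subseteq> C" "C \<subseteq> M" "\<And>x e. x \<in> C \<Longrightarrow> 0 < e \<Longrightarrow> \<exists>q\<in>D. d x q < e"
    and p: "\<And>x. x \<in> C \<Longrightarrow> \<bar>p x\<bar> \<le> 1"
      "\<And>x e. x \<in> C \<Longrightarrow> 0 < e \<Longrightarrow> \<exists>\<delta>>0. \<forall>y\<in>C. d x y < \<delta> \<longrightarrow> \<bar>p x - p y\<bar> < e"
    and x: "x \<in> C"
  shows "(\<lambda>k. lip_env (real k) ((\<lambda>q. (q, p q)) ` D) x) \<longlonglongrightarrow> p x"
proof (rule LIMSEQ_I)
  fix e :: real assume e: "0 < e"
  obtain \<delta> where \<delta>: "\<delta> > 0" "\<And>y. y \<in> C \<Longrightarrow> d x y < \<delta> \<Longrightarrow> \<bar>p x - p y\<bar> < e / 2"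
    using p(2)[OF x, of "e / 2"] e by auto
  obtain k0 where k0: "2 / \<delta> < real k0" using reals_Archimedean2 by blast
  have "norm (lip_env (real k) ((\<lambda>q. (q, p q)) ` D) x - p x) < e" if k: "k \<ge> k0" for k
  proof -
    have "p x - e / 2 \<le> lip_env (real k) ((\<lambda>q. (q, p q)) ` D) x"
    proof (rule lip_env_ge)
      show "p x - e / 2 \<le> 1" using p(1)[OF x] e by auto
      fix q b assume "(q, b) \<in> (\<lambda>q. (q, p q)) ` D"
      then have q: "q \<in> C" "b = p q" using D by auto
      show "p x - e / 2 \<le> b + real k * d x q"
      proof (cases "d x q < \<delta>")
        case True
        have "0 \<le> real k * d x q" by simp
        then show ?thesis using \<delta>(2)[OF q(1) True] q(2) by linarith
      next
        case False
        have "2 < real k0 * \<delta>" using k0 \<delta>(1) by (simp add: field_simps)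
        also have "\<dots> \<le> real k * d x q" using False k \<delta>(1) by (intro mult_mono) auto
        finally show ?thesis using p(1)[OF x] p(1)[OF q(1)] q(2) e by auto
      qed
    qed
    moreover have "lip_env (real k) ((\<lambda>q. (q, p q)) ` D) x \<le> p x"
      by (rule lip_env_graph_le[OF D p]) (use x in auto)
    ultimately show ?thesis using e by auto
  qed
  then show "\<exists>no. \<forall>k\<ge>no. norm (lip_env (real k) ((\<lambda>q. (q, p q)) ` D) x - p x) < e" by blast
qed

end

section \<open>The extended continuous mapping theorem\<close>

context Metric_space
begin

text \<open>Quantified form of the hypothesis of the extended continuous mapping theorem:
  \<open>G n\<close> evaluated at points of \<open>A n\<close> that approach a point
  \<open>x\<close> of \<open>C\<close> tends to \<open>G0 x\<close>, also along subsequences. One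
  number \<open>k\<close> is both the index threshold and the inverse radius, so that the points at
  which a given \<open>k\<close> works form a single sequence of sets, increasing in
  \<open>k\<close>.\<close>

definition ext_conv :: "(nat \<Rightarrow> 'a set) \<Rightarrow> (nat \<Rightarrow> 'a \<Rightarrow> real) \<Rightarrow> 'a set \<Rightarrow> ('a \<Rightarrow> real) \<Rightarrow> bool" where
  "ext_conv A G C G0 \<longleftrightarrow>
     (\<forall>x\<in>C. \<forall>e>0. \<exists>k. \<forall>n>k. \<forall>y\<in>A n. d x y < 1 / real (Suc k) \<longrightarrow> \<bar>G n y - G0 x\<bar> \<le> e)"

text \<open>The cutoff measures the distance to the set of points of \<open>C\<close> at which \<open>G n\<close> is within \<open>e\<close>
  of the limit on a ball of radius \<open>1 / (k + 1)\<close> for all \<open>n > k\<close>. These sets increase to \<open>C\<close>.\<close>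

lemma ext_conv_cutoff:
  assumes ext: "ext_conv A G C G0" and C: "C \<subseteq> M" "separable_space (subtopology mtopology C)"
    and e: "0 < e" and r: "0 < r"
  obtains S s where "\<And>k. countable (S k)" "\<And>k. S k \<subseteq> M \<times> {0..}" "\<And>k::nat. 0 \<le> s k"
    "\<And>x. x \<in> C \<Longrightarrow> (\<lambda>k. lip_env (s k) (S k) x) \<longlonglongrightarrow> 0"
    "\<And>k n y. k < n \<Longrightarrow> y \<in> A n \<Longrightarrow> lip_env (s k) (S k) y < 1 \<Longrightarrow> \<exists>x\<in>C. d x y < r \<and> \<bar>G n y - G0 x\<bar> \<le> e"
proof -
  define Q where "Q k = {x \<in> C. \<forall>n>k. \<forall>y\<in>A n. d x y < 1 / real (Suc k) \<longrightarrow> \<bar>G n y - G0 x\<bar> \<le> e}" for k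
  have QC: "Q k \<subseteq> C" for k by (auto simp: Q_def)
  have "\<exists>D. countable D \<and> D \<subseteq> Q k \<and> (\<forall>x\<in>Q k. \<forall>e>0. \<exists>q\<in>D. d x q < e)" for k
    by (rule separable_subset_countable_dense[OF C QC, of k]) blast
  then obtain D where D: "\<And>k. countable (D k)" "\<And>k. D k \<subseteq> Q k"
      "\<And>k x e. x \<in> Q k \<Longrightarrow> 0 < e \<Longrightarrow> \<exists>q\<in>D k. d x q < e"
    by metis
  define S where "S k = (\<lambda>q. (q, 0::real)) ` D k" for k
  \<comment> \<open>The apexes have height 0, so a value below 1 means that some centre is nearer
    than \<open>1 / s k\<close>; the maximum keeps this below both \<open>1 / (k + 1)\<close> and
    \<open>r\<close>.\<close>
  define s where "s k = max (real (Suc k)) (1 / r)" for k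
  have S0: "S k \<subseteq> M \<times> {0..}" for k using D(2) QC C(1) by (fastforce simp: S_def)
  then have S: "S k \<subseteq> M \<times> {-1..}" for k by fastforce
  have s: "0 < s k" for k by (simp add: s_def less_max_iff_disj)
  show ?thesis
  proof (rule that[of S s])
    show "countable (S k)" for k using D(1) by (simp add: S_def)
    show "0 \<le> s k" for k using s[of k] by simp
    fix x assume x: "x \<in> C"
    obtain k where k: "\<And>n y. n > k \<Longrightarrow> y \<in> A n \<Longrightarrow> d x y < 1 / real (Suc k) \<Longrightarrow> \<bar>G n y - G0 x\<bar> \<le> e"
      using ext x e unfolding ext_conv_def by blast
    \<comment> \<open>The point belongs to \<open>Q j\<close> from some index on, and the cutoff is
      zero on all of \<open>Q j\<close> by density of its centres. The limit is thus reached after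
      finitely many indices.\<close>
    have zero: "lip_env (s j) (S j) x = 0" if j: "j \<ge> k" for j
    proof (rule antisym)
      have xQ: "x \<in> Q j"
      proof -
        have "1 / real (Suc j) \<le> 1 / real (Suc k)" using j by (simp add: frac_le)
        then show ?thesis using x k j unfolding Q_def by force
      qed
      show "0 \<le> lip_env (s j) (S j) x" by (rule lip_env_ge_lower_bound[OF _ S0]) (use s[of j] in auto)
      show "lip_env (s j) (S j) x \<le> 0"
      proof (rule field_le_epsilon)
        fix t :: real assume "0 < t"
        then have "0 < t / s j" using s by simp
        then obtain q where q: "q \<in> D j" "d x q < t / s j" using D(3)[OF xQ] by blast
        have "lip_env (s j) (S j) x \<le> 0 + s j * d x q"
          by (rule lip_env_le[OF S]) (use q s[of j] in \<open>auto simp: S_def\<close>)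
        also have "\<dots> \<le> 0 + t" using q(2) s[of j] by (simp add: field_simps)
        finally show "lip_env (s j) (S j) x \<le> 0 + t" .
      qed
    qed
    show "(\<lambda>k. lip_env (s k) (S k) x) \<longlonglongrightarrow> 0"
      by (rule tendsto_eventually) (use zero in \<open>auto simp: eventually_sequentially\<close>)
  next
    fix k n y assume kn: "k < n" and y: "y \<in> A n" and lt: "lip_env (s k) (S k) y < 1"
    then obtain q where q: "q \<in> D k" "s k * d y q < 1"
      using lip_env_less_iff[OF S, of "s k" k y 1] s[of k] by (auto simp: S_def)
    have "d y q < 1 / s k" using q(2) s[of k] by (simp add: field_simps)
    moreover have "1 / s k \<le> 1 / real (Suc k)" by (intro frac_le) (auto simp: s_def)
    moreover have "1 / s k \<le> r"
    proof -
      have "1 / s k \<le> 1 / (1 / r)" by (intro frac_le) (use r in \<open>auto simp: s_def\<close>)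
      then show ?thesis by simp
    qed
    ultimately have "d q y < r" "d q y < 1 / real (Suc k)" by (auto simp: commute)
    moreover have "q \<in> Q k" using q D(2) by blast
    ultimately show "\<exists>x\<in>C. d x y < r \<and> \<bar>G n y - G0 x\<bar> \<le> e" using kn y unfolding Q_def by blast
  qed (rule S0)
qed

lemma continuous_map_subtopology_realD:
  assumes "continuous_map (subtopology mtopology C) euclideanreal p" "C \<subseteq> M" "x \<in> C" "0 < e"
  shows "\<exists>\<delta>>0. \<forall>y\<in>C. d x y < \<delta> \<longrightarrow> \<bar>p x - p y\<bar> < e"
proof -
  have "openin (subtopology mtopology C) {y \<in> topspace (subtopology mtopology C). p y \<in> ball (p x) e}"
    by (rule openin_continuous_map_preimage[OF assms(1)]) auto
  then obtain T where T: "openin mtopology T" "{y \<in> C. p y \<in> ball (p x) e} = T \<inter> C"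
    using assms(2) by (auto simp: openin_subtopology Int_absorb1)
  have "x \<in> T" using T(2) assms by auto
  then obtain \<delta> where "\<delta> > 0" "mball x \<delta> \<subseteq> T" using T(1) unfolding openin_mtopology by blast
  moreover have "\<bar>p x - p y\<bar> < e" if "y \<in> C" "d x y < \<delta>" for y
  proof -
    have "y \<in> mball x \<delta>" using that assms by auto
    then show ?thesis using calculation T(2) that by (auto simp: dist_real_def)
  qed
  ultimately show ?thesis by blast
qed

text \<open>Continuity on \<open>C\<close> gives no direct access to the ball sigma-algebra.
  Measurability is inherited from the envelopes of \<open>p\<close>, which are measurable on the
  whole space and converge to \<open>p\<close> at every value of \<open>B\<close>.\<close>

lemma measurable_continuous_on_separable_bounded:
  fixes p :: "'a \<Rightarrow> real"
  assumes B: "B \<in> measurable N0 (ball_sigma M d)" "\<And>\<omega>. \<omega> \<in> space N0 \<Longrightarrow> B \<omega> \<in> C"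
    and C: "C \<subseteq> M" "separable_space (subtopology mtopology C)"
    and p: "\<And>x. x \<in> C \<Longrightarrow> \<bar>p x\<bar> \<le> 1"
      "\<And>x e. x \<in> C \<Longrightarrow> 0 < e \<Longrightarrow> \<exists>\<delta>>0. \<forall>y\<in>C. d x y < \<delta> \<longrightarrow> \<bar>p x - p y\<bar> < e"
  shows "(\<lambda>\<omega>. p (B \<omega>)) \<in> borel_measurable N0"
proof -
  obtain D where D: "countable D" "D \<subseteq> C" "\<And>x e. x \<in> C \<Longrightarrow> 0 < e \<Longrightarrow> \<exists>q\<in>D. d x q < e"
    by (rule separable_subset_countable_dense[OF C, of C]) auto
  have S: "(\<lambda>q. (q, p q)) ` D \<subseteq> M \<times> {-1..}" using D(2) C(1) p(1) by (auto simp: abs_le_iff)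
  show ?thesis
  proof (rule borel_measurable_LIMSEQ_real)
    show "(\<lambda>k. lip_env (real k) ((\<lambda>q. (q, p q)) ` D) (B \<omega>)) \<longlonglongrightarrow> p (B \<omega>)" if "\<omega> \<in> space N0" for \<omega>
      by (rule lip_env_graph_tendsto[OF D(2) C(1) D(3) p B(2)[OF that]]) auto
    show "(\<lambda>\<omega>. lip_env (real k) ((\<lambda>q. (q, p q)) ` D) (B \<omega>)) \<in> borel_measurable N0" for k
      by (rule measurable_compose[OF B(1) measurable_lip_env[OF S]]) (use D(1) in auto)
  qed
qed

lemma measurable_continuous_on_separable:
  assumes B: "B \<in> measurable N0 (ball_sigma M d)" "\<And>\<omega>. \<omega> \<in> space N0 \<Longrightarrow> B \<omega> \<in> C"
    and C: "C \<subseteq> M" "separable_space (subtopology mtopology C)"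
    and p: "continuous_map (subtopology mtopology C) euclideanreal p"
  shows "(\<lambda>\<omega>. p (B \<omega>)) \<in> borel_measurable N0"
proof (rule borel_measurable_iff_greater[THEN iffD2], rule allI)
  fix c
  \<comment> \<open>Clipping \<open>p - c\<close> to [0, 1] makes the function bounded and preserves
    the set where \<open>p\<close> exceeds \<open>c\<close>.\<close>
  have "continuous_map (subtopology mtopology C) euclideanreal (\<lambda>x. min 1 (max 0 (p x - c)))"
    using p by (intro continuous_intros)
  note cont = continuous_map_subtopology_realD[OF this C(1)]
  have "(\<lambda>\<omega>. min 1 (max 0 (p (B \<omega>) - c))) \<in> borel_measurable N0"
    by (rule measurable_continuous_on_separable_bounded[OF B C _ cont]) auto
  then have "{\<omega> \<in> space N0. 0 < min 1 (max 0 (p (B \<omega>) - c))} \<in> sets N0" by measurable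
  moreover have "{\<omega> \<in> space N0. 0 < min 1 (max 0 (p (B \<omega>) - c))} = {\<omega> \<in> space N0. c < p (B \<omega>)}"
    by auto
  ultimately show "{\<omega> \<in> space N0. c < p (B \<omega>)} \<in> sets N0" by simp
qed

text \<open>On \<open>C\<close> the function \<open>h \<circ> G0\<close> lies above its envelope of
  slope \<open>L\<close>, and the envelope is a legitimate test function. Where the cutoff is below
  1, some \<open>x\<close> in \<open>C\<close> is close to \<open>U n \<omega>\<close> and
  \<open>G n (U n \<omega>)\<close> is close to \<open>G0 x\<close>, so the envelope can be moved
  from \<open>U n \<omega>\<close> to \<open>x\<close> at small cost. Elsewhere twice the cutoff
  pays for the trivial bound 2. The estimate is one-sided because the matching upper bound is the
  same statement for \<open>- h\<close>.\<close>

lemma ext_conv_integral_lower: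
  assumes conv: "conv_distr M d (\<lambda>n. N) U N0 B" and N: "prob_space N" and N0: "prob_space N0"
    and C: "C \<subseteq> M" "separable_space (subtopology mtopology C)" and BC: "\<And>\<omega>. \<omega> \<in> space N0 \<Longrightarrow> B \<omega> \<in> C"
    and ext: "ext_conv A G C G0"
    and G0: "continuous_map (subtopology mtopology C) euclideanreal G0"
    and UA: "\<And>n \<omega>. n \<ge> 1 \<Longrightarrow> \<omega> \<in> space N \<Longrightarrow> U n \<omega> \<in> A n"
    and meas: "\<And>n. n \<ge> 1 \<Longrightarrow> (\<lambda>\<omega>. G n (U n \<omega>)) \<in> borel_measurable N"
    and h: "uniformly_continuous_on UNIV h" "\<And>u::real. \<bar>h u\<bar> \<le> 1"
    and e: "0 < (e::real)"
  shows "\<forall>\<^sub>F n in sequentially. (\<integral>\<omega>. h (G0 (B \<omega>)) \<partial>N0) - e < (\<integral>\<omega>. h (G n (U n \<omega>)) \<partial>N)"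
proof -
  interpret N: prob_space N by fact
  have B: "B \<in> measurable N0 (ball_sigma M d)" using conv by (auto simp: conv_distr_def)
  have U: "U n \<in> measurable N (ball_sigma M d)" if "n \<ge> 1" for n using conv that by (auto simp: conv_distr_def)
  have UM: "U n \<omega> \<in> M" if "n \<ge> 1" "\<omega> \<in> space N" for n \<omega> using measurable_space[OF U] that by simp
  obtain D where D: "countable D" "D \<subseteq> C" "\<And>x e. x \<in> C \<Longrightarrow> 0 < e \<Longrightarrow> \<exists>q\<in>D. d x q < e"
    by (rule separable_subset_countable_dense[OF C, of C]) auto
  define p where "p x = h (G0 x)" for x
  have hc: "continuous_on UNIV h" by (rule uniformly_continuous_imp_continuous[OF h(1)])
  have "continuous_map (subtopology mtopology C) euclideanreal (h \<circ> G0)"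
    by (rule continuous_map_compose[OF G0]) (use hc in simp)
  then have "continuous_map (subtopology mtopology C) euclideanreal p" by (simp add: p_def[abs_def] comp_def)
  note pc = continuous_map_subtopology_realD[OF this C(1)]
  have p1: "\<bar>p x\<bar> \<le> 1" for x using h(2) by (simp add: p_def)
  define T where "T = (\<lambda>q. (q, p q)) ` D"
  have T: "T \<subseteq> M \<times> {-1..}" using D(2) C(1) p1 by (auto simp: T_def abs_le_iff)
  have Tc: "countable T" using D(1) by (simp add: T_def)
  have "(\<lambda>k. \<integral>\<omega>. lip_env (real k) T (B \<omega>) \<partial>N0) \<longlonglongrightarrow> (\<integral>\<omega>. p (B \<omega>) \<partial>N0)"
  proof (rule prob_bounded_convergence[OF N0])
    show "(\<lambda>\<omega>. lip_env (real k) T (B \<omega>)) \<in> borel_measurable N0" for k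
      by (rule measurable_compose[OF B measurable_lip_env[OF T _ Tc]]) simp
    show "\<bar>lip_env (real k) T (B \<omega>)\<bar> \<le> 1" for k \<omega> by (rule abs_lip_env_le_1[OF T]) simp
    show "(\<lambda>k. lip_env (real k) T (B \<omega>)) \<longlonglongrightarrow> p (B \<omega>)" if "\<omega> \<in> space N0" for \<omega>
      unfolding T_def by (rule lip_env_graph_tendsto[OF D(2) C(1) D(3) p1 pc BC[OF that]]) auto
  qed
  then have "\<forall>\<^sub>F k in sequentially. (\<integral>\<omega>. p (B \<omega>) \<partial>N0) - e / 8 < (\<integral>\<omega>. lip_env (real k) T (B \<omega>) \<partial>N0)"
    by (rule order_tendstoD(1)) (use e in simp)
  then obtain L where L: "(\<integral>\<omega>. p (B \<omega>) \<partial>N0) - e / 8 < (\<integral>\<omega>. lip_env (real L) T (B \<omega>) \<partial>N0)"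
    by (auto simp: eventually_sequentially)
  obtain \<eta> where \<eta>: "\<eta> > 0" "\<And>u v. \<bar>u - v\<bar> < \<eta> \<Longrightarrow> \<bar>h u - h v\<bar> < e / 8"
    using h(1) e unfolding uniformly_continuous_on_def dist_real_def
    by (metis UNIV_I zero_less_divide_iff zero_less_numeral abs_minus_commute)
  \<comment> \<open>Moving an argument by less than \<open>r\<close> changes the envelope of slope
    \<open>L\<close> by at most \<open>e / 8\<close>. The slope must therefore be fixed before the
    cutoff.\<close>
  define r where "r = e / 8 / (real L + 1)"
  have r: "0 < r" using e by (simp add: r_def)
  obtain S s where S: "\<And>k. countable (S k)" "\<And>k. S k \<subseteq> M \<times> {0..}" "\<And>k::nat. 0 \<le> s k"
    "\<And>x. x \<in> C \<Longrightarrow> (\<lambda>k. lip_env (s k) (S k) x) \<longlonglongrightarrow> 0"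
    "\<And>k n y. k < n \<Longrightarrow> y \<in> A n \<Longrightarrow> lip_env (s k) (S k) y < 1 \<Longrightarrow> \<exists>x\<in>C. d x y < r \<and> \<bar>G n y - G0 x\<bar> \<le> \<eta> / 2"
    by (rule ext_conv_cutoff[OF ext C, of "\<eta> / 2" r]) (use \<eta> r in auto)
  have S': "S k \<subseteq> M \<times> {-1..}" for k using S(2)[of k] by fastforce
  have "(\<lambda>k. \<integral>\<omega>. lip_env (s k) (S k) (B \<omega>) \<partial>N0) \<longlonglongrightarrow> (\<integral>\<omega>. 0 \<partial>N0)"
    by (rule prob_bounded_convergence[OF N0 measurable_compose[OF B measurable_lip_env[OF S' S(3,1)]]
          abs_lip_env_le_1[OF S' S(3)] S(4)[OF BC]])
  then have "\<forall>\<^sub>F k in sequentially. (\<integral>\<omega>. lip_env (s k) (S k) (B \<omega>) \<partial>N0) < e / 8"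
    by (rule order_tendstoD(2)) (use e in simp)
  then obtain k where k: "(\<integral>\<omega>. lip_env (s k) (S k) (B \<omega>) \<partial>N0) < e / 8"
    by (auto simp: eventually_sequentially)
  have "\<forall>\<^sub>F n in sequentially. (\<integral>\<omega>. lip_env (real L) T (B \<omega>) \<partial>N0) - e / 8 < (\<integral>\<omega>. lip_env (real L) T (U n \<omega>) \<partial>N)"
    by (rule order_tendstoD(1)[OF conv_distr_lip_env[OF conv T _ Tc]]) (use e in auto)
  moreover have "\<forall>\<^sub>F n in sequentially. (\<integral>\<omega>. lip_env (s k) (S k) (U n \<omega>) \<partial>N) < e / 8"
    by (rule order_tendstoD(2)[OF conv_distr_lip_env[OF conv S' S(3,1)] k])
  moreover have "\<forall>\<^sub>F n in sequentially. k < n \<and> 1 \<le> n" 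
    by (intro eventually_conj eventually_gt_at_top eventually_ge_at_top)
  ultimately show ?thesis
  proof eventually_elim
    case (elim n)
    then have n: "1 \<le> n" "k < n" by auto
    \<comment> \<open>Of the loss \<open>e / 4\<close>, one half is due to the modulus of continuity
      of \<open>h\<close> and the other to the displacement of the envelope. After integration the
      cutoff costs less than \<open>e / 4\<close>, and the two envelope approximations cost
      \<open>e / 8\<close> each, in total less than \<open>e\<close>.\<close>
    have pt: "lip_env (real L) T (U n \<omega>) - e / 4 - 2 * lip_env (s k) (S k) (U n \<omega>) \<le> h (G n (U n \<omega>))"
      if \<omega>: "\<omega> \<in> space N" for \<omega>
    proof (cases "lip_env (s k) (S k) (U n \<omega>) < 1")
      case True
      obtain x where x: "x \<in> C" "d x (U n \<omega>) < r" "\<bar>G n (U n \<omega>) - G0 x\<bar> \<le> \<eta> / 2"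
        using S(5)[OF n(2) UA[OF n(1) \<omega>] True] by blast
      then have "\<bar>h (G n (U n \<omega>)) - h (G0 x)\<bar> < e / 8" using \<eta> by (intro \<eta>(2)) auto
      moreover have "lip_env (real L) T x \<le> h (G0 x)"
        using lip_env_graph_le[OF D(2) C(1) D(3) p1 pc _ x(1), of "real L"] by (simp add: T_def p_def)
      moreover have "\<bar>lip_env (real L) T x - lip_env (real L) T (U n \<omega>)\<bar> \<le> real L * d x (U n \<omega>)"
        by (rule lip_env_Lipschitz[OF T]) (use x C UM[OF n(1) \<omega>] in auto)
      moreover have "real L * d x (U n \<omega>) \<le> e / 8"
      proof -
        have "real L * d x (U n \<omega>) \<le> (real L + 1) * r" using x(2) r by (intro mult_mono) auto
        moreover have "(real L + 1) * r = e / 8" using nonzero_eq_divide_eq[of "real L + 1" r "e / 8"] by (simp add: r_def mult.commute)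
        ultimately show ?thesis by simp
      qed
      moreover have "0 \<le> lip_env (s k) (S k) (U n \<omega>)" by (rule lip_env_ge_lower_bound[OF _ S(2,3)]) simp
      ultimately show ?thesis by linarith
    next
      case False
      moreover have "\<bar>lip_env (real L) T (U n \<omega>)\<bar> \<le> 1" by (rule abs_lip_env_le_1[OF T]) simp
      moreover have "\<bar>h (G n (U n \<omega>))\<bar> \<le> 1" by (rule h(2))
      ultimately show ?thesis using e by (simp add: abs_le_iff)
    qed
    have i1: "integrable N (\<lambda>\<omega>. lip_env (real L) T (U n \<omega>))"
      by (rule integrable_lip_env_compose[OF N U[OF n(1)] T _ Tc]) simp
    have i2: "integrable N (\<lambda>\<omega>. lip_env (s k) (S k) (U n \<omega>))"
      by (rule integrable_lip_env_compose[OF N U[OF n(1)] S' S(3,1)])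
    have i3: "integrable N (\<lambda>\<omega>. h (G n (U n \<omega>)))"
      by (rule prob_integrable_bounded[OF N measurable_compose[OF meas[OF n(1)] borel_measurable_continuous_onI[OF hc]] h(2)])
    have "(\<integral>\<omega>. lip_env (real L) T (U n \<omega>) - e / 4 - 2 * lip_env (s k) (S k) (U n \<omega>) \<partial>N) \<le> (\<integral>\<omega>. h (G n (U n \<omega>)) \<partial>N)"
      by (rule integral_mono) (use i1 i2 i3 pt in auto)
    moreover have "(\<integral>\<omega>. lip_env (real L) T (U n \<omega>) - e / 4 - 2 * lip_env (s k) (S k) (U n \<omega>) \<partial>N)
        = (\<integral>\<omega>. lip_env (real L) T (U n \<omega>) \<partial>N) - e / 4 - 2 * (\<integral>\<omega>. lip_env (s k) (S k) (U n \<omega>) \<partial>N)"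
      using i1 i2 by (simp add: N.prob_space)
    ultimately show ?case using elim L e by (simp add: p_def)
  qed
qed

text \<open>On the line weak convergence is decided by the functions \<open>cts_step\<close>, which
  are uniformly continuous with values in [0, 1]. The one-sided estimate for \<open>h\<close> and
  \<open>- h\<close> covers them, and weak convergence of the laws then yields all bounded
  continuous functions.\<close>

theorem extended_continuous_mapping:
  assumes conv: "conv_distr M d (\<lambda>n. N) U N0 B" and N: "prob_space N" and N0: "prob_space N0"
    and C: "C \<subseteq> M" "separable_space (subtopology mtopology C)" and BC: "\<And>\<omega>. \<omega> \<in> space N0 \<Longrightarrow> B \<omega> \<in> C"
    and ext: "ext_conv A G C G0"
    and G0: "continuous_map (subtopology mtopology C) euclideanreal G0"
    and UA: "\<And>n \<omega>. n \<ge> 1 \<Longrightarrow> \<omega> \<in> space N \<Longrightarrow> U n \<omega> \<in> A n"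
    and meas: "\<And>n. n \<ge> 1 \<Longrightarrow> (\<lambda>\<omega>. G n (U n \<omega>)) \<in> borel_measurable N"
  shows "conv_distr UNIV dist (\<lambda>n. N) (\<lambda>n \<omega>. G n (U n \<omega>)) N0 (\<lambda>\<omega>. G0 (B \<omega>))"
proof -
  have B: "B \<in> measurable N0 (ball_sigma M d)" using conv by (auto simp: conv_distr_def)
  have mB: "(\<lambda>\<omega>. G0 (B \<omega>)) \<in> borel_measurable N0"
    by (rule measurable_continuous_on_separable[OF B BC C G0])
  have lim: "(\<lambda>n. \<integral>\<omega>. h (G n (U n \<omega>)) \<partial>N) \<longlonglongrightarrow> (\<integral>\<omega>. h (G0 (B \<omega>)) \<partial>N0)"
    if h: "uniformly_continuous_on UNIV h" "\<And>u. \<bar>h u\<bar> \<le> 1" for h :: "real \<Rightarrow> real"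
  proof (rule tendstoI)
    fix e :: real assume e: "0 < e"
    have h': "uniformly_continuous_on UNIV (\<lambda>u. - h u)" "\<And>u. \<bar>- h u\<bar> \<le> 1"
      using uniformly_continuous_on_minus[OF h(1)] h(2) by simp_all
    have "\<forall>\<^sub>F n in sequentially. (\<integral>\<omega>. h (G0 (B \<omega>)) \<partial>N0) - e < (\<integral>\<omega>. h (G n (U n \<omega>)) \<partial>N)"
      by (rule ext_conv_integral_lower[OF conv N N0 C BC ext G0 UA meas h e])
    moreover have "\<forall>\<^sub>F n in sequentially. (\<integral>\<omega>. - h (G0 (B \<omega>)) \<partial>N0) - e < (\<integral>\<omega>. - h (G n (U n \<omega>)) \<partial>N)"
      by (rule ext_conv_integral_lower[OF conv N N0 C BC ext G0 UA meas h' e])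
    ultimately show "\<forall>\<^sub>F n in sequentially. dist (\<integral>\<omega>. h (G n (U n \<omega>)) \<partial>N) (\<integral>\<omega>. h (G0 (B \<omega>)) \<partial>N0) < e"
      by eventually_elim (simp add: dist_real_def abs_less_iff)
  qed
  \<comment> \<open>The criterion asks for a probability law at every index, but measurability is
    known only from index 1 on; hence the shift by \<open>Suc\<close>.\<close>
  define \<mu> where "\<mu> n = distr N borel (\<lambda>\<omega>. G (Suc n) (U (Suc n) \<omega>))" for n
  define \<nu> where "\<nu> = distr N0 borel (\<lambda>\<omega>. G0 (B \<omega>))"
  have \<mu>: "real_distribution (\<mu> n)" for n
    unfolding \<mu>_def by (rule prob_space.real_distribution_distr[OF N meas]) simp
  have \<nu>: "real_distribution \<nu>" unfolding \<nu>_def by (rule prob_space.real_distribution_distr[OF N0 mB])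
  have int\<mu>: "(\<integral>x. h x \<partial>\<mu> n) = (\<integral>\<omega>. h (G (Suc n) (U (Suc n) \<omega>)) \<partial>N)"
    and int\<nu>: "(\<integral>x. h x \<partial>\<nu>) = (\<integral>\<omega>. h (G0 (B \<omega>)) \<partial>N0)" if "h \<in> borel_measurable borel" for h :: "real \<Rightarrow> real" and n
    unfolding \<mu>_def \<nu>_def by (intro integral_distr meas mB that; simp)+
  have weak: "weak_conv_m \<mu> \<nu>"
  proof (rule integral_cts_step_conv_imp_weak_conv[OF \<mu> \<nu>])
    fix x y :: real assume xy: "x < y"
    have uc: "uniformly_continuous_on UNIV (cts_step x y)" by (rule cts_step_uniformly_continuous[OF xy])
    have m: "cts_step x y \<in> borel_measurable borel"
      by (rule borel_measurable_continuous_onI[OF uniformly_continuous_imp_continuous[OF uc]])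
    have "\<bar>cts_step x y u\<bar> \<le> 1" for u using xy by (auto simp: cts_step_def abs_le_iff field_simps)
    from LIMSEQ_Suc[OF lim[OF uc this]]
    show "(\<lambda>n. integral\<^sup>L (\<mu> n) (cts_step x y)) \<longlonglongrightarrow> integral\<^sup>L \<nu> (cts_step x y)"
      by (simp add: int\<mu>[OF m] int\<nu>[OF m])
  qed
  show ?thesis unfolding conv_distr_def
  proof (intro conjI allI impI)
    show "(\<lambda>\<omega>. G n (U n \<omega>)) \<in> N \<rightarrow>\<^sub>M ball_sigma UNIV dist" if "1 \<le> n" for n
      using meas[OF that] measurable_cong_sets[OF refl sets_ball_sigma_real] by blast
    show "(\<lambda>\<omega>. G0 (B \<omega>)) \<in> N0 \<rightarrow>\<^sub>M ball_sigma UNIV dist"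
      using mB measurable_cong_sets[OF refl sets_ball_sigma_real] by blast
    fix g :: "real \<Rightarrow> real"
    assume g: "g \<in> borel_measurable (ball_sigma UNIV dist) \<and> continuous_map Met_TC.mtopology euclideanreal g \<and> bounded (range g)"
    then have gc: "continuous_on UNIV g" by simp
    obtain K where K: "\<And>x. norm (g x) \<le> K" using g unfolding bounded_iff by auto
    have gm: "g \<in> borel_measurable borel" by (rule borel_measurable_continuous_onI[OF gc])
    have "(\<lambda>n. integral\<^sup>L (\<mu> n) g) \<longlonglongrightarrow> integral\<^sup>L \<nu> g"
      by (rule weak_conv_imp_integral_bdd_continuous_conv[OF \<mu> \<nu> weak _ K])
        (use gc in \<open>simp add: continuous_on_eq_continuous_at\<close>)
    then have "(\<lambda>n. \<integral>\<omega>. g (G (Suc n) (U (Suc n) \<omega>)) \<partial>N) \<longlonglongrightarrow> (\<integral>\<omega>. g (G0 (B \<omega>)) \<partial>N0)"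
      by (simp add: int\<mu>[OF gm] int\<nu>[OF gm])
    then show "(\<lambda>n. \<integral>\<omega>. g (G n (U n \<omega>)) \<partial>N) \<longlonglongrightarrow> (\<integral>\<omega>. g (G0 (B \<omega>)) \<partial>N0)"
      by (rule LIMSEQ_imp_Suc)
  qed
qed


section \<open>Countable suprema for the bounded Lipschitz distance, and vanishing
  remainders\<close>

lemma lip_env_in_BL1:
  assumes "S \<subseteq> M \<times> {-1..}" "countable S"
  shows "lip_env 1 S \<in> BL1 M d"
  using measurable_lip_env[OF assms(1) _ assms(2), of 1] lip_env_Lipschitz[OF assms(1), of 1]
    abs_lip_env_le_1[OF assms(1), of 1]
  by (simp add: BL1_def)

text \<open>Every function of the unit class is a pointwise limit of envelopes with finitely many
  centres in \<open>D\<close> and rational heights, and bounded convergence passes this on to the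
  integrals. Since \<open>D\<close> has to be dense in the whole space, this is applied on the real
  line, with the rationals.\<close>

lemma dBL_eq_countable_SUP:
  assumes D: "countable D" "D \<subseteq> M" "\<And>x e. x \<in> M \<Longrightarrow> 0 < e \<Longrightarrow> \<exists>q\<in>D. d x q < e"
    and \<mu>: "prob_space \<mu>" "prob_space \<nu>" "sets \<mu> = sets (ball_sigma M d)" "sets \<nu> = sets (ball_sigma M d)"
  shows "dBL M d \<mu> \<nu> = (SUP S\<in>{S. finite S \<and> S \<subseteq> D \<times> (\<rat> \<inter> {-1..})}.
      \<bar>(\<integral>x. lip_env 1 S x \<partial>\<mu>) - (\<integral>x. lip_env 1 S x \<partial>\<nu>)\<bar>)"
    (is "_ = (SUP S\<in>?\<S>. ?I S)")
proof (rule antisym)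
  have S: "S \<subseteq> M \<times> {-1..}" "countable S" if "S \<in> ?\<S>" for S
  proof -
    have "S \<subseteq> D \<times> (\<rat> \<inter> {-1..})" "finite S" using that by auto
    then show "S \<subseteq> M \<times> {-1..}" "countable S" using D(2) countable_finite by blast+
  qed
  have BL: "lip_env 1 S \<in> BL1 M d" if "S \<in> ?\<S>" for S by (rule lip_env_in_BL1[OF S[OF that]])
  have "{} \<in> ?\<S>" by simp
  then have "?\<S> \<noteq> {}" by blast
  then show "(SUP S\<in>?\<S>. ?I S) \<le> dBL M d \<mu> \<nu>"
  proof (rule cSUP_least)
    fix S assume "S \<in> ?\<S>"
    from BL1_integral_diff_le_dBL[OF \<mu> BL[OF this]] show "?I S \<le> dBL M d \<mu> \<nu>" .
  qed
  have bdd: "bdd_above (?I ` ?\<S>)"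
  proof (rule bdd_aboveI2)
    fix S assume "S \<in> ?\<S>"
    from BL1_integral_diff_le[OF \<mu> BL[OF this]] show "?I S \<le> 2" .
  qed
  have sp: "space \<mu> = M" "space \<nu> = M" using \<mu>(3,4)[THEN sets_eq_imp_space_eq] by simp_all
  have "M \<noteq> {}" using prob_space.not_empty[OF \<mu>(1)] sp by simp
  then have "D \<noteq> {}" using D(3)[of _ 1] by fastforce
  define x where "x = from_nat_into D"
  have x: "range x = D" unfolding x_def by (rule range_from_nat_into[OF \<open>D \<noteq> {}\<close> D(1)])
  have xD: "x i \<in> D" for i using x by blast
  show "dBL M d \<mu> \<nu> \<le> (SUP S\<in>?\<S>. ?I S)"
  proof (rule dBL_leI)
    fix h assume h: "h \<in> BL1 M d"
    have "\<exists>c. c \<in> \<rat> \<and> h y \<le> c \<and> c \<le> h y + 1 / real (Suc m)" for m y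
    proof -
      have "h y < h y + 1 / real (Suc m)" by simp
      from Rats_dense_in_real[OF this] show ?thesis by (meson less_imp_le)
    qed
    then have "\<forall>m y. \<exists>c. c \<in> \<rat> \<and> h y \<le> c \<and> c \<le> h y + 1 / real (Suc m)" by blast
    then obtain c where "\<forall>m y. c m y \<in> \<rat> \<and> h y \<le> c m y \<and> c m y \<le> h y + 1 / real (Suc m)"
      unfolding choice_iff by blast
    then have c: "\<And>m y. c m y \<in> \<rat> \<and> h y \<le> c m y \<and> c m y \<le> h y + 1 / real (Suc m)" by blast
    \<comment> \<open>The number of centres and the accuracy \<open>1 / (m + 1)\<close> of the
      heights improve together, so one sequence of envelopes approximates \<open>h\<close> at every
      point.\<close>
    define T where "T m = (\<lambda>q. (q, c m q)) ` (x ` {..m})" for m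
    have xM: "x ` {..m} \<subseteq> M" for m using xD D(2) by blast
    have T: "T m \<in> ?\<S>" for m
    proof -
      have "-1 \<le> c m q" if "q \<in> D" for q
        using BL1D(3)[OF h subsetD[OF D(2) that]] c[of m q] by linarith
      then show ?thesis using xD c by (auto simp: T_def)
    qed
    have lim: "(\<lambda>m. \<integral>y. lip_env 1 (T m) y \<partial>\<rho>) \<longlonglongrightarrow> (\<integral>y. h y \<partial>\<rho>)"
      if \<rho>: "prob_space \<rho>" "sets \<rho> = sets (ball_sigma M d)" for \<rho>
    proof (rule prob_bounded_convergence[OF \<rho>(1)])
      show "lip_env 1 (T m) \<in> borel_measurable \<rho>" for m
        using BL1D(1)[OF BL[OF T]] measurable_cong_sets[OF \<rho>(2) refl] by blast
      show "\<bar>lip_env 1 (T m) y\<bar> \<le> 1" for m y by (rule abs_lip_env_le_1[OF S(1)[OF T]]) simp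
      fix y assume "y \<in> space \<rho>"
      then have y: "y \<in> M" using sets_eq_imp_space_eq[OF \<rho>(2)] by simp
      have lo: "h y \<le> lip_env 1 (T m) y" for m
        unfolding T_def by (rule lip_env_graph_approx(2)[OF h xM _ y]) (use c in blast)
      have hi: "lip_env 1 (T m) y \<le> h y + 1 / real (Suc m) + 2 * d y (x i)" if "i \<le> m" for m i
        unfolding T_def by (rule lip_env_graph_approx(3)[OF h xM _ y]) (use c that in auto)
      show "(\<lambda>m. lip_env 1 (T m) y) \<longlonglongrightarrow> h y"
      proof (rule LIMSEQ_I)
        fix e :: real assume e: "0 < e"
        obtain i where i: "d y (x i) < e / 4" using D(3)[OF y, of "e / 4"] e x by fastforce
        obtain j where j: "1 / real (Suc j) < e / 2"
          using reals_Archimedean[of "e / 2"] e by (auto simp: inverse_eq_divide)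
        have "norm (lip_env 1 (T m) y - h y) < e" if m: "m \<ge> max i j" for m
        proof -
          have "1 / real (Suc m) \<le> 1 / real (Suc j)" using m by (intro frac_le) auto
          then show ?thesis using lo[of m] hi[of i m] m i j by simp
        qed
        then show "\<exists>no. \<forall>m\<ge>no. norm (lip_env 1 (T m) y - h y) < e" by blast
      qed
    qed
    have "(\<lambda>m. ?I (T m)) \<longlonglongrightarrow> \<bar>(\<integral>y. h y \<partial>\<mu>) - (\<integral>y. h y \<partial>\<nu>)\<bar>"
      by (intro tendsto_intros lim \<mu>)
    then show "\<bar>(\<integral>y. h y \<partial>\<mu>) - (\<integral>y. h y \<partial>\<nu>)\<bar> \<le> (SUP S\<in>?\<S>. ?I S)"
      by (rule LIMSEQ_le_const2) (use cSUP_upper[OF T bdd] in blast)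
  qed
qed

text \<open>The limits \<open>I s S\<close> are left abstract: they are integrals under the law of
  \<open>B\<close> in one application and iterated integrals for \<open>B\<close> plus an
  independent copy in the other. The truncated remainder is at most \<open>e / 2\<close> where the
  cutoff is below 1 and at most the cutoff elsewhere, so it suffices that \<open>I\<close> vanishes
  along cutoffs that vanish on \<open>C\<close>.\<close>

lemma ext_conv_remainder_tendsto_0:
  assumes ext: "ext_conv A R C (\<lambda>_. 0)" and C: "C \<subseteq> M" "separable_space (subtopology mtopology C)"
    and N: "prob_space N"
    and Z: "\<And>n. n \<ge> 1 \<Longrightarrow> Z n \<in> measurable N (ball_sigma M d)"
    and ZA: "\<And>n \<omega>. n \<ge> 1 \<Longrightarrow> \<omega> \<in> space N \<Longrightarrow> Z n \<omega> \<in> A n"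
    and meas: "\<And>n. n \<ge> 1 \<Longrightarrow> (\<lambda>\<omega>. R n (Z n \<omega>)) \<in> borel_measurable N"
    and I: "\<And>s S. S \<subseteq> M \<times> {-1..} \<Longrightarrow> 0 \<le> s \<Longrightarrow> countable S \<Longrightarrow>
      (\<lambda>n. \<integral>\<omega>. lip_env s S (Z n \<omega>) \<partial>N) \<longlonglongrightarrow> I s S"
    and I0: "\<And>s S. (\<And>k. S k \<subseteq> M \<times> {0..}) \<Longrightarrow> (\<And>k::nat. 0 \<le> s k) \<Longrightarrow> (\<And>k. countable (S k)) \<Longrightarrow>
      (\<And>x. x \<in> C \<Longrightarrow> (\<lambda>k. lip_env (s k) (S k) x) \<longlonglongrightarrow> 0) \<Longrightarrow> (\<lambda>k. I (s k) (S k)) \<longlonglongrightarrow> 0"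
  shows "(\<lambda>n. \<integral>\<omega>. min 1 \<bar>R n (Z n \<omega>)\<bar> \<partial>N) \<longlonglongrightarrow> 0"
proof (rule tendstoI)
  interpret N: prob_space N by fact
  fix e :: real assume e: "0 < e"
  obtain S s where S: "\<And>k. countable (S k)" "\<And>k. S k \<subseteq> M \<times> {0..}" "\<And>k::nat. 0 \<le> s k"
    "\<And>x. x \<in> C \<Longrightarrow> (\<lambda>k. lip_env (s k) (S k) x) \<longlonglongrightarrow> 0"
    "\<And>k n y. k < n \<Longrightarrow> y \<in> A n \<Longrightarrow> lip_env (s k) (S k) y < 1 \<Longrightarrow> \<exists>x\<in>C. d x y < 1 \<and> \<bar>R n y - 0\<bar> \<le> e / 2"
    by (rule ext_conv_cutoff[OF ext C, of "e / 2" 1]) (use e in auto)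
  have S': "S k \<subseteq> M \<times> {-1..}" for k using S(2)[of k] by fastforce
  have "\<forall>\<^sub>F k in sequentially. I (s k) (S k) < e / 2"
    by (rule order_tendstoD(2)[OF I0[OF S(2,3,1,4)]]) (use e in auto)
  then obtain k where k: "I (s k) (S k) < e / 2" by (auto simp: eventually_sequentially)
  have "\<forall>\<^sub>F n in sequentially. (\<integral>\<omega>. lip_env (s k) (S k) (Z n \<omega>) \<partial>N) < e / 2"
    by (rule order_tendstoD(2)[OF I[OF S' S(3,1)] k])
  moreover have "\<forall>\<^sub>F n in sequentially. k < n \<and> 1 \<le> n"
    by (intro eventually_conj eventually_gt_at_top eventually_ge_at_top)
  ultimately show "\<forall>\<^sub>F n in sequentially. dist (\<integral>\<omega>. min 1 \<bar>R n (Z n \<omega>)\<bar> \<partial>N) 0 < e"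
  proof eventually_elim
    case (elim n)
    then have n: "1 \<le> n" "k < n" by auto
    have i: "integrable N (\<lambda>\<omega>. lip_env (s k) (S k) (Z n \<omega>))"
      by (rule integrable_lip_env_compose[OF N Z[OF n(1)] S' S(3,1)])
    have "min 1 \<bar>R n (Z n \<omega>)\<bar> \<le> e / 2 + lip_env (s k) (S k) (Z n \<omega>)" if \<omega>: "\<omega> \<in> space N" for \<omega>
    proof (cases "lip_env (s k) (S k) (Z n \<omega>) < 1")
      case True
      have "0 \<le> lip_env (s k) (S k) (Z n \<omega>)" by (rule lip_env_ge_lower_bound[OF _ S(2,3)]) simp
      then show ?thesis using S(5)[OF n(2) ZA[OF n(1) \<omega>] True] by auto
    qed (use e in auto)
    then have "(\<integral>\<omega>. min 1 \<bar>R n (Z n \<omega>)\<bar> \<partial>N) \<le> (\<integral>\<omega>. e / 2 + lip_env (s k) (S k) (Z n \<omega>) \<partial>N)"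
      using prob_integrable_bounded[OF N, of "\<lambda>\<omega>. min 1 \<bar>R n (Z n \<omega>)\<bar>" 1] i meas[OF n(1)]
      by (intro integral_mono) auto
    also have "\<dots> < e" using i elim by (simp add: N.prob_space)
    finally have "(\<integral>\<omega>. min 1 \<bar>R n (Z n \<omega>)\<bar> \<partial>N) < e" .
    moreover have "0 \<le> (\<integral>\<omega>. min 1 \<bar>R n (Z n \<omega>)\<bar> \<partial>N)" by (rule Bochner_Integration.integral_nonneg) simp
    ultimately show ?case by simp
  qed
qed

text \<open>Near a point \<open>x\<close> of \<open>C\<close> the value \<open>g y\<close> stays
  close to \<open>g x\<close>, which is \<open>G0 x\<close>, so subtracting \<open>g\<close> turns
  the limit into 0. One radius has to serve \<open>G n\<close> and \<open>g\<close> at once, whence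
  the maximum \<open>l\<close> of two indices.\<close>

lemma ext_conv_diff_Lipschitz:
  assumes ext: "ext_conv A G C G0" and C: "C \<subseteq> M" and A: "\<And>n. A n \<subseteq> M"
    and g: "\<And>x. x \<in> C \<Longrightarrow> g x = G0 x" "\<And>x y. x \<in> M \<Longrightarrow> y \<in> M \<Longrightarrow> \<bar>g x - g y\<bar> \<le> L * d x y"
  shows "ext_conv A (\<lambda>n y. G n y - g y) C (\<lambda>_. 0)"
  unfolding ext_conv_def
proof (intro ballI allI impI)
  fix x and e :: real assume x: "x \<in> C" and e: "0 < e"
  obtain k where k: "\<And>n y. n > k \<Longrightarrow> y \<in> A n \<Longrightarrow> d x y < 1 / real (Suc k) \<Longrightarrow> \<bar>G n y - G0 x\<bar> \<le> e / 2"
    using ext x e unfolding ext_conv_def by (meson half_gt_zero)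
  obtain j where j: "1 / real (Suc j) < e / 2 / (\<bar>L\<bar> + 1)"
    using reals_Archimedean[of "e / 2 / (\<bar>L\<bar> + 1)"] e by (auto simp: inverse_eq_divide)
  define l where "l = max k j"
  have l: "1 / real (Suc l) \<le> 1 / real (Suc k)" "1 / real (Suc l) \<le> 1 / real (Suc j)"
    unfolding l_def by (rule frac_le; simp)+
  have "\<bar>G n y - g y - 0\<bar> \<le> e" if n: "n > l" and y: "y \<in> A n" and dxy: "d x y < 1 / real (Suc l)" for n y
  proof -
    have "\<bar>G n y - G0 x\<bar> \<le> e / 2" using k[of n y] n y dxy l(1) by (simp add: l_def)
    moreover have "\<bar>g x - g y\<bar> \<le> L * d x y" using g(2) x C y A by blast
    moreover have "L * d x y \<le> e / 2"
    proof -
      define K where "K = \<bar>L\<bar> + 1"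
      have K: "0 < K" "L \<le> K" by (auto simp: K_def)
      have "L * d x y \<le> K * d x y" using K by (intro mult_right_mono) auto
      also have "\<dots> \<le> K * (e / 2 / K)" using dxy l(2) j K by (intro mult_left_mono) (auto simp: K_def)
      also have "\<dots> = e / 2" using K by simp
      finally show ?thesis .
    qed
    ultimately show ?thesis using g(1)[OF x] by linarith
  qed
  then show "\<exists>k. \<forall>n>k. \<forall>y\<in>A n. d x y < 1 / real (Suc k) \<longrightarrow> \<bar>G n y - g y - 0\<bar> \<le> e" by blast
qed

end

text \<open>With the rationals as dense set the distance is a countable supremum of partial
  integrals, each measurable in \<open>\<omega>\<close> by Fubini. This allows the conclusion for
  laws on the line to speak of probabilities of events instead of outer probabilities.\<close>

lemma measurable_dBL_real_kernel:
  assumes "prob_space N'" and Y: "Y \<in> borel_measurable (N \<Otimes>\<^sub>M N')"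
    and \<nu>: "prob_space \<nu>" "sets \<nu> = sets (borel :: real measure)"
  shows "(\<lambda>\<omega>. dBL UNIV dist (distr N' borel (\<lambda>\<omega>'. Y (\<omega>, \<omega>'))) \<nu>) \<in> borel_measurable N"
proof -
  interpret N': prob_space N' by fact
  let ?\<S> = "{S. finite S \<and> S \<subseteq> \<rat> \<times> (\<rat> \<inter> {-1..})} :: (real \<times> real) set set"
  have "countable ?\<S>"
    by (rule countable_Collect_finite_subset) (use countable_rat in auto)
  have Rats_dense: "\<exists>q\<in>\<rat>. dist x q < e" if "0 < e" for x e :: real
  proof -
    have "x < x + e" using that by simp
    from Rats_dense_in_real[OF this] obtain q where "q \<in> \<rat>" "x < q" "q < x + e" by blast
    then show ?thesis by (auto simp: dist_real_def intro!: bexI[of _ q])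
  qed
  have Y\<omega>: "(\<lambda>\<omega>'. Y (\<omega>, \<omega>')) \<in> borel_measurable N'" if "\<omega> \<in> space N" for \<omega>
    by (rule measurable_compose[OF measurable_Pair1'[OF that] Y])
  have S: "S \<subseteq> UNIV \<times> {-1..}" "countable S" if "S \<in> ?\<S>" for S
  proof -
    have "S \<subseteq> \<rat> \<times> (\<rat> \<inter> {-1..})" "finite S" using that by auto
    then show "S \<subseteq> UNIV \<times> {-1..}" "countable S" using countable_finite by blast+
  qed
  have m: "Met_TC.lip_env 1 S \<in> borel_measurable borel" if "S \<in> ?\<S>" for S
    using Met_TC.measurable_lip_env[OF S(1)[OF that] _ S(2)[OF that], of 1]
      measurable_cong_sets[OF sets_ball_sigma_real refl] by auto
  have eq: "dBL UNIV dist (distr N' borel (\<lambda>\<omega>'. Y (\<omega>, \<omega>'))) \<nu> =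
      (SUP S\<in>?\<S>. \<bar>(\<integral>\<omega>'. Met_TC.lip_env 1 S (Y (\<omega>, \<omega>')) \<partial>N') - (\<integral>x. Met_TC.lip_env 1 S x \<partial>\<nu>)\<bar>)"
    if "\<omega> \<in> space N" for \<omega>
  proof -
    have "dBL UNIV dist (distr N' borel (\<lambda>\<omega>'. Y (\<omega>, \<omega>'))) \<nu> =
      (SUP S\<in>?\<S>. \<bar>(\<integral>x. Met_TC.lip_env 1 S x \<partial>distr N' borel (\<lambda>\<omega>'. Y (\<omega>, \<omega>'))) - (\<integral>x. Met_TC.lip_env 1 S x \<partial>\<nu>)\<bar>)"
      by (rule Met_TC.dBL_eq_countable_SUP)
        (use countable_rat Rats_dense \<nu> N'.prob_space_distr[OF Y\<omega>[OF that]] sets_ball_sigma_real in auto)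
    also have "\<dots> = (SUP S\<in>?\<S>. \<bar>(\<integral>\<omega>'. Met_TC.lip_env 1 S (Y (\<omega>, \<omega>')) \<partial>N') - (\<integral>x. Met_TC.lip_env 1 S x \<partial>\<nu>)\<bar>)"
      by (rule SUP_cong[OF refl]) (simp add: integral_distr[OF Y\<omega>[OF that] m])
    finally show ?thesis .
  qed
  have "(\<lambda>\<omega>. SUP S\<in>?\<S>. \<bar>(\<integral>\<omega>'. Met_TC.lip_env 1 S (Y (\<omega>, \<omega>')) \<partial>N') - (\<integral>x. Met_TC.lip_env 1 S x \<partial>\<nu>)\<bar>) \<in> borel_measurable N"
  proof (rule borel_measurable_cSUP[OF \<open>countable ?\<S>\<close>])
    fix S assume "S \<in> ?\<S>"
    have "(\<lambda>w. Met_TC.lip_env 1 S (Y w)) \<in> borel_measurable (N \<Otimes>\<^sub>M N')"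
      by (rule measurable_compose[OF Y m[OF \<open>S \<in> ?\<S>\<close>]])
    then have "(\<lambda>\<omega>. \<integral>\<omega>'. Met_TC.lip_env 1 S (Y (\<omega>, \<omega>')) \<partial>N') \<in> borel_measurable N"
      by (intro N'.borel_measurable_lebesgue_integral) (simp add: case_prod_beta')
    then show "(\<lambda>\<omega>. \<bar>(\<integral>\<omega>'. Met_TC.lip_env 1 S (Y (\<omega>, \<omega>')) \<partial>N') - (\<integral>x. Met_TC.lip_env 1 S x \<partial>\<nu>)\<bar>) \<in> borel_measurable N"
      by measurable
  next
    fix \<omega> assume \<omega>: "\<omega> \<in> space N"
    show "bdd_above ((\<lambda>S. \<bar>(\<integral>\<omega>'. Met_TC.lip_env 1 S (Y (\<omega>, \<omega>')) \<partial>N') - (\<integral>x. Met_TC.lip_env 1 S x \<partial>\<nu>)\<bar>) ` ?\<S>)"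
    proof (rule bdd_aboveI2)
      fix S assume S': "S \<in> ?\<S>"
      have "\<bar>(\<integral>x. Met_TC.lip_env 1 S x \<partial>distr N' borel (\<lambda>\<omega>'. Y (\<omega>, \<omega>'))) - (\<integral>x. Met_TC.lip_env 1 S x \<partial>\<nu>)\<bar> \<le> 2"
        by (rule BL1_integral_diff_le[OF _ _ _ _ Met_TC.lip_env_in_BL1[OF S[OF S']]])
          (use \<nu> N'.prob_space_distr[OF Y\<omega>[OF \<omega>]] sets_ball_sigma_real in auto)
      then show "\<bar>(\<integral>\<omega>'. Met_TC.lip_env 1 S (Y (\<omega>, \<omega>')) \<partial>N') - (\<integral>x. Met_TC.lip_env 1 S x \<partial>\<nu>)\<bar> \<le> 2"
        by (simp add: integral_distr[OF Y\<omega>[OF \<omega>] m[OF S']])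
    qed
  qed
  then show ?thesis by (subst measurable_cong[OF eq])
qed

section \<open>Linear structure of the weighted space\<close>

lemma Dphi_add:
  assumes "x \<in> Dphi \<phi>" "y \<in> Dphi \<phi>"
  shows "(\<lambda>t. x t + y t) \<in> Dphi \<phi>"
proof -
  have xy: "cadlag x" "cadlag y" "sup_norm x < \<infinity>" "sup_norm y < \<infinity>"
      "((\<lambda>t. \<bar>x t\<bar>) \<longlongrightarrow> 0) at_infinity" "((\<lambda>t. \<bar>y t\<bar>) \<longlongrightarrow> 0) at_infinity"
    using assms by (auto simp: Dphi_def Dspace_def)
  have "cadlag (\<lambda>t. x t + y t)"
    unfolding cadlag_def
  proof (intro allI conjI)
    fix t
    show "continuous (at_right t) (\<lambda>t. x t + y t)"
      using xy(1,2) by (intro continuous_add) (auto simp: cadlag_def)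
    obtain l l' where "(x \<longlongrightarrow> l) (at_left t)" "(y \<longlongrightarrow> l') (at_left t)"
      using xy(1,2) unfolding cadlag_def by blast
    then show "\<exists>l. ((\<lambda>t. x t + y t) \<longlongrightarrow> l) (at_left t)" by (blast intro: tendsto_add)
  qed
  moreover have "sup_norm (\<lambda>t. x t + y t) < \<infinity>"
  proof -
    obtain K L where "\<And>t. \<bar>x t\<bar> \<le> K" "\<And>t. \<bar>y t\<bar> \<le> L" using xy(3,4) unfolding sup_norm_finite_iff by blast
    then have "\<bar>x t + y t\<bar> \<le> K + L" for t by (meson abs_triangle_ineq add_mono order_trans)
    then show ?thesis unfolding sup_norm_finite_iff by blast
  qed
  moreover have "wnorm \<phi> (\<lambda>t. x t + y t) < \<infinity>"
  proof -
    obtain K L where "\<And>t. \<bar>x t * \<phi> t\<bar> \<le> K" "\<And>t. \<bar>y t * \<phi> t\<bar> \<le> L" using DphiD assms by metis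
    then have "\<bar>(x t + y t) * \<phi> t\<bar> \<le> K + L" for t
      unfolding distrib_right by (meson abs_triangle_ineq add_mono order_trans)
    then show ?thesis unfolding wnorm_def sup_norm_finite_iff by blast
  qed
  moreover have "((\<lambda>t. \<bar>x t + y t\<bar>) \<longlongrightarrow> 0) at_infinity"
    using tendsto_add[of x 0 _ y 0] xy(5,6) by (simp add: tendsto_rabs_zero_iff)
  ultimately show ?thesis by (simp add: Dphi_def Dspace_def)
qed

lemma Dphi_scale:
  assumes "x \<in> Dphi \<phi>"
  shows "(\<lambda>t. c * x t) \<in> Dphi \<phi>"
proof -
  have x: "cadlag x" "sup_norm x < \<infinity>" "((\<lambda>t. \<bar>x t\<bar>) \<longlongrightarrow> 0) at_infinity"
    using assms by (auto simp: Dphi_def Dspace_def)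
  have "cadlag (\<lambda>t. c * x t)"
    unfolding cadlag_def
  proof (intro allI conjI)
    fix t
    show "continuous (at_right t) (\<lambda>t. c * x t)"
      using x(1) by (intro continuous_mult_left) (auto simp: cadlag_def)
    obtain l where "(x \<longlongrightarrow> l) (at_left t)" using x(1) unfolding cadlag_def by blast
    then show "\<exists>l. ((\<lambda>t. c * x t) \<longlongrightarrow> l) (at_left t)" by (blast intro: tendsto_mult_left)
  qed
  moreover have "sup_norm (\<lambda>t. c * x t) < \<infinity>"
  proof -
    obtain K where "\<And>t. \<bar>x t\<bar> \<le> K" using x(2) unfolding sup_norm_finite_iff by blast
    then have "\<bar>c * x t\<bar> \<le> \<bar>c\<bar> * K" for t by (simp add: abs_mult mult_left_mono)
    then show ?thesis unfolding sup_norm_finite_iff by blast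
  qed
  moreover have "wnorm \<phi> (\<lambda>t. c * x t) < \<infinity>"
  proof -
    obtain K where "\<And>t. \<bar>x t * \<phi> t\<bar> \<le> K" using DphiD assms by metis
    then have "\<bar>c * x t * \<phi> t\<bar> \<le> \<bar>c\<bar> * K" for t
      unfolding mult.assoc abs_mult[of c] by (intro mult_left_mono) auto
    then show ?thesis unfolding wnorm_def sup_norm_finite_iff by blast
  qed
  moreover have "((\<lambda>t. \<bar>c * x t\<bar>) \<longlongrightarrow> 0) at_infinity"
    using tendsto_mult_right_zero[of x at_infinity c] x(3) by (simp add: tendsto_rabs_zero_iff)
  ultimately show ?thesis by (simp add: Dphi_def Dspace_def)
qed

lemma dphi_add_left: "dphi \<phi> (\<lambda>t. u t + x t) (\<lambda>t. u t + y t) = dphi \<phi> x y"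
  by (simp add: dphi_def)

lemma dphi_add_right: "dphi \<phi> (\<lambda>t. x t + u t) (\<lambda>t. y t + u t) = dphi \<phi> x y"
  by (simp add: dphi_def)

lemma measurable_Dphi_sigmaI:
  assumes "\<And>\<omega>. \<omega> \<in> space N \<Longrightarrow> h \<omega> \<in> Dphi \<phi>" "\<And>t. (\<lambda>\<omega>. h \<omega> t) \<in> borel_measurable N"
  shows "h \<in> measurable N (Dphi_sigma \<phi>)"
proof -
  have "h \<in> measurable N Dsigma"
    unfolding Dsigma_def
  proof (rule measurable_measure_of)
    show "h \<in> space N \<rightarrow> Dspace" using assms(1) Dphi_subset by blast
    fix Y assume "Y \<in> {{v \<in> Dspace. v t \<in> A} |t A. A \<in> sets (borel :: real measure)}"
    then obtain t A where A: "A \<in> sets borel" and Y: "Y = {v \<in> Dspace. v t \<in> A}" by blast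
    have "h -` Y \<inter> space N = (\<lambda>\<omega>. h \<omega> t) -` A \<inter> space N" using assms(1) Dphi_subset Y by blast
    then show "h -` Y \<inter> space N \<in> sets N" using measurable_sets[OF assms(2) A] by simp
  qed auto
  then show ?thesis unfolding Dphi_sigma_def using assms(1) by (intro measurable_restrict_space2) auto
qed

text \<open>In a nonseparable normed space measurability of addition with respect to the ball
  sigma-algebra is not automatic. Here the coordinate projections generate it, so addition of real
  random variables is enough.\<close>

lemma measurable_Dphi_add:
  assumes u: "u \<in> measurable N (Dphi_sigma \<phi>)" and v: "v \<in> measurable N (Dphi_sigma \<phi>)"
  shows "(\<lambda>\<omega> t. u \<omega> t + v \<omega> t) \<in> measurable N (Dphi_sigma \<phi>)"
proof (rule measurable_Dphi_sigmaI)
  show "(\<lambda>t. u \<omega> t + v \<omega> t) \<in> Dphi \<phi>" if "\<omega> \<in> space N" for \<omega>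
    using measurable_space[OF u that] measurable_space[OF v that] by (intro Dphi_add) auto
  show "(\<lambda>\<omega>. u \<omega> t + v \<omega> t) \<in> borel_measurable N" for t
    using measurable_compose[OF u measurable_coord_Dphi] measurable_compose[OF v measurable_coord_Dphi]
    by simp
qed

lemma linear_continuous_at_zero_imp_Lipschitz:
  assumes w: "weight_function \<phi>" and lin: "fun_linear_on (Dphi \<phi>) g"
    and cont: "topcontinuous_at (Dphi_top \<phi>) euclideanreal g (\<lambda>t. 0)"
  shows "\<exists>L>0. \<forall>x\<in>Dphi \<phi>. \<forall>y\<in>Dphi \<phi>. \<bar>g x - g y\<bar> \<le> L * dphi \<phi> x y"
proof -
  interpret Metric_space "Dphi \<phi>" "dphi \<phi>" by (rule Metric_space_Dphi[OF w])
  have z: "(\<lambda>t. 0) \<in> Dphi \<phi>" using cont by (auto simp: topcontinuous_at_def)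
  have scale: "g (\<lambda>t. c * x t) = c * g x" if "x \<in> Dphi \<phi>" for c x
    using lin that by (auto simp: fun_linear_on_def)
  have g0: "g (\<lambda>t. 0) = 0" using scale[OF z, of 0] by simp
  obtain T where T: "openin mtopology T" "(\<lambda>t. 0) \<in> T" "\<And>y. y \<in> T \<Longrightarrow> g y \<in> ball 0 1"
    using cont g0 unfolding topcontinuous_at_def by (metis centre_in_ball open_ball open_openin zero_less_one)
  obtain \<delta> where \<delta>: "\<delta> > 0" "mball (\<lambda>t. 0) \<delta> \<subseteq> T" using T(1,2) unfolding openin_mtopology by blast
  have small: "\<bar>g y\<bar> < 1" if "y \<in> Dphi \<phi>" "dphi \<phi> (\<lambda>t. 0) y < \<delta>" for y
  proof -
    have "y \<in> T" using that z \<delta>(2) by auto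
    from T(3)[OF this] show ?thesis by simp
  qed
  have "\<bar>g x - g y\<bar> \<le> 2 / \<delta> * dphi \<phi> x y" if x: "x \<in> Dphi \<phi>" and y: "y \<in> Dphi \<phi>" for x y
  proof (cases "x = y")
    case False
    define r where "r = dphi \<phi> x y"
    have r: "0 < r" using False x y by (simp add: r_def less_le)
    define v where "v = (\<lambda>t. x t + (-1) * y t)"
    have y': "(\<lambda>t. (-1) * y t) \<in> Dphi \<phi>" by (rule Dphi_scale[OF y])
    have v: "v \<in> Dphi \<phi>" unfolding v_def by (rule Dphi_add[OF x y'])
    have gv: "g v = g x - g y"
    proof -
      have "g v = g x + g (\<lambda>t. (-1) * y t)"
        using lin x y' unfolding fun_linear_on_def v_def by auto
      then show ?thesis using scale[OF y, of "-1"] by simp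
    qed
    \<comment> \<open>Scales \<open>x - y\<close> to norm \<open>\<delta> / 2\<close>, strictly
      inside the ball on which \<open>g\<close> is smaller than 1; undoing the scaling produces the
      constant \<open>2 / \<delta>\<close>.\<close>
    define c where "c = \<delta> / (2 * r)"
    have c: "0 < c" using \<delta>(1) r by (simp add: c_def)
    have "\<bar>(0 - c * v t) * \<phi> t\<bar> \<le> c * r" for t
    proof -
      have "\<bar>(x t - y t) * \<phi> t\<bar> \<le> r" using dphi_le_iff[OF x y, of r] r by (simp add: r_def)
      then have "c * \<bar>(x t - y t) * \<phi> t\<bar> \<le> c * r" using c by (intro mult_left_mono) auto
      then show ?thesis using c by (simp add: v_def abs_mult)
    qed
    then have "dphi \<phi> (\<lambda>t. 0) (\<lambda>t. c * v t) \<le> c * r"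
      using dphi_le_iff[OF z Dphi_scale[OF v], of "c * r" c] c r by simp
    also have "\<dots> < \<delta>" using \<delta>(1) r by (simp add: c_def)
    finally have "\<bar>g (\<lambda>t. c * v t)\<bar> < 1" by (intro small Dphi_scale[OF v])
    then have "c * \<bar>g x - g y\<bar> < 1" using scale[OF v, of c] c gv by (simp add: abs_mult)
    then show ?thesis using \<delta>(1) r by (simp add: c_def r_def[symmetric] field_simps)
  qed (use \<delta>(1) nonneg in simp)
  then show ?thesis using \<delta>(1) by (intro exI[of _ "2 / \<delta>"]) auto
qed

text \<open>If no \<open>k\<close> worked, points \<open>y k\<close> violating the bound at indices
  \<open>m k > k\<close> would converge to \<open>x\<close>. With step sizes
  \<open>1 / a (m k)\<close> they form an admissible triplet, which contradicts differentiability.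
  The indices need not be monotone: \<open>m k > k\<close> already forces them to infinity.\<close>

lemma quasi_hadamard_imp_ext_conv:
  assumes w: "weight_function \<phi>" and qh: "quasi_hadamard \<phi> f Df F C f'" and C: "C \<subseteq> Dphi \<phi>"
    and a: "\<And>n. n \<ge> 1 \<Longrightarrow> 0 < a n" "filterlim a at_top sequentially"
  shows "Metric_space.ext_conv (dphi \<phi>) (\<lambda>n. {y \<in> Dphi \<phi>. (\<lambda>t. F t + 1 / a n * y t) \<in> Df})
      (\<lambda>n y. a n * (f (\<lambda>t. F t + 1 / a n * y t) - f F)) C f'"
proof -
  interpret Metric_space "Dphi \<phi>" "dphi \<phi>" by (rule Metric_space_Dphi[OF w])
  show ?thesis
    unfolding ext_conv_def
  proof (intro ballI allI impI, rule ccontr)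
    fix x and e :: real assume x: "x \<in> C" and e: "0 < e"
    assume "\<not> (\<exists>k. \<forall>n>k. \<forall>y\<in>{y \<in> Dphi \<phi>. (\<lambda>t. F t + 1 / a n * y t) \<in> Df}. dphi \<phi> x y < 1 / real (Suc k) \<longrightarrow>
        \<bar>a n * (f (\<lambda>t. F t + 1 / a n * y t) - f F) - f' x\<bar> \<le> e)"
    then have "\<forall>k. \<exists>n y. n > k \<and> y \<in> Dphi \<phi> \<and> (\<lambda>t. F t + 1 / a n * y t) \<in> Df \<and> dphi \<phi> x y < 1 / real (Suc k) \<and>
        e < \<bar>a n * (f (\<lambda>t. F t + 1 / a n * y t) - f F) - f' x\<bar>"
      by (force simp: not_le)
    then obtain m y where "\<forall>k. m k > k \<and> y k \<in> Dphi \<phi> \<and> (\<lambda>t. F t + 1 / a (m k) * y k t) \<in> Df \<and>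
        dphi \<phi> x (y k) < 1 / real (Suc k) \<and> e < \<bar>a (m k) * (f (\<lambda>t. F t + 1 / a (m k) * y k t) - f F) - f' x\<bar>"
      unfolding choice_iff by blast
    then have my: "\<And>k::nat. m k > k" "\<And>k. y k \<in> Dphi \<phi>" "\<And>k. (\<lambda>t. F t + 1 / a (m k) * y k t) \<in> Df"
        "\<And>k. dphi \<phi> x (y k) < 1 / real (Suc k)"
        "\<And>k. e < \<bar>a (m k) * (f (\<lambda>t. F t + 1 / a (m k) * y k t) - f F) - f' x\<bar>"
      by simp_all
    have m: "filterlim m at_top sequentially"
      by (rule filterlim_at_top_mono[OF filterlim_ident]) (use my(1) in \<open>auto intro: less_imp_le always_eventually\<close>)
    \<comment> \<open>\<open>m k > k\<close> excludes index 0, at which nothing is known about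
      \<open>a\<close>.\<close>
    have am: "0 < a (m k)" for k using a(1)[of "m k"] my(1)[of k] by simp
    have "(\<lambda>k. 1 / a (m k)) \<longlonglongrightarrow> 0"
      using tendsto_inverse_0_at_top[OF filterlim_compose[OF a(2) m]] by (simp add: inverse_eq_divide)
    moreover have "(\<lambda>k. dphi \<phi> (y k) x) \<longlonglongrightarrow> 0"
    proof (rule tendsto_sandwich[OF _ _ tendsto_const LIMSEQ_inverse_real_of_nat])
      show "\<forall>\<^sub>F k in sequentially. dphi \<phi> (y k) x \<le> inverse (real (Suc k))"
        using my(4) by (auto simp: commute[of _ x] inverse_eq_divide intro!: always_eventually less_imp_le)
    qed simp
    ultimately have "(\<lambda>k. \<bar>f' x - (f (\<lambda>t. F t + 1 / a (m k) * y k t) - f F) / (1 / a (m k))\<bar>) \<longlonglongrightarrow> 0"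
      using x my(2,3) am qh[unfolded quasi_hadamard_def, THEN conjunct2, rule_format, of x y "\<lambda>k. 1 / a (m k)"]
      by (simp del: times_divide_eq_left divide_divide_eq_right)
    from order_tendstoD(2)[OF this e]
    obtain k where "\<bar>f' x - (f (\<lambda>t. F t + 1 / a (m k) * y k t) - f F) / (1 / a (m k))\<bar> < e"
      by (auto simp: eventually_sequentially)
    then show False using my(5)[of k] by (simp add: abs_minus_commute mult.commute)
  qed
qed

section \<open>Conditional laws in the bootstrap world\<close>

text \<open>The functions \<open>b n\<close> may be nonmeasurable, so dominated convergence is
  applied to the minorants \<open>T n\<close>, which are squeezed to 0 wherever \<open>b n\<close>
  tends to 0.\<close>

lemma integral_tendsto_0_of_AE_dominated:
  fixes T b :: "nat \<Rightarrow> 'a \<Rightarrow> real"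
  assumes "prob_space N" and T: "\<And>n. n \<ge> 1 \<Longrightarrow> T n \<in> borel_measurable N"
    and b: "\<And>n \<omega>. n \<ge> 1 \<Longrightarrow> \<omega> \<in> space N \<Longrightarrow> 0 \<le> T n \<omega> \<and> T n \<omega> \<le> b n \<omega> \<and> b n \<omega> \<le> 2"
    and lim: "AE \<omega> in N. (\<lambda>n. b n \<omega>) \<longlonglongrightarrow> 0"
  shows "(\<lambda>n. \<integral>\<omega>. T n \<omega> \<partial>N) \<longlonglongrightarrow> 0"
proof -
  interpret prob_space N by fact
  have "(\<lambda>n. \<integral>\<omega>. T (Suc n) \<omega> \<partial>N) \<longlonglongrightarrow> (\<integral>\<omega>. 0 \<partial>N)"
  proof (rule integral_dominated_convergence[where w = "\<lambda>_. 2"])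
    show "AE \<omega> in N. (\<lambda>n. T (Suc n) \<omega>) \<longlonglongrightarrow> 0"
      using lim AE_space
    proof eventually_elim
      case (elim \<omega>)
      have "0 \<le> T (Suc n) \<omega>" "T (Suc n) \<omega> \<le> b (Suc n) \<omega>" for n
        using b[of "Suc n" \<omega>] elim(2) by auto
      then show ?case
        by (intro tendsto_sandwich[OF _ _ tendsto_const LIMSEQ_Suc[OF elim(1)]] always_eventually) auto
    qed
    show "AE \<omega> in N. norm (T (Suc n) \<omega>) \<le> 2" for n
    proof (rule AE_I2)
      show "norm (T (Suc n) \<omega>) \<le> 2" if "\<omega> \<in> space N" for \<omega> using b[of "Suc n" \<omega>] that by simp
    qed
  qed (use T in auto)
  then have "(\<lambda>n. \<integral>\<omega>. T (Suc n) \<omega> \<partial>N) \<longlonglongrightarrow> 0" by simp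
  then show ?thesis by (rule LIMSEQ_imp_Suc)
qed

text \<open>The event that \<open>T n\<close> is at least \<open>e / 4\<close> is measurable and
  contained in the corresponding set for \<open>b n\<close>, so its probability is at most the outer
  measure of that set. On the event \<open>T n\<close> is at most 2, off it less than
  \<open>e / 4\<close>.\<close>

lemma integral_tendsto_0_of_outer_dominated:
  fixes T b :: "nat \<Rightarrow> 'a \<Rightarrow> real"
  assumes "prob_space N" and T: "\<And>n. n \<ge> 1 \<Longrightarrow> T n \<in> borel_measurable N"
    and b: "\<And>n \<omega>. n \<ge> 1 \<Longrightarrow> \<omega> \<in> space N \<Longrightarrow> 0 \<le> T n \<omega> \<and> T n \<omega> \<le> b n \<omega> \<and> b n \<omega> \<le> 2"
    and lim: "\<And>\<delta>. \<delta> > 0 \<Longrightarrow> (\<lambda>n. outer_measure_of N {\<omega> \<in> space N. b n \<omega> \<ge> \<delta>}) \<longlonglongrightarrow> 0"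
  shows "(\<lambda>n. \<integral>\<omega>. T n \<omega> \<partial>N) \<longlonglongrightarrow> 0"
proof (rule tendstoI)
  interpret prob_space N by fact
  fix e :: real assume e: "0 < e"
  have "\<forall>\<^sub>F n in sequentially. outer_measure_of N {\<omega> \<in> space N. b n \<omega> \<ge> e / 4} < ennreal (e / 8)"
    by (rule order_tendstoD(2)[OF lim]) (use e in auto)
  moreover have "\<forall>\<^sub>F n in sequentially. 1 \<le> (n::nat)" by (rule eventually_ge_at_top)
  ultimately show "\<forall>\<^sub>F n in sequentially. dist (\<integral>\<omega>. T n \<omega> \<partial>N) 0 < e"
  proof eventually_elim
    case (elim n)
    note n = elim(2)
    let ?A = "{\<omega> \<in> space N. e / 4 \<le> T n \<omega>}"
    have A: "?A \<in> sets N" using T[OF n] by measurable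
    have iA: "integrable N (\<lambda>\<omega>. indicator ?A \<omega> :: real)"
      by (rule prob_integrable_bounded[OF assms(1), of _ 1]) (use A in auto)
    have "?A \<subseteq> {\<omega> \<in> space N. e / 4 \<le> b n \<omega>}" using b[OF n] by force
    then have "emeasure N ?A \<le> outer_measure_of N {\<omega> \<in> space N. e / 4 \<le> b n \<omega>}"
      using outer_measure_of_mono[of ?A _ N] outer_measure_of_eq[OF A] by simp
    also have "\<dots> < ennreal (e / 8)" by (rule elim(1))
    finally have "prob ?A < e / 8" using e by (simp add: emeasure_eq_measure ennreal_less_iff)
    have T2: "\<bar>T n \<omega>\<bar> \<le> 2" if "\<omega> \<in> space N" for \<omega> using b[OF n that] by linarith
    have "(\<integral>\<omega>. T n \<omega> \<partial>N) \<le> (\<integral>\<omega>. e / 4 + 2 * indicator ?A \<omega> \<partial>N)"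
    proof (rule integral_mono)
      show "integrable N (T n)" by (rule prob_integrable_bounded[OF assms(1) T[OF n] T2])
      show "integrable N (\<lambda>\<omega>. e / 4 + 2 * indicator ?A \<omega>)" using iA by simp
      show "T n \<omega> \<le> e / 4 + 2 * indicator ?A \<omega>" if "\<omega> \<in> space N" for \<omega>
        using that T2[OF that] e by (auto simp: indicator_def)
    qed
    also have "\<dots> = e / 4 + 2 * prob ?A" using A iA
      by (subst Bochner_Integration.integral_add) (simp_all add: prob_space)
    also have "\<dots> < e" using \<open>prob ?A < e / 8\<close> e by linarith
    finally have "(\<integral>\<omega>. T n \<omega> \<partial>N) < e" .
    moreover have "0 \<le> (\<integral>\<omega>. T n \<omega> \<partial>N)" using b[OF n] by (intro Bochner_Integration.integral_nonneg) auto
    ultimately show ?case by simp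
  qed
qed

text \<open>The bounded Lipschitz distance of the conditional laws is a supremum over an uncountable family
  and need not be measurable in \<open>\<omega>\<close>, so almost sure convergence does not give convergence
  in outer probability. Both modes of conditional convergence enter the following lemmas only through
  their common consequence for measurable minorants of this distance.\<close>

lemma bootstrap_remainder_tendsto_0:
  fixes V :: "nat \<Rightarrow> 'a \<times> 'b \<Rightarrow> real \<Rightarrow> real"
  assumes w: "weight_function \<phi>"
    and C: "C \<subseteq> Dphi \<phi>" "fun_subspace C" "separable_space (subtopology (Dphi_top \<phi>) C)"
    and N: "prob_space N" "prob_space N'" "prob_space N0"
    and convU: "conv_distr (Dphi \<phi>) (dphi \<phi>) (\<lambda>n. N) U N0 B" and BC: "\<And>\<omega>. \<omega> \<in> space N0 \<Longrightarrow> B \<omega> \<in> C"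
    and V: "\<And>n. n \<ge> 1 \<Longrightarrow> V n \<in> measurable (N \<Otimes>\<^sub>M N') (Dphi_sigma \<phi>)"
    and ctrl: "\<And>T. (\<And>n. n \<ge> 1 \<Longrightarrow> T n \<in> borel_measurable N) \<Longrightarrow>
      (\<And>n \<omega>. n \<ge> 1 \<Longrightarrow> \<omega> \<in> space N \<Longrightarrow> 0 \<le> T n \<omega> \<and> T n \<omega> \<le> dBL (Dphi \<phi>) (dphi \<phi>)
        (distr N' (Dphi_sigma \<phi>) (\<lambda>\<omega>'. V n (\<omega>, \<omega>'))) (distr N0 (Dphi_sigma \<phi>) B)) \<Longrightarrow>
      (\<lambda>n. \<integral>\<omega>. T n \<omega> \<partial>N) \<longlonglongrightarrow> 0"
    and ext: "Metric_space.ext_conv (dphi \<phi>) A R C (\<lambda>_. 0)"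
    and WA: "\<And>n w. n \<ge> 1 \<Longrightarrow> w \<in> space (N \<Otimes>\<^sub>M N') \<Longrightarrow> (\<lambda>t. U n (fst w) t + V n w t) \<in> A n"
    and measW: "\<And>n. n \<ge> 1 \<Longrightarrow> (\<lambda>w. R n (\<lambda>t. U n (fst w) t + V n w t)) \<in> borel_measurable (N \<Otimes>\<^sub>M N')"
  shows "(\<lambda>n. \<integral>w. min 1 \<bar>R n (\<lambda>t. U n (fst w) t + V n w t)\<bar> \<partial>(N \<Otimes>\<^sub>M N')) \<longlonglongrightarrow> 0"
proof -
  interpret Metric_space "Dphi \<phi>" "dphi \<phi>" by (rule Metric_space_Dphi[OF w])
  interpret N: prob_space N by fact
  interpret N': prob_space N' by fact
  interpret N0: prob_space N0 by fact
  interpret P: pair_prob_space N N' by unfold_locales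
  let ?\<Sigma> = "Dphi_sigma \<phi>" and ?BS = "ball_sigma (Dphi \<phi>) (dphi \<phi>)"
  note sb = sets_ball_sigma_Dphi[OF w]
  have mto: "measurable K ?BS = measurable K ?\<Sigma>" for K :: "'z measure" by (rule measurable_cong_sets[OF refl sb])
  have mfrom: "borel_measurable ?BS = borel_measurable ?\<Sigma>" by (rule measurable_cong_sets[OF sb refl])
  have U: "U n \<in> measurable N ?\<Sigma>" if "n \<ge> 1" for n
    using convU that by (auto simp: conv_distr_def mto)
  have B: "B \<in> measurable N0 ?\<Sigma>" using convU by (auto simp: conv_distr_def mto)
  have UE: "U n \<omega> \<in> Dphi \<phi>" if "n \<ge> 1" "\<omega> \<in> space N" for n \<omega> using measurable_space[OF U that(2)] that by simp
  have BE: "B \<omega> \<in> Dphi \<phi>" if "\<omega> \<in> space N0" for \<omega> using BC[OF that] C(1) by blast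
  have Uf: "(\<lambda>w. U n (fst w)) \<in> measurable (N \<Otimes>\<^sub>M N') ?\<Sigma>" if "n \<ge> 1" for n
    by (rule measurable_compose[OF measurable_fst U[OF that]])
  have W: "(\<lambda>w t. U n (fst w) t + V n w t) \<in> measurable (N \<Otimes>\<^sub>M N') ?\<Sigma>" if "n \<ge> 1" for n
    by (rule measurable_Dphi_add[OF Uf[OF that] V[OF that]])
  have V\<omega>: "(\<lambda>\<omega>'. V n (\<omega>, \<omega>')) \<in> measurable N' ?\<Sigma>" if "n \<ge> 1" "\<omega> \<in> space N" for n \<omega>
    by (rule measurable_compose[OF measurable_Pair1'[OF that(2)] V[OF that(1)]])
  have UB: "(\<lambda>z t. fst z t + B (snd z) t) \<in> measurable (?\<Sigma> \<Otimes>\<^sub>M N0) ?\<Sigma>"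
    by (rule measurable_Dphi_add[OF measurable_fst measurable_compose[OF measurable_snd B]])
  define \<Psi> where "\<Psi> s S u = (\<integral>\<omega>0. lip_env s S (\<lambda>t. u t + B \<omega>0 t) \<partial>N0)" for s S u
  have me: "lip_env s S \<in> borel_measurable ?\<Sigma>"
    if "S \<subseteq> Dphi \<phi> \<times> {-1..}" "0 \<le> s" "countable S" for s S
    using measurable_lip_env[OF that] by (simp add: mfrom)
  have \<Psi>m: "\<Psi> s S \<in> borel_measurable ?\<Sigma>" if "S \<subseteq> Dphi \<phi> \<times> {-1..}" "0 \<le> s" "countable S" for s S
  proof -
    have "(\<lambda>u. \<integral>\<omega>0. lip_env s S (\<lambda>t. u t + B \<omega>0 t) \<partial>N0) \<in> borel_measurable ?\<Sigma>"
      using measurable_compose[OF UB me[OF that]]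
      by (intro N0.borel_measurable_lebesgue_integral) (simp add: case_prod_beta')
    then show ?thesis by (simp add: \<Psi>_def[abs_def])
  qed
  have im: "(\<lambda>\<omega>0. lip_env s S (\<lambda>t. u t + B \<omega>0 t)) \<in> borel_measurable N0"
    if "S \<subseteq> Dphi \<phi> \<times> {-1..}" "0 \<le> s" "countable S" "u \<in> Dphi \<phi>" for s S u
    by (rule measurable_compose[OF measurable_Dphi_add[OF measurable_const B] me[OF that(1-3)]]) (use that in simp)
  have \<Psi>1: "\<bar>\<Psi> s S u\<bar> \<le> 1" if "S \<subseteq> Dphi \<phi> \<times> {-1..}" "0 \<le> s" "countable S" "u \<in> Dphi \<phi>" for s S u
    unfolding \<Psi>_def by (rule prob_integral_abs_le[OF N(3) im[OF that] abs_lip_env_le_1[OF that(1,2)]])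
  \<comment> \<open>Translation and averaging preserve the Lipschitz constant, so
    \<open>\<Psi>\<close> is itself a test function for the convergence of
    \<open>U n\<close>.\<close>
  have \<Psi>L: "\<bar>\<Psi> s S u - \<Psi> s S v\<bar> \<le> s * dphi \<phi> u v"
    if S: "S \<subseteq> Dphi \<phi> \<times> {-1..}" "0 \<le> s" "countable S" and u: "u \<in> Dphi \<phi>" and v: "v \<in> Dphi \<phi>" for s S u v
  proof -
    have i: "integrable N0 (\<lambda>\<omega>0. lip_env s S (\<lambda>t. z t + B \<omega>0 t))" if "z \<in> Dphi \<phi>" for z
      by (rule prob_integrable_bounded[OF N(3) im[OF S that] abs_lip_env_le_1[OF S(1,2)]])
    have "\<bar>\<Psi> s S u - \<Psi> s S v\<bar> \<le> (\<integral>\<omega>0. s * dphi \<phi> u v \<partial>N0)"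
      unfolding \<Psi>_def
    proof (rule integral_diff_le_integral[OF i[OF u] i[OF v]])
      fix \<omega>0 assume "\<omega>0 \<in> space N0"
      from lip_env_Lipschitz[OF S(1,2) Dphi_add[OF u BE[OF this]] Dphi_add[OF v BE[OF this]]]
      show "\<bar>lip_env s S (\<lambda>t. u t + B \<omega>0 t) - lip_env s S (\<lambda>t. v t + B \<omega>0 t)\<bar> \<le> s * dphi \<phi> u v"
        by (simp add: dphi_add_right)
    qed simp
    then show ?thesis by (simp add: N0.prob_space)
  qed
  show ?thesis
  proof (rule ext_conv_remainder_tendsto_0[OF ext C(1,3), where I = "\<lambda>s S. \<integral>\<omega>. \<Psi> s S (B \<omega>) \<partial>N0"])
    show "prob_space (N \<Otimes>\<^sub>M N')" by unfold_locales
    show "(\<lambda>w t. U n (fst w) t + V n w t) \<in> measurable (N \<Otimes>\<^sub>M N') ?BS" if "n \<ge> 1" for n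
      using W[OF that] by (simp add: mto)
  next
    fix s :: real and S :: "((real \<Rightarrow> real) \<times> real) set"
    assume S: "S \<subseteq> Dphi \<phi> \<times> {-1..}" "0 \<le> s" "countable S"
    define K where "K = max s 1"
    have K: "0 < K" "s \<le> K" "1 \<le> K" by (auto simp: K_def)
    define \<Delta> where "\<Delta> n \<omega> = (\<integral>\<omega>'. lip_env s S (\<lambda>t. U n \<omega> t + V n (\<omega>, \<omega>') t) \<partial>N') - \<Psi> s S (U n \<omega>)" for n \<omega>
    have m1: "(\<lambda>\<omega>. \<integral>\<omega>'. lip_env s S (\<lambda>t. U n \<omega> t + V n (\<omega>, \<omega>') t) \<partial>N') \<in> borel_measurable N" if "n \<ge> 1" for n
      using measurable_compose[OF W[OF that] me[OF S]]
      by (intro N'.borel_measurable_lebesgue_integral) (simp add: case_prod_beta')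
    have m2: "(\<lambda>\<omega>. \<Psi> s S (U n \<omega>)) \<in> borel_measurable N" if "n \<ge> 1" for n
      by (rule measurable_compose[OF U[OF that] \<Psi>m[OF S]])
    have \<Delta>m: "\<Delta> n \<in> borel_measurable N" if "n \<ge> 1" for n
      using m1[OF that] m2[OF that] by (simp add: \<Delta>_def[abs_def])
    \<comment> \<open>The test function \<open>v \<mapsto> lip_env s S (U n \<omega> + v)\<close>
      varies with \<open>n\<close> and \<open>\<omega>\<close>, but its Lipschitz constant and bound
      do not; this is where uniformity of the bounded Lipschitz distance is used.\<close>
    have \<Delta>b: "\<bar>\<Delta> n \<omega>\<bar> \<le> K * dBL (Dphi \<phi>) (dphi \<phi>) (distr N' ?\<Sigma> (\<lambda>\<omega>'. V n (\<omega>, \<omega>'))) (distr N0 ?\<Sigma> B)"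
      if n: "n \<ge> 1" and \<omega>: "\<omega> \<in> space N" for n \<omega>
    proof -
      define g where "g v = lip_env s S (\<lambda>t. U n \<omega> t + v t)" for v
      have gm: "g \<in> borel_measurable ?\<Sigma>"
        unfolding g_def[abs_def]
        by (rule measurable_compose[OF measurable_Dphi_add[OF measurable_const measurable_ident_sets[OF refl]] me[OF S]])
          (use UE[OF n \<omega>] in simp)
      have "\<bar>integral\<^sup>L (distr N' ?\<Sigma> (\<lambda>\<omega>'. V n (\<omega>, \<omega>'))) g - integral\<^sup>L (distr N0 ?\<Sigma> B) g\<bar>
          \<le> K * dBL (Dphi \<phi>) (dphi \<phi>) (distr N' ?\<Sigma> (\<lambda>\<omega>'. V n (\<omega>, \<omega>'))) (distr N0 ?\<Sigma> B)"
      proof (rule Lipschitz_integral_diff_le_dBL)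
        show "prob_space (distr N' ?\<Sigma> (\<lambda>\<omega>'. V n (\<omega>, \<omega>')))" by (rule N'.prob_space_distr[OF V\<omega>[OF n \<omega>]])
        show "prob_space (distr N0 ?\<Sigma> B)" by (rule N0.prob_space_distr[OF B])
        show "g \<in> borel_measurable ?BS" using gm by (simp add: mfrom)
        show "\<bar>g x\<bar> \<le> K" for x using abs_lip_env_le_1[OF S(1,2)] K(3) by (auto simp: g_def intro: order_trans)
        fix x y assume xy: "x \<in> Dphi \<phi>" "y \<in> Dphi \<phi>"
        have "\<bar>g x - g y\<bar> \<le> s * dphi \<phi> x y"
          using lip_env_Lipschitz[OF S(1,2) Dphi_add[OF UE[OF n \<omega>] xy(1)] Dphi_add[OF UE[OF n \<omega>] xy(2)]]
          by (simp add: g_def dphi_add_left)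
        also have "\<dots> \<le> K * dphi \<phi> x y" using K by (intro mult_right_mono) auto
        finally show "\<bar>g x - g y\<bar> \<le> K * dphi \<phi> x y" .
      qed (use sb K in auto)
      moreover have "integral\<^sup>L (distr N' ?\<Sigma> (\<lambda>\<omega>'. V n (\<omega>, \<omega>'))) g - integral\<^sup>L (distr N0 ?\<Sigma> B) g = \<Delta> n \<omega>"
        unfolding integral_distr[OF V\<omega>[OF n \<omega>] gm] integral_distr[OF B gm] by (simp add: g_def \<Delta>_def \<Psi>_def)
      ultimately show ?thesis by simp
    qed
    have "(\<lambda>n. \<integral>\<omega>. \<bar>\<Delta> n \<omega>\<bar> / K \<partial>N) \<longlonglongrightarrow> 0"
    proof (rule ctrl)
      show "(\<lambda>\<omega>. \<bar>\<Delta> n \<omega>\<bar> / K) \<in> borel_measurable N" if "n \<ge> 1" for n using \<Delta>m[OF that] by simp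
    qed (use \<Delta>b K(1) in \<open>auto simp: divide_le_eq mult.commute\<close>)
    from tendsto_mult_right_zero[OF this, of K]
    have lim\<Delta>: "(\<lambda>n. \<integral>\<omega>. \<bar>\<Delta> n \<omega>\<bar> \<partial>N) \<longlonglongrightarrow> 0" using K(1) by simp
    have "(\<lambda>n. \<integral>\<omega>. \<Delta> n \<omega> \<partial>N) \<longlonglongrightarrow> 0"
      by (rule tendsto_rabs_zero_cancel, rule tendsto_sandwich[OF _ _ tendsto_const lim\<Delta>])
        (auto intro!: always_eventually)
    moreover have "(\<lambda>n. \<integral>\<omega>. \<Psi> s S (U n \<omega>) \<partial>N) \<longlonglongrightarrow> (\<integral>\<omega>. \<Psi> s S (B \<omega>) \<partial>N0)"
      by (rule conv_distr_Lipschitz[OF convU _ \<Psi>L[OF S] \<Psi>1[OF S]]) (use \<Psi>m[OF S] in \<open>auto simp: mfrom\<close>)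
    ultimately have "(\<lambda>n. (\<integral>\<omega>. \<Delta> n \<omega> \<partial>N) + (\<integral>\<omega>. \<Psi> s S (U n \<omega>) \<partial>N)) \<longlonglongrightarrow> 0 + (\<integral>\<omega>. \<Psi> s S (B \<omega>) \<partial>N0)"
      by (rule tendsto_add)
    moreover have "(\<integral>\<omega>. \<Delta> n \<omega> \<partial>N) + (\<integral>\<omega>. \<Psi> s S (U n \<omega>) \<partial>N) =
        (\<integral>w. lip_env s S (\<lambda>t. U n (fst w) t + V n w t) \<partial>(N \<Otimes>\<^sub>M N'))" if n: "n \<ge> 1" for n
    proof -
      have i1: "integrable N (\<lambda>\<omega>. \<integral>\<omega>'. lip_env s S (\<lambda>t. U n \<omega> t + V n (\<omega>, \<omega>') t) \<partial>N')"
      proof (rule prob_integrable_bounded[OF N(1) m1[OF n]])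
        fix \<omega> assume \<omega>: "\<omega> \<in> space N"
        show "\<bar>\<integral>\<omega>'. lip_env s S (\<lambda>t. U n \<omega> t + V n (\<omega>, \<omega>') t) \<partial>N'\<bar> \<le> 1"
          by (rule prob_integral_abs_le[OF N(2) measurable_compose[OF measurable_Dphi_add[OF measurable_const V\<omega>[OF n \<omega>]] me[OF S]]
                abs_lip_env_le_1[OF S(1,2)]]) (use UE[OF n \<omega>] in simp)
      qed
      have i2: "integrable N (\<lambda>\<omega>. \<Psi> s S (U n \<omega>))"
        by (rule prob_integrable_bounded[OF N(1) m2[OF n] \<Psi>1[OF S UE[OF n]]])
      have "integrable (N \<Otimes>\<^sub>M N') (\<lambda>w. lip_env s S (\<lambda>t. U n (fst w) t + V n w t))"
        by (rule prob_integrable_bounded[OF _ measurable_compose[OF W[OF n] me[OF S]] abs_lip_env_le_1[OF S(1,2)]])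
          unfold_locales
      from P.integral_fst'[OF this] show ?thesis using i1 i2 by (simp add: \<Delta>_def)
    qed
    ultimately show "(\<lambda>n. \<integral>w. lip_env s S (\<lambda>t. U n (fst w) t + V n w t) \<partial>(N \<Otimes>\<^sub>M N')) \<longlonglongrightarrow> (\<integral>\<omega>. \<Psi> s S (B \<omega>) \<partial>N0)"
      by (subst (asm) tendsto_cong[OF eventually_mono[OF eventually_ge_at_top[of 1]]]) auto
  next
    fix s :: "nat \<Rightarrow> real" and S :: "nat \<Rightarrow> ((real \<Rightarrow> real) \<times> real) set"
    assume S0: "\<And>k. S k \<subseteq> Dphi \<phi> \<times> {0..}" and s: "\<And>k::nat. 0 \<le> s k" and Sc: "\<And>k. countable (S k)"
      and lim: "\<And>x. x \<in> C \<Longrightarrow> (\<lambda>k. lip_env (s k) (S k) x) \<longlonglongrightarrow> 0"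
    have S: "S k \<subseteq> Dphi \<phi> \<times> {-1..}" for k using S0[of k] by fastforce
    have "(\<lambda>k. \<integral>\<omega>. \<Psi> (s k) (S k) (B \<omega>) \<partial>N0) \<longlonglongrightarrow> (\<integral>\<omega>. 0 \<partial>N0)"
    proof (rule prob_bounded_convergence[OF N(3) _ \<Psi>1[OF S s Sc BE]])
      show "(\<lambda>\<omega>. \<Psi> (s k) (S k) (B \<omega>)) \<in> borel_measurable N0" for k
        by (rule measurable_compose[OF B \<Psi>m[OF S s Sc]])
      fix \<omega> assume \<omega>: "\<omega> \<in> space N0"
      \<comment> \<open>\<open>C\<close> is closed under addition, so the sum of the two values of
        \<open>B\<close> lies in \<open>C\<close>, where the cutoffs tend to 0. Bounded convergence
        is used twice, for the inner and for the outer integral.\<close>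
      have "(\<lambda>k. \<integral>\<omega>0. lip_env (s k) (S k) (\<lambda>t. B \<omega> t + B \<omega>0 t) \<partial>N0) \<longlonglongrightarrow> (\<integral>\<omega>0. 0 \<partial>N0)"
        by (rule prob_bounded_convergence[OF N(3) im[OF S s Sc BE[OF \<omega>]] abs_lip_env_le_1[OF S s] lim])
          (use C(2) BC \<omega> in \<open>auto simp: fun_subspace_def\<close>)
      then show "(\<lambda>k. \<Psi> (s k) (S k) (B \<omega>)) \<longlonglongrightarrow> 0" by (simp add: \<Psi>_def)
    qed
    then show "(\<lambda>k. \<integral>\<omega>. \<Psi> (s k) (S k) (B \<omega>) \<partial>N0) \<longlonglongrightarrow> 0" by simp
  qed (use WA measW in auto)
qed

text \<open>For each \<open>\<omega>\<close> the distance \<open>D\<close> of the real laws is at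
  most \<open>K\<close> times the distance of the laws on the function space plus
  \<open>\<rho>\<close>, a conditional mean of truncated remainders. \<open>D\<close> and
  \<open>\<rho>\<close> are measurable while the function space distance need not be, so the
  inequality is solved for a measurable minorant of the latter.\<close>

lemma bootstrap_dBL_tendsto_0:
  fixes V :: "nat \<Rightarrow> 'a \<times> 'b \<Rightarrow> real \<Rightarrow> real"
  assumes w: "weight_function \<phi>"
    and N: "prob_space N" "prob_space N'" "prob_space N0"
    and B: "B \<in> measurable N0 (Dphi_sigma \<phi>)"
    and V: "\<And>n. n \<ge> 1 \<Longrightarrow> V n \<in> measurable (N \<Otimes>\<^sub>M N') (Dphi_sigma \<phi>)"
    and ctrl: "\<And>T. (\<And>n. n \<ge> 1 \<Longrightarrow> T n \<in> borel_measurable N) \<Longrightarrow>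
      (\<And>n \<omega>. n \<ge> 1 \<Longrightarrow> \<omega> \<in> space N \<Longrightarrow> 0 \<le> T n \<omega> \<and> T n \<omega> \<le> dBL (Dphi \<phi>) (dphi \<phi>)
        (distr N' (Dphi_sigma \<phi>) (\<lambda>\<omega>'. V n (\<omega>, \<omega>'))) (distr N0 (Dphi_sigma \<phi>) B)) \<Longrightarrow>
      (\<lambda>n. \<integral>\<omega>. T n \<omega> \<partial>N) \<longlonglongrightarrow> 0"
    and g: "g \<in> borel_measurable (Dphi_sigma \<phi>)"
      "\<And>x y. x \<in> Dphi \<phi> \<Longrightarrow> y \<in> Dphi \<phi> \<Longrightarrow> \<bar>g x - g y\<bar> \<le> L * dphi \<phi> x y"
    and RU: "\<And>n. n \<ge> 1 \<Longrightarrow> RU n \<in> borel_measurable N" "(\<lambda>n. \<integral>\<omega>. min 1 \<bar>RU n \<omega>\<bar> \<partial>N) \<longlonglongrightarrow> 0"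
    and RW: "\<And>n. n \<ge> 1 \<Longrightarrow> RW n \<in> borel_measurable (N \<Otimes>\<^sub>M N')"
      "(\<lambda>n. \<integral>w. min 1 \<bar>RW n w\<bar> \<partial>(N \<Otimes>\<^sub>M N')) \<longlonglongrightarrow> 0"
    and Y: "\<And>n. n \<ge> 1 \<Longrightarrow> Y n \<in> borel_measurable (N \<Otimes>\<^sub>M N')"
      "\<And>n w. n \<ge> 1 \<Longrightarrow> w \<in> space (N \<Otimes>\<^sub>M N') \<Longrightarrow> Y n w = g (V n w) + RW n w - RU n (fst w)"
    and \<delta>: "0 < (\<delta>::real)"
  defines "D \<equiv> \<lambda>n \<omega>. dBL UNIV dist (distr N' borel (\<lambda>\<omega>'. Y n (\<omega>, \<omega>'))) (distr N0 borel (\<lambda>\<omega>0. g (B \<omega>0)))"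
  shows "(\<forall>n\<ge>1. {\<omega> \<in> space N. D n \<omega> \<ge> \<delta>} \<in> sets N) \<and>
    (\<lambda>n. measure N {\<omega> \<in> space N. D n \<omega> \<ge> \<delta>}) \<longlonglongrightarrow> 0"
proof -
  interpret Metric_space "Dphi \<phi>" "dphi \<phi>" by (rule Metric_space_Dphi[OF w])
  interpret N: prob_space N by fact
  interpret N': prob_space N' by fact
  interpret N0: prob_space N0 by fact
  interpret P: pair_prob_space N N' by unfold_locales
  let ?\<Sigma> = "Dphi_sigma \<phi>"
  let ?b = "\<lambda>n \<omega>. dBL (Dphi \<phi>) (dphi \<phi>) (distr N' ?\<Sigma> (\<lambda>\<omega>'. V n (\<omega>, \<omega>'))) (distr N0 ?\<Sigma> B)"
  note sb = sets_ball_sigma_Dphi[OF w]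
  note sr = sets_ball_sigma_real
  have mfrom: "borel_measurable (ball_sigma (Dphi \<phi>) (dphi \<phi>)) = borel_measurable ?\<Sigma>"
    by (rule measurable_cong_sets[OF sb refl])
  have V\<omega>: "(\<lambda>\<omega>'. V n (\<omega>, \<omega>')) \<in> measurable N' ?\<Sigma>" if "n \<ge> 1" "\<omega> \<in> space N" for n \<omega>
    by (rule measurable_compose[OF measurable_Pair1'[OF that(2)] V[OF that(1)]])
  have Y\<omega>: "(\<lambda>\<omega>'. Y n (\<omega>, \<omega>')) \<in> borel_measurable N'" if "n \<ge> 1" "\<omega> \<in> space N" for n \<omega>
    by (rule measurable_compose[OF measurable_Pair1'[OF that(2)] Y(1)[OF that(1)]])
  have RW\<omega>: "(\<lambda>\<omega>'. RW n (\<omega>, \<omega>')) \<in> borel_measurable N'" if "n \<ge> 1" "\<omega> \<in> space N" for n \<omega>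
    by (rule measurable_compose[OF measurable_Pair1'[OF that(2)] RW(1)[OF that(1)]])
  have gB: "(\<lambda>\<omega>0. g (B \<omega>0)) \<in> borel_measurable N0" by (rule measurable_compose[OF B g(1)])
  have Dm: "D n \<in> borel_measurable N" if "n \<ge> 1" for n
    unfolding D_def
    by (rule measurable_dBL_real_kernel[OF N(2) Y(1)[OF that] N0.prob_space_distr[OF gB]]) simp
  have pr: "prob_space (distr N' ?\<Sigma> (\<lambda>\<omega>'. V n (\<omega>, \<omega>')))" "prob_space (distr N' borel (\<lambda>\<omega>'. Y n (\<omega>, \<omega>')))"
    if "n \<ge> 1" "\<omega> \<in> space N" for n \<omega>
    using N'.prob_space_distr[OF V\<omega>[OF that]] N'.prob_space_distr[OF Y\<omega>[OF that]] by auto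
  have pr0: "prob_space (distr N0 ?\<Sigma> B)" "prob_space (distr N0 borel (\<lambda>\<omega>0. g (B \<omega>0)))"
    using N0.prob_space_distr[OF B] N0.prob_space_distr[OF gB] by auto
  have D0: "0 \<le> D n \<omega>" "D n \<omega> \<le> 2" if "n \<ge> 1" "\<omega> \<in> space N" for n \<omega>
    unfolding D_def
    using Met_TC.dBL_nonneg[OF pr(2)[OF that] pr0(2)] BL1_integral_diff_le[OF pr(2)[OF that] pr0(2), of UNIV dist]
    by (auto simp: sr intro!: Met_TC.dBL_leI)
  have b0: "0 \<le> ?b n \<omega>" if "n \<ge> 1" "\<omega> \<in> space N" for n \<omega>
    using dBL_nonneg[OF pr(1)[OF that] pr0(1)] by (simp add: sb)
  define K where "K = max L 1"
  have K: "0 < K" "L \<le> K" "1 \<le> K" by (auto simp: K_def)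
  \<comment> \<open>Replacing \<open>Y n\<close> by \<open>g (V n)\<close> changes a function of the
    unit class by at most the minimum of 2 and the size of \<open>RW n - RU n\<close>, hence by at
    most twice the sum of both remainders truncated at 1.\<close>
  define \<rho> where "\<rho> n \<omega> = 2 * (\<integral>\<omega>'. min 1 \<bar>RW n (\<omega>, \<omega>')\<bar> \<partial>N') + 2 * min 1 \<bar>RU n \<omega>\<bar>" for n \<omega>
  have mR: "(\<lambda>\<omega>. \<integral>\<omega>'. min 1 \<bar>RW n (\<omega>, \<omega>')\<bar> \<partial>N') \<in> borel_measurable N" if "n \<ge> 1" for n
    using RW(1)[OF that] by (intro N'.borel_measurable_lebesgue_integral) (simp add: case_prod_beta')
  have \<rho>m: "\<rho> n \<in> borel_measurable N" if "n \<ge> 1" for n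
    using mR[OF that] RU(1)[OF that] by (simp add: \<rho>_def[abs_def])
  have iRW\<omega>: "integrable N' (\<lambda>\<omega>'. min 1 \<bar>RW n (\<omega>, \<omega>')\<bar>)" if "n \<ge> 1" "\<omega> \<in> space N" for n \<omega>
    by (rule prob_integrable_bounded[OF N(2), of _ 1]) (use RW\<omega>[OF that] in auto)
  have iR: "integrable N (\<lambda>\<omega>. \<integral>\<omega>'. min 1 \<bar>RW n (\<omega>, \<omega>')\<bar> \<partial>N')" if n: "n \<ge> 1" for n
  proof (rule prob_integrable_bounded[OF N(1) mR[OF n]])
    show "\<bar>\<integral>\<omega>'. min 1 \<bar>RW n (\<omega>, \<omega>')\<bar> \<partial>N'\<bar> \<le> 1" if "\<omega> \<in> space N" for \<omega>
      by (rule prob_integral_abs_le[OF N(2)]) (use RW\<omega>[OF n that] in auto)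
  qed
  have iU: "integrable N (\<lambda>\<omega>. min 1 \<bar>RU n \<omega>\<bar>)" if "n \<ge> 1" for n
    by (rule prob_integrable_bounded[OF N(1), of _ 1]) (use RU(1)[OF that] in auto)
  have \<rho>i: "integrable N (\<rho> n)" if "n \<ge> 1" for n
    unfolding \<rho>_def[abs_def] using iR[OF that] iU[OF that] by simp
  have \<rho>int: "(\<integral>\<omega>. \<rho> n \<omega> \<partial>N) = 2 * (\<integral>w. min 1 \<bar>RW n w\<bar> \<partial>(N \<Otimes>\<^sub>M N')) + 2 * (\<integral>\<omega>. min 1 \<bar>RU n \<omega>\<bar> \<partial>N)"
    if "n \<ge> 1" for n
  proof -
    have "integrable (N \<Otimes>\<^sub>M N') (\<lambda>w. min 1 \<bar>RW n w\<bar>)"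
      by (rule prob_integrable_bounded[of _ _ 1]) (use RW(1)[OF that] P.prob_space_axioms in auto)
    from P.integral_fst'[OF this] show ?thesis using iR[OF that] iU[OF that] by (simp add: \<rho>_def)
  qed
  have "(\<lambda>n. 2 * (\<integral>w. min 1 \<bar>RW n w\<bar> \<partial>(N \<Otimes>\<^sub>M N')) + 2 * (\<integral>\<omega>. min 1 \<bar>RU n \<omega>\<bar> \<partial>N)) \<longlonglongrightarrow> 2 * 0 + 2 * 0"
    by (intro tendsto_intros RU RW)
  then have lim\<rho>: "(\<lambda>n. \<integral>\<omega>. \<rho> n \<omega> \<partial>N) \<longlonglongrightarrow> 0"
    by (subst tendsto_cong[OF eventually_mono[OF eventually_ge_at_top[of 1] \<rho>int]]) auto
  have Db: "D n \<omega> \<le> K * ?b n \<omega> + \<rho> n \<omega>" if n: "n \<ge> 1" and \<omega>: "\<omega> \<in> space N" for n \<omega>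
    unfolding D_def
  proof (rule Met_TC.dBL_leI)
    fix h :: "real \<Rightarrow> real" assume h: "h \<in> BL1 UNIV dist"
    have hL: "\<bar>h x - h y\<bar> \<le> \<bar>x - y\<bar>" for x y using BL1D(2)[OF h] by (simp add: dist_real_def)
    have h1: "\<bar>h x\<bar> \<le> 1" for x using BL1D(3)[OF h] by simp
    have hm: "h \<in> borel_measurable borel" using BL1D(1)[OF h] measurable_cong_sets[OF sr refl] by blast
    have hg: "(\<lambda>v. h (g v)) \<in> borel_measurable ?\<Sigma>" by (rule measurable_compose[OF g(1) hm])
    have 1: "\<bar>integral\<^sup>L (distr N' ?\<Sigma> (\<lambda>\<omega>'. V n (\<omega>, \<omega>'))) (\<lambda>v. h (g v)) - integral\<^sup>L (distr N0 ?\<Sigma> B) (\<lambda>v. h (g v))\<bar>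
        \<le> K * ?b n \<omega>"
    proof (rule Lipschitz_integral_diff_le_dBL[OF pr(1)[OF n \<omega>] pr0(1)])
      fix x y assume xy: "x \<in> Dphi \<phi>" "y \<in> Dphi \<phi>"
      have "\<bar>h (g x) - h (g y)\<bar> \<le> L * dphi \<phi> x y" using hL g(2)[OF xy] by (rule order_trans)
      also have "\<dots> \<le> K * dphi \<phi> x y" using K by (intro mult_right_mono) auto
      finally show "\<bar>h (g x) - h (g y)\<bar> \<le> K * dphi \<phi> x y" .
    next
      show "\<bar>h (g x)\<bar> \<le> K" for x using h1 K(3) by (rule order_trans)
    qed (use sb K hg mfrom in auto)
    have hgV: "(\<lambda>\<omega>'. h (g (V n (\<omega>, \<omega>')))) \<in> borel_measurable N'" by (rule measurable_compose[OF V\<omega>[OF n \<omega>] hg])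
    have hY: "(\<lambda>\<omega>'. h (Y n (\<omega>, \<omega>'))) \<in> borel_measurable N'" by (rule measurable_compose[OF Y\<omega>[OF n \<omega>] hm])
    have 2: "\<bar>(\<integral>\<omega>'. h (Y n (\<omega>, \<omega>')) \<partial>N') - (\<integral>\<omega>'. h (g (V n (\<omega>, \<omega>'))) \<partial>N')\<bar>
        \<le> (\<integral>\<omega>'. 2 * min 1 \<bar>RW n (\<omega>, \<omega>')\<bar> + 2 * min 1 \<bar>RU n \<omega>\<bar> \<partial>N')"
    proof (rule integral_diff_le_integral)
      fix \<omega>' assume "\<omega>' \<in> space N'"
      then have "Y n (\<omega>, \<omega>') = g (V n (\<omega>, \<omega>')) + RW n (\<omega>, \<omega>') - RU n \<omega>"
        using Y(2)[OF n, of "(\<omega>, \<omega>')"] \<omega> by (simp add: space_pair_measure)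
      then show "\<bar>h (Y n (\<omega>, \<omega>')) - h (g (V n (\<omega>, \<omega>')))\<bar> \<le> 2 * min 1 \<bar>RW n (\<omega>, \<omega>')\<bar> + 2 * min 1 \<bar>RU n \<omega>\<bar>"
        using hL[of "Y n (\<omega>, \<omega>')" "g (V n (\<omega>, \<omega>'))"] h1[of "Y n (\<omega>, \<omega>')"] h1[of "g (V n (\<omega>, \<omega>'))"]
        by (auto simp: min_def)
    qed (use prob_integrable_bounded[OF N(2) hY h1] prob_integrable_bounded[OF N(2) hgV h1] iRW\<omega>[OF n \<omega>] in auto)
    also have "\<dots> = \<rho> n \<omega>" using iRW\<omega>[OF n \<omega>] by (simp add: \<rho>_def N'.prob_space)
    finally show "\<bar>integral\<^sup>L (distr N' borel (\<lambda>\<omega>'. Y n (\<omega>, \<omega>'))) h - integral\<^sup>L (distr N0 borel (\<lambda>\<omega>0. g (B \<omega>0))) h\<bar>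
        \<le> K * ?b n \<omega> + \<rho> n \<omega>"
      using 1 unfolding integral_distr[OF V\<omega>[OF n \<omega>] hg] integral_distr[OF B hg]
        integral_distr[OF Y\<omega>[OF n \<omega>] hm] integral_distr[OF gB hm] by linarith
  qed
  \<comment> \<open>Nonnegative, measurable and below the function space distance, hence admissible
    in \<open>ctrl\<close>; at the same time \<open>D \<le> K * T + \<rho>\<close>.\<close>
  define T where "T n \<omega> = max 0 (D n \<omega> - \<rho> n \<omega>) / K" for n \<omega>
  have T0: "0 \<le> T n \<omega>" for n \<omega> using K by (simp add: T_def)
  have Tb: "T n \<omega> \<le> ?b n \<omega>" if "n \<ge> 1" "\<omega> \<in> space N" for n \<omega>
  proof -
    have "max 0 (D n \<omega> - \<rho> n \<omega>) \<le> K * ?b n \<omega>" using Db[OF that] b0[OF that] K by simp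
    then show ?thesis using K(1) by (simp add: T_def divide_le_eq mult.commute)
  qed
  have Tm: "T n \<in> borel_measurable N" if "n \<ge> 1" for n
    using Dm[OF that] \<rho>m[OF that] by (simp add: T_def[abs_def])
  have \<rho>0: "0 \<le> \<rho> n \<omega>" for n \<omega>
    unfolding \<rho>_def by (intro add_nonneg_nonneg mult_nonneg_nonneg Bochner_Integration.integral_nonneg) auto
  have limT: "(\<lambda>n. \<integral>\<omega>. T n \<omega> \<partial>N) \<longlonglongrightarrow> 0" by (rule ctrl) (use Tm T0 Tb in auto)
  have "(\<lambda>n. (K * (\<integral>\<omega>. T n \<omega> \<partial>N) + (\<integral>\<omega>. \<rho> n \<omega> \<partial>N)) / \<delta>) \<longlonglongrightarrow> (K * 0 + 0) / \<delta>"
    using \<delta> by (intro tendsto_intros limT lim\<rho>) auto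
  then have lim: "(\<lambda>n. (K * (\<integral>\<omega>. T n \<omega> \<partial>N) + (\<integral>\<omega>. \<rho> n \<omega> \<partial>N)) / \<delta>) \<longlonglongrightarrow> 0" by simp
  have S: "{\<omega> \<in> space N. \<delta> \<le> D n \<omega>} \<in> sets N" if "n \<ge> 1" for n
    using Dm[OF that] by measurable
  \<comment> \<open>Markov's inequality for \<open>D\<close>, followed by the bound
    \<open>K * T + \<rho>\<close>, whose mean tends to 0.\<close>
  have markov: "measure N {\<omega> \<in> space N. \<delta> \<le> D n \<omega>} \<le> (K * (\<integral>\<omega>. T n \<omega> \<partial>N) + (\<integral>\<omega>. \<rho> n \<omega> \<partial>N)) / \<delta>"
    if n: "n \<ge> 1" for n
  proof -
    have iT: "integrable N (T n)"
    proof (rule prob_integrable_bounded[OF N(1) Tm[OF n]])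
      fix \<omega> assume \<omega>: "\<omega> \<in> space N"
      have "max 0 (D n \<omega> - \<rho> n \<omega>) \<le> 2" using D0[OF n \<omega>] \<rho>0[of n \<omega>] by simp
      also have "\<dots> \<le> 2 * K" using K by simp
      finally show "\<bar>T n \<omega>\<bar> \<le> 2" using K(1) T0[of n \<omega>] by (simp add: T_def divide_le_eq)
    qed
    have iD: "integrable N (D n)"
      by (rule prob_integrable_bounded[OF N(1) Dm[OF n], of 2]) (use D0[OF n] in auto)
    have iA: "integrable N (\<lambda>\<omega>. indicator {\<omega> \<in> space N. \<delta> \<le> D n \<omega>} \<omega> :: real)"
      by (rule prob_integrable_bounded[OF N(1), of _ 1]) (use S[OF n] in auto)
    have "\<delta> * measure N {\<omega> \<in> space N. \<delta> \<le> D n \<omega>} = (\<integral>\<omega>. \<delta> * indicator {\<omega> \<in> space N. \<delta> \<le> D n \<omega>} \<omega> \<partial>N)"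
      using S[OF n] by simp
    also have "\<dots> \<le> (\<integral>\<omega>. K * T n \<omega> + \<rho> n \<omega> \<partial>N)"
    proof (rule integral_mono)
      fix \<omega> assume \<omega>: "\<omega> \<in> space N"
      have "\<delta> * indicator {\<omega> \<in> space N. \<delta> \<le> D n \<omega>} \<omega> \<le> D n \<omega>"
        using D0[OF n \<omega>] \<delta> by (auto simp: indicator_def)
      also have "\<dots> \<le> K * T n \<omega> + \<rho> n \<omega>" using K by (simp add: T_def max_def)
      finally show "\<delta> * indicator {\<omega> \<in> space N. \<delta> \<le> D n \<omega>} \<omega> \<le> K * T n \<omega> + \<rho> n \<omega>" .
    qed (use iA iT \<rho>i[OF n] in auto)
    also have "\<dots> = K * (\<integral>\<omega>. T n \<omega> \<partial>N) + (\<integral>\<omega>. \<rho> n \<omega> \<partial>N)" using iT \<rho>i[OF n] by simp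
    finally show ?thesis using \<delta> by (simp add: le_divide_eq mult.commute)
  qed
  have "(\<lambda>n. measure N {\<omega> \<in> space N. \<delta> \<le> D n \<omega>}) \<longlonglongrightarrow> 0"
    by (rule tendsto_sandwich[OF _ _ tendsto_const lim])
      (use markov in \<open>auto intro!: eventually_mono[OF eventually_ge_at_top[of 1]]\<close>)
  then show ?thesis using S by blast
qed

section \<open>The delta method\<close>

lemma conv_distr_cong:
  assumes "\<And>n \<omega>. n \<ge> 1 \<Longrightarrow> \<omega> \<in> space (N n) \<Longrightarrow> X n \<omega> = Y n \<omega>" and X: "conv_distr E d N X N0 X0"
  shows "conv_distr E d N Y N0 X0"
  unfolding conv_distr_def
proof (intro conjI allI impI)
  show "Y n \<in> measurable (N n) (ball_sigma E d)" if "1 \<le> n" for n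
  proof -
    have "X n \<in> measurable (N n) (ball_sigma E d)" using X that unfolding conv_distr_def by blast
    then show ?thesis using assms(1)[OF that] by (simp cong: measurable_cong)
  qed
  show "X0 \<in> measurable N0 (ball_sigma E d)" using X unfolding conv_distr_def by blast
  fix g assume g: "g \<in> borel_measurable (ball_sigma E d) \<and>
    continuous_map (Metric_space.mtopology E d) euclideanreal g \<and> bounded (g ` E)"
  have "(\<integral>\<omega>. g (X n \<omega>) \<partial>N n) = (\<integral>\<omega>. g (Y n \<omega>) \<partial>N n)" if "n \<ge> 1" for n
    using assms(1)[OF that] by (intro Bochner_Integration.integral_cong) auto
  then have "\<forall>\<^sub>F n in sequentially. (\<integral>\<omega>. g (X n \<omega>) \<partial>N n) = (\<integral>\<omega>. g (Y n \<omega>) \<partial>N n)"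
    by (auto intro: eventually_mono[OF eventually_ge_at_top[of 1]])
  from tendsto_cong[OF this] show "(\<lambda>n. \<integral>\<omega>. g (Y n \<omega>) \<partial>N n) \<longlonglongrightarrow> (\<integral>\<omega>. g (X0 \<omega>) \<partial>N0)"
    using X g unfolding conv_distr_def by blast
qed

lemma distr_Dphi_sigma_eq:
  assumes "weight_function \<phi>"
  shows "distr N (Dphi_sigma \<phi>) Z = distr N (ball_sigma (Dphi \<phi>) (dphi \<phi>)) Z"
  by (rule distr_cong) (simp_all add: sets_ball_sigma_Dphi[OF assms])

lemma add_scaled_diff:
  assumes "0 < c"
  shows "(\<lambda>t. F t + 1 / c * scaled_diff c G F t) = G"
  using assms by (auto simp: scaled_diff_def fun_eq_iff)

text \<open>The extended continuous mapping theorem for the difference quotients of \<open>f\<close>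
  at \<open>F\<close>. The sets of admissible arguments consist of the directions \<open>y\<close>
  for which \<open>F + y / a n\<close> stays in \<open>Df\<close>, since differentiability says
  nothing about other directions.\<close>

lemma quasi_hadamard_delta_method:
  assumes w: "weight_function \<phi>"
    and C: "C \<subseteq> Dphi \<phi>" "separable_space (subtopology (Dphi_top \<phi>) C)"
    and N: "prob_space N" "prob_space N0"
    and a: "\<And>n. n \<ge> 1 \<Longrightarrow> 0 < a n" "filterlim a at_top sequentially"
    and GDf: "\<And>n \<omega>. n \<ge> 1 \<Longrightarrow> \<omega> \<in> space N \<Longrightarrow> G n \<omega> \<in> Df"
    and GD: "\<And>n \<omega>. n \<ge> 1 \<Longrightarrow> \<omega> \<in> space N \<Longrightarrow> scaled_diff (a n) (G n \<omega>) F \<in> Dphi \<phi>"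
    and conv: "conv_distr (Dphi \<phi>) (dphi \<phi>) (\<lambda>n. N) (\<lambda>n \<omega>. scaled_diff (a n) (G n \<omega>) F) N0 B"
    and BC: "\<And>\<omega>. \<omega> \<in> space N0 \<Longrightarrow> B \<omega> \<in> C"
    and fG: "\<And>n. n \<ge> 1 \<Longrightarrow> (\<lambda>\<omega>. f (G n \<omega>)) \<in> borel_measurable N"
    and qh: "quasi_hadamard \<phi> f Df F C f'"
  shows "n \<ge> 1 \<Longrightarrow> (\<lambda>\<omega>. a n * (f (G n \<omega>) - f F)) \<in> borel_measurable N"
    and "(\<lambda>\<omega>. f' (B \<omega>)) \<in> borel_measurable N0"
    and "conv_distr UNIV dist (\<lambda>n. N) (\<lambda>n \<omega>. a n * (f (G n \<omega>) - f F)) N0 (\<lambda>\<omega>. f' (B \<omega>))"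
proof -
  interpret Metric_space "Dphi \<phi>" "dphi \<phi>" by (rule Metric_space_Dphi[OF w])
  show m: "(\<lambda>\<omega>. a n * (f (G n \<omega>) - f F)) \<in> borel_measurable N" if "n \<ge> 1" for n
    using fG[OF that] by simp
  have cont: "continuous_map (subtopology mtopology C) euclideanreal f'"
    using qh by (simp add: quasi_hadamard_def)
  have B: "B \<in> measurable N0 (ball_sigma (Dphi \<phi>) (dphi \<phi>))" using conv by (simp add: conv_distr_def)
  show "(\<lambda>\<omega>. f' (B \<omega>)) \<in> borel_measurable N0"
    by (rule measurable_continuous_on_separable[OF B BC C cont])
  let ?G = "\<lambda>n y. a n * (f (\<lambda>t. F t + 1 / a n * y t) - f F)"
  have eq: "?G n (scaled_diff (a n) (G n \<omega>) F) = a n * (f (G n \<omega>) - f F)" if "n \<ge> 1" for n \<omega>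
    by (simp only: add_scaled_diff[OF a(1)[OF that]])
  have "conv_distr UNIV dist (\<lambda>n. N) (\<lambda>n \<omega>. ?G n (scaled_diff (a n) (G n \<omega>) F)) N0 (\<lambda>\<omega>. f' (B \<omega>))"
  proof (rule extended_continuous_mapping[OF conv N C BC quasi_hadamard_imp_ext_conv[OF w qh C(1) a] cont])
    show "scaled_diff (a n) (G n \<omega>) F \<in> {y \<in> Dphi \<phi>. (\<lambda>t. F t + 1 / a n * y t) \<in> Df}"
      if "n \<ge> 1" "\<omega> \<in> space N" for n \<omega>
      unfolding mem_Collect_eq add_scaled_diff[OF a(1)[OF that(1)]] using GD GDf that by blast
    show "(\<lambda>\<omega>. ?G n (scaled_diff (a n) (G n \<omega>) F)) \<in> borel_measurable N" if "n \<ge> 1" for n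
      using m[OF that] by (simp only: eq[OF that])
  qed
  then show "conv_distr UNIV dist (\<lambda>n. N) (\<lambda>n \<omega>. a n * (f (G n \<omega>) - f F)) N0 (\<lambda>\<omega>. f' (B \<omega>))"
    by (rule conv_distr_cong[rotated]) (rule eq)
qed

lemma quasi_hadamard_bootstrap:
  fixes Fs :: "nat \<Rightarrow> 'a \<times> 'b \<Rightarrow> real \<Rightarrow> real"
  assumes w: "weight_function \<phi>"
    and C: "C \<subseteq> Dphi \<phi>" "fun_subspace C" "separable_space (subtopology (Dphi_top \<phi>) C)"
    and N: "prob_space N" "prob_space N'" "prob_space N0"
    and a: "\<And>n. n \<ge> 1 \<Longrightarrow> 0 < a n" "filterlim a at_top sequentially"
    and GDf: "\<And>n \<omega>. n \<ge> 1 \<Longrightarrow> \<omega> \<in> space N \<Longrightarrow> G n \<omega> \<in> Df"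
    and GD: "\<And>n \<omega>. n \<ge> 1 \<Longrightarrow> \<omega> \<in> space N \<Longrightarrow> scaled_diff (a n) (G n \<omega>) F \<in> Dphi \<phi>"
    and conv: "conv_distr (Dphi \<phi>) (dphi \<phi>) (\<lambda>n. N) (\<lambda>n \<omega>. scaled_diff (a n) (G n \<omega>) F) N0 B"
    and BC: "\<And>\<omega>. \<omega> \<in> space N0 \<Longrightarrow> B \<omega> \<in> C"
    and fG: "\<And>n. n \<ge> 1 \<Longrightarrow> (\<lambda>\<omega>. f (G n \<omega>)) \<in> borel_measurable N"
    and qh: "quasi_hadamard \<phi> f Df F C f'"
    and g: "\<And>x. x \<in> C \<Longrightarrow> g x = f' x" "fun_linear_on (Dphi \<phi>) g" "g \<in> borel_measurable (Dphi_sigma \<phi>)"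
      "\<And>x. x \<in> C \<Longrightarrow> topcontinuous_at (Dphi_top \<phi>) euclideanreal g x"
    and FsDf: "\<And>n w. n \<ge> 1 \<Longrightarrow> w \<in> space (N \<Otimes>\<^sub>M N') \<Longrightarrow> Fs n w \<in> Df"
    and fFs: "\<And>n. n \<ge> 1 \<Longrightarrow> (\<lambda>w. f (Fs n w)) \<in> borel_measurable (N \<Otimes>\<^sub>M N')"
    and V: "\<And>n. n \<ge> 1 \<Longrightarrow> (\<lambda>w. scaled_diff (a n) (Fs n w) (G n (fst w))) \<in> measurable (N \<Otimes>\<^sub>M N') (Dphi_sigma \<phi>)"
    and ctrl: "\<And>T. (\<And>n. n \<ge> 1 \<Longrightarrow> T n \<in> borel_measurable N) \<Longrightarrow>
      (\<And>n \<omega>. n \<ge> 1 \<Longrightarrow> \<omega> \<in> space N \<Longrightarrow> 0 \<le> T n \<omega> \<and> T n \<omega> \<le> dBL (Dphi \<phi>) (dphi \<phi>)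
        (distr N' (Dphi_sigma \<phi>) (\<lambda>\<omega>'. scaled_diff (a n) (Fs n (\<omega>, \<omega>')) (G n \<omega>))) (distr N0 (Dphi_sigma \<phi>) B)) \<Longrightarrow>
      (\<lambda>n. \<integral>\<omega>. T n \<omega> \<partial>N) \<longlonglongrightarrow> 0"
  defines "D \<equiv> \<lambda>n \<omega>. dBL UNIV dist (distr N' borel (\<lambda>\<omega>'. a n * (f (Fs n (\<omega>, \<omega>')) - f (G n \<omega>))))
    (distr N0 borel (\<lambda>\<omega>0. f' (B \<omega>0)))"
  shows "n \<ge> 1 \<Longrightarrow> (\<lambda>w. a n * (f (Fs n w) - f (G n (fst w)))) \<in> borel_measurable (N \<Otimes>\<^sub>M N')"
    and "0 < \<delta> \<Longrightarrow> n \<ge> 1 \<Longrightarrow> {\<omega> \<in> space N. D n \<omega> \<ge> \<delta>} \<in> sets N"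
    and "0 < \<delta> \<Longrightarrow> (\<lambda>n. measure N {\<omega> \<in> space N. D n \<omega> \<ge> \<delta>}) \<longlonglongrightarrow> 0"
proof -
  interpret Metric_space "Dphi \<phi>" "dphi \<phi>" by (rule Metric_space_Dphi[OF w])
  have mto: "measurable K (ball_sigma (Dphi \<phi>) (dphi \<phi>)) = measurable K (Dphi_sigma \<phi>)" for K :: "'z measure"
    by (rule measurable_cong_sets[OF refl sets_ball_sigma_Dphi[OF w]])
  have B: "B \<in> measurable N0 (ball_sigma (Dphi \<phi>) (dphi \<phi>))" using conv by (simp add: conv_distr_def)
  \<comment> \<open>Continuity of \<open>g\<close> is given at points of \<open>C\<close> only; the
    origin is one of them because \<open>C\<close> is a subspace.\<close>
  have "(\<lambda>t. 0) \<in> C" using C(2) by (simp add: fun_subspace_def)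
  then obtain L where L: "\<And>x y. x \<in> Dphi \<phi> \<Longrightarrow> y \<in> Dphi \<phi> \<Longrightarrow> \<bar>g x - g y\<bar> \<le> L * dphi \<phi> x y"
    using linear_continuous_at_zero_imp_Lipschitz[OF w g(2) g(4)] by blast
  define A where "A n = {y \<in> Dphi \<phi>. (\<lambda>t. F t + 1 / a n * y t) \<in> Df}" for n
  define R where "R n y = a n * (f (\<lambda>t. F t + 1 / a n * y t) - f F) - g y" for n y
  have ext: "ext_conv A R C (\<lambda>_. 0)"
    unfolding A_def[abs_def] R_def[abs_def]
    by (rule ext_conv_diff_Lipschitz[OF quasi_hadamard_imp_ext_conv[OF w qh C(1) a] C(1) _ g(1) L]) auto
  define U where "U n \<omega> = scaled_diff (a n) (G n \<omega>) F" for n \<omega>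
  define V' where "V' n w = scaled_diff (a n) (Fs n w) (G n (fst w))" for n w
  have convU: "conv_distr (Dphi \<phi>) (dphi \<phi>) (\<lambda>n. N) U N0 B" using conv by (simp add: U_def[abs_def])
  have Um: "U n \<in> measurable N (Dphi_sigma \<phi>)" if "n \<ge> 1" for n
    using convU that by (simp add: conv_distr_def mto)
  have Vm: "V' n \<in> measurable (N \<Otimes>\<^sub>M N') (Dphi_sigma \<phi>)" if "n \<ge> 1" for n
    using V[OF that] by (simp add: V'_def[abs_def])
  have fst_space: "fst w \<in> space N" if "w \<in> space (N \<Otimes>\<^sub>M N')" for w
    using that by (auto simp: space_pair_measure)
  \<comment> \<open>The intermediate \<open>G n\<close> telescopes away, so the difference quotient
    in this direction involves only \<open>f\<close> at \<open>Fs n\<close> and at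
    \<open>F\<close>.\<close>
  have W: "(\<lambda>t. U n (fst w) t + V' n w t) = scaled_diff (a n) (Fs n w) F" for n w
    by (auto simp: U_def V'_def scaled_diff_def algebra_simps)
  have UE: "U n \<omega> \<in> Dphi \<phi>" if "n \<ge> 1" "\<omega> \<in> space N" for n \<omega>
    using GD[OF that] by (simp add: U_def)
  have VE: "V' n w \<in> Dphi \<phi>" if "n \<ge> 1" "w \<in> space (N \<Otimes>\<^sub>M N')" for n w
    using measurable_space[OF Vm[OF that(1)] that(2)] by simp
  have WE: "scaled_diff (a n) (Fs n w) F \<in> Dphi \<phi>" if "n \<ge> 1" "w \<in> space (N \<Otimes>\<^sub>M N')" for n w
    using Dphi_add[OF UE[OF that(1) fst_space[OF that(2)]] VE[OF that]] by (simp add: W)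
  have RU: "R n (U n \<omega>) = a n * (f (G n \<omega>) - f F) - g (U n \<omega>)" if "n \<ge> 1" for n \<omega>
    unfolding R_def U_def by (simp only: add_scaled_diff[OF a(1)[OF that]])
  have RW: "R n (\<lambda>t. U n (fst w) t + V' n w t) = a n * (f (Fs n w) - f F) - g (\<lambda>t. U n (fst w) t + V' n w t)"
    if "n \<ge> 1" for n w
    unfolding R_def W by (simp only: add_scaled_diff[OF a(1)[OF that]])
  have RUm: "(\<lambda>\<omega>. R n (U n \<omega>)) \<in> borel_measurable N" if "n \<ge> 1" for n
    using fG[OF that] measurable_compose[OF Um[OF that] g(3)] by (simp add: RU[OF that])
  have RWm: "(\<lambda>w. R n (\<lambda>t. U n (fst w) t + V' n w t)) \<in> borel_measurable (N \<Otimes>\<^sub>M N')" if "n \<ge> 1" for n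
    using fFs[OF that] measurable_compose[OF
        measurable_Dphi_add[OF measurable_compose[OF measurable_fst Um[OF that]] Vm[OF that]] g(3)]
    by (simp add: RW[OF that])
  have ctrl': "(\<lambda>n. \<integral>\<omega>. T n \<omega> \<partial>N) \<longlonglongrightarrow> 0"
    if "\<And>n. n \<ge> 1 \<Longrightarrow> T n \<in> borel_measurable N"
      and "\<And>n \<omega>. n \<ge> 1 \<Longrightarrow> \<omega> \<in> space N \<Longrightarrow> 0 \<le> T n \<omega> \<and> T n \<omega> \<le> dBL (Dphi \<phi>) (dphi \<phi>)
        (distr N' (Dphi_sigma \<phi>) (\<lambda>\<omega>'. V' n (\<omega>, \<omega>'))) (distr N0 (Dphi_sigma \<phi>) B)" for T
    by (rule ctrl) (use that in \<open>auto simp: V'_def\<close>)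
  have UA: "U n \<omega> \<in> A n" if "n \<ge> 1" "\<omega> \<in> space N" for n \<omega>
    unfolding A_def U_def mem_Collect_eq add_scaled_diff[OF a(1)[OF that(1)]] using GD GDf that by blast
  have WA: "(\<lambda>t. U n (fst w) t + V' n w t) \<in> A n" if "n \<ge> 1" "w \<in> space (N \<Otimes>\<^sub>M N')" for n w
    unfolding A_def W mem_Collect_eq add_scaled_diff[OF a(1)[OF that(1)]] using WE FsDf that by blast
  have limU: "(\<lambda>n. \<integral>\<omega>. min 1 \<bar>R n (U n \<omega>)\<bar> \<partial>N) \<longlonglongrightarrow> 0"
  proof (rule ext_conv_remainder_tendsto_0[OF ext C(1,3) N(1) _ UA RUm])
    show "U n \<in> measurable N (ball_sigma (Dphi \<phi>) (dphi \<phi>))" if "n \<ge> 1" for n using Um[OF that] by (simp add: mto)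
    show "(\<lambda>n. \<integral>\<omega>. lip_env s S (U n \<omega>) \<partial>N) \<longlonglongrightarrow> (\<integral>\<omega>. lip_env s S (B \<omega>) \<partial>N0)"
      if "S \<subseteq> Dphi \<phi> \<times> {-1..}" "0 \<le> s" "countable S" for s S
      by (rule conv_distr_lip_env[OF convU that])
    fix s :: "nat \<Rightarrow> real" and S :: "nat \<Rightarrow> ((real \<Rightarrow> real) \<times> real) set"
    assume S0: "\<And>k. S k \<subseteq> Dphi \<phi> \<times> {0..}" and s: "\<And>k. 0 \<le> s k" and Sc: "\<And>k. countable (S k)"
      and lim: "\<And>x. x \<in> C \<Longrightarrow> (\<lambda>k. lip_env (s k) (S k) x) \<longlonglongrightarrow> 0"
    have S: "S k \<subseteq> Dphi \<phi> \<times> {-1..}" for k using S0[of k] by fastforce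
    have "(\<lambda>k. \<integral>\<omega>. lip_env (s k) (S k) (B \<omega>) \<partial>N0) \<longlonglongrightarrow> (\<integral>\<omega>. 0 \<partial>N0)"
      by (rule prob_bounded_convergence[OF N(3) measurable_compose[OF B measurable_lip_env[OF S s Sc]]
            abs_lip_env_le_1[OF S s] lim[OF BC]])
    then show "(\<lambda>k. \<integral>\<omega>. lip_env (s k) (S k) (B \<omega>) \<partial>N0) \<longlonglongrightarrow> 0" by simp
  qed
  have limW: "(\<lambda>n. \<integral>w. min 1 \<bar>R n (\<lambda>t. U n (fst w) t + V' n w t)\<bar> \<partial>(N \<Otimes>\<^sub>M N')) \<longlonglongrightarrow> 0"
    by (rule bootstrap_remainder_tendsto_0[OF w C N convU BC Vm ctrl' ext WA RWm])
  show Ym: "(\<lambda>w. a n * (f (Fs n w) - f (G n (fst w)))) \<in> borel_measurable (N \<Otimes>\<^sub>M N')" if "n \<ge> 1" for n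
    using fFs[OF that] measurable_compose[OF measurable_fst[of N N'] fG[OF that]] by simp
  define Y where "Y n w = a n * (f (Fs n w) - f (G n (fst w)))" for n w
  have Ym': "Y n \<in> borel_measurable (N \<Otimes>\<^sub>M N')" if "n \<ge> 1" for n
    using Ym[OF that] by (simp add: Y_def[abs_def])
  have Y': "Y n w = g (V' n w) + R n (\<lambda>t. U n (fst w) t + V' n w t) - R n (U n (fst w))"
    if n: "n \<ge> 1" and w: "w \<in> space (N \<Otimes>\<^sub>M N')" for n w
  proof -
    \<comment> \<open>Splitting \<open>g\<close> makes its values at \<open>U n\<close> cancel
      between the two remainders, just as \<open>f F\<close> does.\<close>
    have "g (\<lambda>t. U n (fst w) t + V' n w t) = g (U n (fst w)) + g (V' n w)"
      using g(2) UE[OF n fst_space[OF w]] VE[OF n w] unfolding fun_linear_on_def by blast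
    then show ?thesis unfolding RU[OF n] RW[OF n] Y_def by (simp add: algebra_simps)
  qed
  have eq: "distr N0 borel (\<lambda>\<omega>0. f' (B \<omega>0)) = distr N0 borel (\<lambda>\<omega>0. g (B \<omega>0))"
    by (rule distr_cong) (use g(1) BC in auto)
  have Bm: "B \<in> measurable N0 (Dphi_sigma \<phi>)" using B by (simp add: mto)
  have main: "(\<forall>n\<ge>1. {\<omega> \<in> space N. D n \<omega> \<ge> \<delta>} \<in> sets N) \<and>
    (\<lambda>n. measure N {\<omega> \<in> space N. D n \<omega> \<ge> \<delta>}) \<longlonglongrightarrow> 0" if "0 < \<delta>" for \<delta>
  proof -
    have "(\<forall>n\<ge>1. {\<omega> \<in> space N. \<delta> \<le> dBL UNIV dist (distr N' borel (\<lambda>\<omega>'. Y n (\<omega>, \<omega>'))) (distr N0 borel (\<lambda>\<omega>0. g (B \<omega>0)))} \<in> sets N) \<and>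
      (\<lambda>n. measure N {\<omega> \<in> space N. \<delta> \<le> dBL UNIV dist (distr N' borel (\<lambda>\<omega>'. Y n (\<omega>, \<omega>'))) (distr N0 borel (\<lambda>\<omega>0. g (B \<omega>0)))}) \<longlonglongrightarrow> 0"
      by (rule bootstrap_dBL_tendsto_0[where V = V' and L = L and RU = "\<lambda>n \<omega>. R n (U n \<omega>)"
            and RW = "\<lambda>n w. R n (\<lambda>t. U n (fst w) t + V' n w t)" and \<phi> = \<phi>])
        (fact w N Bm Vm ctrl' g(3) L RUm limU RWm limW Ym' Y' that)+
    then show ?thesis by (simp add: D_def eq Y_def)
  qed
  show "{\<omega> \<in> space N. D n \<omega> \<ge> \<delta>} \<in> sets N" if "0 < \<delta>" "n \<ge> 1" for \<delta> n
    using main[OF that(1)] that(2) by blast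
  show "(\<lambda>n. measure N {\<omega> \<in> space N. D n \<omega> \<ge> \<delta>}) \<longlonglongrightarrow> 0" if "0 < \<delta>" for \<delta>
    using main[OF that] by blast
qed

text \<open>The two bootstrap assertions differ only in the origin of \<open>ctrl\<close>: under
  almost sure conditional convergence it comes from metrisation and dominated convergence, under
  convergence in outer probability from the inclusion of level sets.\<close>

theorem corollary4p2:
  fixes \<phi> F :: "real \<Rightarrow> real"
    and f f' :: "(real \<Rightarrow> real) \<Rightarrow> real"
    and Df C :: "(real \<Rightarrow> real) set"
    and M :: "'a measure" and M' :: "'b measure" and M0 :: "'c measure"
    and X :: "nat \<Rightarrow> 'a \<Rightarrow> real"
    and Fs :: "nat \<Rightarrow> 'a \<times> 'b \<Rightarrow> real \<Rightarrow> real"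
    and B :: "'c \<Rightarrow> real \<Rightarrow> real"
    and a :: "nat \<Rightarrow> real"
  assumes weight: "weight_function \<phi>"
    and Df: "Df \<subseteq> {G. \<exists>\<mu>. finite_borel_measure \<mu> \<and> G = cdf \<mu>}"
    and F: "F \<in> Df" "\<exists>\<mu>. real_distribution \<mu> \<and> F = cdf \<mu>"
    and C: "C \<subseteq> Dphi \<phi>" "fun_subspace C" "separable_space (subtopology (Dphi_top \<phi>) C)"
      "C \<in> sets (Dphi_sigma \<phi>)"
    and prob: "prob_space M" "prob_space M'" "prob_space M0"
    and X: "\<forall>i\<ge>1. X i \<in> borel_measurable M \<and> cdf (distr M borel (X i)) = F"
    and emp_Df: "\<forall>n\<ge>1. \<forall>\<omega>\<in>space M. emp_df X n \<omega> \<in> Df"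
    and Fs_Df: "\<forall>n\<ge>1. \<forall>w\<in>space (M \<Otimes>\<^sub>M M'). Fs n w \<in> Df"
    and a: "\<forall>n\<ge>1. 0 < a n" "filterlim a at_top sequentially"
  shows
    "let
       cond_a =
         ((\<forall>n\<ge>1. \<forall>\<omega>\<in>space M. scaled_diff (a n) (emp_df X n \<omega>) F \<in> Dphi \<phi>) \<and>
          B \<in> measurable M0 (Dphi_sigma \<phi>) \<and> (\<forall>\<omega>\<in>space M0. B \<omega> \<in> C) \<and>
          conv_distr (Dphi \<phi>) (dphi \<phi>)
            (\<lambda>n. M) (\<lambda>n \<omega>. scaled_diff (a n) (emp_df X n \<omega>) F) M0 B);
       cond_b = (\<forall>n\<ge>1. (\<lambda>\<omega>. f (emp_df X n \<omega>)) \<in> borel_measurable M);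
       cond_c = quasi_hadamard \<phi> f Df F C f';
       cond_d =
         (\<exists>g. (\<forall>x\<in>C. g x = f' x) \<and> fun_linear_on (Dphi \<phi>) g \<and>
            g \<in> borel_measurable (Dphi_sigma \<phi>) \<and>
            (\<forall>x\<in>C. topcontinuous_at (Dphi_top \<phi>) euclideanreal g x));
       cond_e = (\<forall>n\<ge>1. (\<lambda>w. f (Fs n w)) \<in> borel_measurable (M \<Otimes>\<^sub>M M'));
       boot_meas =
         (\<forall>n\<ge>1. (\<forall>w\<in>space (M \<Otimes>\<^sub>M M').
              scaled_diff (a n) (Fs n w) (emp_df X n (fst w)) \<in> Dphi \<phi>) \<and>
            (\<lambda>w. scaled_diff (a n) (Fs n w) (emp_df X n (fst w)))
              \<in> measurable (M \<Otimes>\<^sub>M M') (Dphi_sigma \<phi>));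
       cond_f =
         (boot_meas \<and>
          (AE \<omega> in M. conv_distr (Dphi \<phi>) (dphi \<phi>)
             (\<lambda>n. M') (\<lambda>n \<omega>'. scaled_diff (a n) (Fs n (\<omega>, \<omega>')) (emp_df X n \<omega>)) M0 B));
       P = (\<lambda>n \<omega>. distr M' (Dphi_sigma \<phi>)
              (\<lambda>\<omega>'. scaled_diff (a n) (Fs n (\<omega>, \<omega>')) (emp_df X n \<omega>)));
       cond_f' =
         (boot_meas \<and>
          (\<forall>\<delta>>0. (\<lambda>n. outer_measure_of M
             {\<omega> \<in> space M. dBL (Dphi \<phi>) (dphi \<phi>) (P n \<omega>) (distr M0 (Dphi_sigma \<phi>) B) \<ge> \<delta>})
             \<longlonglongrightarrow> 0));
       Pt = (\<lambda>n \<omega>. distr M' borel (\<lambda>\<omega>'. a n * (f (Fs n (\<omega>, \<omega>')) - f (emp_df X n \<omega>))));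
       S = (\<lambda>n \<delta>. {\<omega> \<in> space M.
              dBL UNIV dist (Pt n \<omega>) (distr M0 borel (\<lambda>\<omega>0. f' (B \<omega>0))) \<ge> \<delta>});
       concl_i =
         ((\<forall>n\<ge>1. (\<lambda>\<omega>. a n * (f (emp_df X n \<omega>) - f F)) \<in> borel_measurable M) \<and>
          (\<lambda>\<omega>0. f' (B \<omega>0)) \<in> borel_measurable M0 \<and>
          conv_distr UNIV dist (\<lambda>n. M) (\<lambda>n \<omega>. a n * (f (emp_df X n \<omega>) - f F))
            M0 (\<lambda>\<omega>0. f' (B \<omega>0)));
       concl_ii =
         ((\<forall>n\<ge>1. (\<lambda>w. a n * (f (Fs n w) - f (emp_df X n (fst w))))
              \<in> borel_measurable (M \<Otimes>\<^sub>M M')) \<and>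
          (\<lambda>\<omega>0. f' (B \<omega>0)) \<in> borel_measurable M0 \<and>
          (\<forall>\<delta>>0. (\<forall>n\<ge>1. S n \<delta> \<in> sets M) \<and> (\<lambda>n. measure M (S n \<delta>)) \<longlonglongrightarrow> 0))
     in
       (cond_a \<and> cond_b \<and> cond_c \<longrightarrow> concl_i) \<and>
       (cond_a \<and> cond_b \<and> cond_c \<and> cond_d \<and> cond_e \<and> cond_f \<longrightarrow> concl_ii) \<and>
       (cond_a \<and> cond_b \<and> cond_c \<and> cond_d \<and> cond_e \<and> cond_f' \<longrightarrow> concl_ii)"
proof -
  note a1 = a(1)[rule_format]
  note emp = emp_Df[rule_format]
  note Fs = Fs_Df[rule_format]
  let ?V = "\<lambda>n w. scaled_diff (a n) (Fs n w) (emp_df X n (fst w))"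
  let ?b = "\<lambda>n \<omega>. dBL (Dphi \<phi>) (dphi \<phi>)
    (distr M' (Dphi_sigma \<phi>) (\<lambda>\<omega>'. scaled_diff (a n) (Fs n (\<omega>, \<omega>')) (emp_df X n \<omega>))) (distr M0 (Dphi_sigma \<phi>) B)"
  have b2: "?b n \<omega> \<le> 2" if "?V n \<in> measurable (M \<Otimes>\<^sub>M M') (Dphi_sigma \<phi>)" "B \<in> measurable M0 (Dphi_sigma \<phi>)"
    "\<omega> \<in> space M" for n \<omega>
  proof -
    have "(\<lambda>\<omega>'. scaled_diff (a n) (Fs n (\<omega>, \<omega>')) (emp_df X n \<omega>)) \<in> measurable M' (Dphi_sigma \<phi>)"
      using measurable_compose[OF measurable_Pair1'[OF that(3)] that(1)] by simp
    note pr = prob_space.prob_space_distr[OF prob(2) this] prob_space.prob_space_distr[OF prob(3) that(2)]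
    show ?thesis
      by (rule Metric_space.dBL_leI[OF Metric_space_Dphi[OF weight]], rule BL1_integral_diff_le[OF pr])
        (use sets_ball_sigma_Dphi[OF weight] in auto)
  qed
  show ?thesis
    unfolding Let_def
  proof (rule conjI[OF impI conjI[OF impI impI]], goal_cases)
    case 1
    then have qh: "quasi_hadamard \<phi> f Df F C f'" by blast
    note dm = quasi_hadamard_delta_method[OF weight C(1,3) prob(1,3) a1 a(2) emp _ _ _ _ qh]
    show ?case
      using 1 by (intro conjI allI impI dm) auto
  next
    case 2
    then have qh: "quasi_hadamard \<phi> f Df F C f'"
      and GD: "\<And>n \<omega>. n \<ge> 1 \<Longrightarrow> \<omega> \<in> space M \<Longrightarrow> scaled_diff (a n) (emp_df X n \<omega>) F \<in> Dphi \<phi>"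
      and conv: "conv_distr (Dphi \<phi>) (dphi \<phi>) (\<lambda>n. M) (\<lambda>n \<omega>. scaled_diff (a n) (emp_df X n \<omega>) F) M0 B"
      and Bm: "B \<in> measurable M0 (Dphi_sigma \<phi>)" and BC: "\<And>\<omega>. \<omega> \<in> space M0 \<Longrightarrow> B \<omega> \<in> C"
      and fG: "\<And>n. n \<ge> 1 \<Longrightarrow> (\<lambda>\<omega>. f (emp_df X n \<omega>)) \<in> borel_measurable M"
      and fFs: "\<And>n. n \<ge> 1 \<Longrightarrow> (\<lambda>w. f (Fs n w)) \<in> borel_measurable (M \<Otimes>\<^sub>M M')"
      and V: "\<And>n. n \<ge> 1 \<Longrightarrow> ?V n \<in> measurable (M \<Otimes>\<^sub>M M') (Dphi_sigma \<phi>)"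
      and AEc: "AE \<omega> in M. conv_distr (Dphi \<phi>) (dphi \<phi>)
        (\<lambda>n. M') (\<lambda>n \<omega>'. scaled_diff (a n) (Fs n (\<omega>, \<omega>')) (emp_df X n \<omega>)) M0 B"
      by blast+
    from 2 obtain g where g: "\<And>x. x \<in> C \<Longrightarrow> g x = f' x" "fun_linear_on (Dphi \<phi>) g"
      "g \<in> borel_measurable (Dphi_sigma \<phi>)" "\<And>x. x \<in> C \<Longrightarrow> topcontinuous_at (Dphi_top \<phi>) euclideanreal g x"
      by blast
    \<comment> \<open>For each good \<open>\<omega>\<close> the conditional convergence has a limit
      with values in the separable set \<open>C\<close>, so it is convergence in the bounded
      Lipschitz distance; no measurability of the distance in \<open>\<omega>\<close> is
      claimed.\<close>
    have AEb: "AE \<omega> in M. (\<lambda>n. ?b n \<omega>) \<longlonglongrightarrow> 0"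
      using AEc
    proof eventually_elim
      case (elim \<omega>)
      show ?case
        unfolding distr_Dphi_sigma_eq[OF weight]
        using Metric_space.conv_distr_imp_dBL_tendsto_0[OF Metric_space_Dphi[OF weight] elim prob(2,3) C(1,3) BC] .
    qed
    have ctrl: "(\<lambda>n. \<integral>\<omega>. T n \<omega> \<partial>M) \<longlonglongrightarrow> 0"
      if "\<And>n. n \<ge> 1 \<Longrightarrow> T n \<in> borel_measurable M"
        and "\<And>n \<omega>. n \<ge> 1 \<Longrightarrow> \<omega> \<in> space M \<Longrightarrow> 0 \<le> T n \<omega> \<and> T n \<omega> \<le> ?b n \<omega>" for T
      by (rule integral_tendsto_0_of_AE_dominated[OF prob(1) that(1) _ AEb]) (use that(2) b2[OF V Bm] in blast)+
    note bs = quasi_hadamard_bootstrap[OF weight C(1-3) prob a1 a(2) emp GD conv BC fG qh g Fs fFs V ctrl]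
    show ?case
      by (intro conjI allI impI; rule bs quasi_hadamard_delta_method(2)[OF weight C(1,3) prob(1,3) a1 a(2) emp GD conv BC fG qh])
  next
    case 3
    then have qh: "quasi_hadamard \<phi> f Df F C f'"
      and GD: "\<And>n \<omega>. n \<ge> 1 \<Longrightarrow> \<omega> \<in> space M \<Longrightarrow> scaled_diff (a n) (emp_df X n \<omega>) F \<in> Dphi \<phi>"
      and conv: "conv_distr (Dphi \<phi>) (dphi \<phi>) (\<lambda>n. M) (\<lambda>n \<omega>. scaled_diff (a n) (emp_df X n \<omega>) F) M0 B"
      and Bm: "B \<in> measurable M0 (Dphi_sigma \<phi>)" and BC: "\<And>\<omega>. \<omega> \<in> space M0 \<Longrightarrow> B \<omega> \<in> C"
      and fG: "\<And>n. n \<ge> 1 \<Longrightarrow> (\<lambda>\<omega>. f (emp_df X n \<omega>)) \<in> borel_measurable M"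
      and fFs: "\<And>n. n \<ge> 1 \<Longrightarrow> (\<lambda>w. f (Fs n w)) \<in> borel_measurable (M \<Otimes>\<^sub>M M')"
      and V: "\<And>n. n \<ge> 1 \<Longrightarrow> ?V n \<in> measurable (M \<Otimes>\<^sub>M M') (Dphi_sigma \<phi>)"
      and out: "\<And>\<delta>. \<delta> > 0 \<Longrightarrow> (\<lambda>n. outer_measure_of M {\<omega> \<in> space M. ?b n \<omega> \<ge> \<delta>}) \<longlonglongrightarrow> 0"
      by blast+
    from 3 obtain g where g: "\<And>x. x \<in> C \<Longrightarrow> g x = f' x" "fun_linear_on (Dphi \<phi>) g"
      "g \<in> borel_measurable (Dphi_sigma \<phi>)" "\<And>x. x \<in> C \<Longrightarrow> topcontinuous_at (Dphi_top \<phi>) euclideanreal g x"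
      by blast
    have ctrl: "(\<lambda>n. \<integral>\<omega>. T n \<omega> \<partial>M) \<longlonglongrightarrow> 0"
      if "\<And>n. n \<ge> 1 \<Longrightarrow> T n \<in> borel_measurable M"
        and "\<And>n \<omega>. n \<ge> 1 \<Longrightarrow> \<omega> \<in> space M \<Longrightarrow> 0 \<le> T n \<omega> \<and> T n \<omega> \<le> ?b n \<omega>" for T
      by (rule integral_tendsto_0_of_outer_dominated[OF prob(1) that(1) _ out]) (use that(2) b2[OF V Bm] in blast)+
    note bs = quasi_hadamard_bootstrap[OF weight C(1-3) prob a1 a(2) emp GD conv BC fG qh g Fs fFs V ctrl]
    show ?case
      by (intro conjI allI impI; rule bs quasi_hadamard_delta_method(2)[OF weight C(1,3) prob(1,3) a1 a(2) emp GD conv BC fG qh])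
  qed
qed

end
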